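(* For every integer $\ell\geq 1$ and every $c>0$ there exist $c_0>0$, $c_1>0$, $c_2>0$ such that, if $q^\ell\geq c_0\log(n)/n$ and $pq^{\ell-1}\geq c_0\log(n)/n$ (where $q=1-p$), then with probability at least $1-n^{-c}$, $$c_1\sqrt{nq^\ell/p}\leq \vartheta_\ell(G(n,p))\leq c_2\sqrt{nq^\ell/p}.$$
   Context: $G(n,p)$ is the Erdős–Rényi random graph on vertex set $[n]=\{1,\dots,n\}$ in which each pair is an edge independently with probability $p=p(n)$. For a graph $G$ on $[n]$, an independent set is a set of vertices containing no edge; $\operatorname{Ind}_i$ is the set of independent sets with $i+1$ elements. For $F=\{x_0<\dots<x_i\}\subseteq[n]$ and $K\subset F$ with $F\setminus K=\{x_j\}$ set $[F:K]=(-1)^j$; for distinct equal-size $F,F'$ with $|F\cap F'|=|F|-1$ put $\epsilon_{F,F'}=[F:F\cap F'][F':F\cap F']$, otherwise $0$. For $\ell\geq1$ such that $G$ has an independent set of size $\ell$, let $L^{\downarrow}_{\ell-1}(\operatorname{Ind})$ be the matrix indexed by $\operatorname{Ind}_{\ell-1}$ with diagonal entries $\ell$ and off-diagonal entries $\epsilon_{F,F'}$, and define $\vartheta_\ell(G)$ as the supremum of $\operatorname{trace}(L^{\downarrow}_{\ell-1}(\operatorname{Ind})Y)$ over real symmetric positive semidefinite $Y$ indexed by $\operatorname{Ind}_{\ell-1}$ with $\operatorname{trace}(Y)=1$, $Y_{F,F'}=0$ whenever $F\cup F'$ is an $(\ell+1)$-subset of $[n]$ that is not independent, $Y_{F,F'}=0$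 whenever $|F\cup F'|\geq\ell+2$, and $\epsilon_{F,F'}Y_{F,F'}=\epsilon_{F'',F^\dagger}Y_{F'',F^\dagger}$ whenever $F\cup F'=F''\cup F^\dagger$ has $\ell+1$ elements. (For $\ell=1$ this is the Lovász theta number of $G$.) *)

theory Defs
  imports "HOL-Probability.Probability"
begin

text \<open>A graph on \<open>{1..n}\<close> is given by its edge set, a set of two-element subsets of \<open>{1..n}\<close>.\<close>

definition vertex_pairs :: "nat \<Rightarrow> nat set set" where
  "vertex_pairs n = {e. e \<subseteq> {1..n} \<and> card e = 2}"

definition Gnp :: "nat \<Rightarrow> real \<Rightarrow> nat set set pmf" where
  "Gnp n p = map_pmf (\<lambda>f. {e \<in> vertex_pairs n. f e})
     (Pi_pmf (vertex_pairs n) False (\<lambda>_. bernoulli_pmf p))"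

definition independent :: "nat \<Rightarrow> nat set set \<Rightarrow> nat set \<Rightarrow> bool" where
  "independent n E F \<longleftrightarrow> F \<subseteq> {1..n} \<and> (\<forall>e\<in>E. \<not> e \<subseteq> F)"

definition Ind :: "nat \<Rightarrow> nat set set \<Rightarrow> nat \<Rightarrow> nat set set" where
  "Ind n E i = {F. independent n E F \<and> card F = i + 1}"

text \<open>If \<open>F = {x\<^sub>0 < \<dots> < x\<^sub>i}\<close> and \<open>F - K = {x\<^sub>j}\<close>, then \<open>j\<close> is the number of elements of \<open>F\<close>
  below \<open>x\<^sub>j\<close>, so \<open>[F:K]\<close> equals \<open>(-1)^j\<close>; see the lemma that follows. The value is
  meaningful only when \<open>F - K\<close> is a singleton.\<close>

definition incidence :: "nat set \<Rightarrow> nat set \<Rightarrow> int" where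
  "incidence F K = (-1) ^ card {y \<in> F. y < the_elem (F - K)}"

lemma incidence_sorted_list:
  assumes "finite F" "j < card F" "F - K = {sorted_list_of_set F ! j}"
  shows "incidence F K = (-1) ^ j"
proof -
  define xs where "xs = sorted_list_of_set F"
  have xs: "sorted_wrt (<) xs" "set xs = F" "length xs = card F"
    using assms(1) by (auto simp: xs_def strict_sorted_list_of_set)
  have mono: "xs ! a < xs ! b" if "a < b" "b < card F" for a b
    using sorted_wrt_nth_less[OF xs(1) that(1)] that(2) xs(3) by simp
  have "{y \<in> F. y < xs ! j} \<subseteq> (!) xs ` {..<j}"
  proof
    fix y assume "y \<in> {y \<in> F. y < xs ! j}"
    then obtain a where a: "a < card F" "y = xs ! a" "xs ! a < xs ! j"
      using xs(2,3) by (auto simp: set_conv_nth)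
    have "a < j"
      using mono[of j a] a by (cases a j rule: linorder_cases) auto
    then show "y \<in> (!) xs ` {..<j}"
      using a(2) by blast
  qed
  moreover have "(!) xs ` {..<j} \<subseteq> {y \<in> F. y < xs ! j}"
  proof
    fix y assume "y \<in> (!) xs ` {..<j}"
    then obtain a where a: "a < j" "y = xs ! a"
      by blast
    then have "y \<in> F"
      using nth_mem[of a xs] assms(2) xs(2,3) by simp
    then show "y \<in> {y \<in> F. y < xs ! j}"
      using a mono assms(2) by simp
  qed
  ultimately have "{y \<in> F. y < xs ! j} = (!) xs ` {..<j}"
    by (rule equalityI)
  moreover have "inj_on ((!) xs) {..<j}"
    using assms(2) xs(3) by (intro inj_onI) (auto simp: nth_eq_iff_index_eq xs_def)
  ultimately have "card {y \<in> F. y < xs ! j} = j"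
    by (simp add: card_image)
  then show ?thesis
    using assms(3) by (simp add: incidence_def xs_def)
qed

definition eps :: "nat set \<Rightarrow> nat set \<Rightarrow> real" where
  "eps F F' =
     (if F \<noteq> F' \<and> card F = card F' \<and> card (F \<inter> F') = card F - 1
      then of_int (incidence F (F \<inter> F') * incidence F' (F \<inter> F')) else 0)"

text \<open>Matrices indexed by a finite set \<open>I\<close> are functions of two arguments; only their values
  on \<open>I\<close> are used.\<close>

definition trace_mult_on :: "'i set \<Rightarrow> ('i \<Rightarrow> 'i \<Rightarrow> real) \<Rightarrow> ('i \<Rightarrow> 'i \<Rightarrow> real) \<Rightarrow> real" where
  "trace_mult_on I A B = (\<Sum>i\<in>I. \<Sum>j\<in>I. A i j * B j i)"

definition trace_on :: "'i set \<Rightarrow> ('i \<Rightarrow> 'i \<Rightarrow> real) \<Rightarrow> real" where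
  "trace_on I A = (\<Sum>i\<in>I. A i i)"

definition psd_on :: "'i set \<Rightarrow> ('i \<Rightarrow> 'i \<Rightarrow> real) \<Rightarrow> bool" where
  "psd_on I A \<longleftrightarrow> (\<forall>i\<in>I. \<forall>j\<in>I. A i j = A j i) \<and>
     (\<forall>v. 0 \<le> (\<Sum>i\<in>I. \<Sum>j\<in>I. v i * A i j * v j))"

definition down_laplacian :: "nat \<Rightarrow> nat set \<Rightarrow> nat set \<Rightarrow> real" where
  "down_laplacian l F F' = (if F = F' then real l else eps F F')"

definition theta_feasible ::
  "nat \<Rightarrow> nat set set \<Rightarrow> nat \<Rightarrow> (nat set \<Rightarrow> nat set \<Rightarrow> real) \<Rightarrow> bool" where
  "theta_feasible n E l Y \<longleftrightarrow>
     psd_on (Ind n E (l - 1)) Y \<and>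
     trace_on (Ind n E (l - 1)) Y = 1 \<and>
     (\<forall>F\<in>Ind n E (l - 1). \<forall>F'\<in>Ind n E (l - 1).
        card (F \<union> F') = l + 1 \<and> \<not> independent n E (F \<union> F') \<longrightarrow> Y F F' = 0) \<and>
     (\<forall>F\<in>Ind n E (l - 1). \<forall>F'\<in>Ind n E (l - 1). card (F \<union> F') \<ge> l + 2 \<longrightarrow> Y F F' = 0) \<and>
     (\<forall>F\<in>Ind n E (l - 1). \<forall>F'\<in>Ind n E (l - 1).
      \<forall>H\<in>Ind n E (l - 1). \<forall>H'\<in>Ind n E (l - 1).
        F \<union> F' = H \<union> H' \<and> card (F \<union> F') = l + 1 \<longrightarrow> eps F F' * Y F F' = eps H H' * Y H H')"

text \<open>Meaningful only if \<open>l \<ge> 1\<close> and \<open>Ind n E (l - 1)\<close> is nonempty. The feasible set is then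
  nonempty, and the objective is bounded on it since positive semidefinite matrices of trace 1
  have entries of absolute value at most 1, so the real supremum is the intended one.\<close>

definition vartheta :: "nat \<Rightarrow> nat \<Rightarrow> nat set set \<Rightarrow> real" where
  "vartheta l n E =
     (SUP Y \<in> {Y. theta_feasible n E l Y}. trace_mult_on (Ind n E (l - 1)) (down_laplacian l) Y)"

end

theory Submission
  imports Defs
begin

text \<open>Write \<open>q = 1 - p\<close>. For a set \<open>K\<close> of \<open>l - 1\<close> vertices let \<open>V\<^sub>K\<close> be the vertices outside \<open>K\<close> with no
  edge to \<open>K\<close>, and let \<open>X\<^sub>K\<close> be the centered adjacency matrix of the graph on \<open>V\<^sub>K\<close> (entries
  \<open>1 - p\<close> on edges and \<open>-p\<close> on non-edges). The objective and the dual certificate obtained from it by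
  subtracting \<open>1/p\<close> times adjacency are, up to signs, sums over \<open>K\<close> of forms on \<open>V\<^sub>K\<close> (Garland's
  method), and so is the primal matrix that is constant on the diagonal and proportional to
  \<open>\<epsilon>\<close> on pairs with independent union. If all \<open>X\<^sub>K\<close> have norm at
  most \<open>R\<close>, this gives \<open>\<theta> \<le> l(1 + R/p)\<close>, and if every \<open>l\<close>-set extends in at least \<open>n q\<^sup>l / 8\<close> ways also
  \<open>\<theta> \<ge> n q\<^sup>l / (8 l (q + R))\<close>.

  The bound \<open>R = O(\<surd>d)\<close>, \<open>d = n p q\<^sup>l\<close>, holds down to \<open>d\<close> of order \<open>log n\<close>. It comes from the trace
  of a power \<open>2k\<close> with \<open>d \<le> k \<le> 2d\<close>, averaged also over \<open>V\<^sub>K\<close>: only closed walks using every edge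
  at least twice contribute, and sorting them by shape compares the moment with that of a
  \<open>2k \<times> 2k\<close> matrix with independent entries in \<open>{2, -1}\<close>, whose norm is controlled by a net.
  Since \<open>k \<ge> d\<close>, which is a large multiple of \<open>log n\<close>, Markov's inequality gives any power of \<open>1/n\<close>.\<close>

section \<open>Powers of symmetric matrices and closed walks\<close>

text \<open>The obstacle is the sparse range. With \<open>d\<close> only of order
  \<open>log n\<close>, a plain union bound over a net does not give \<open>O(sqrt d)\<close> for
  the link matrix itself. Moving to a dense matrix removes this. A surviving walk on
  \<open>m\<close> vertices pays \<open>q ^ (l - 1)\<close> per vertex for lying among the common
  non-neighbours of \<open>K\<close>, and \<open>p q\<close> for each of its at least
  \<open>m - 1\<close> edges. Up to one factor \<open>p q\<close> this is \<open>t ^ m\<close> with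
  \<open>t = p q ^ l\<close>, so \<open>n\<close> vertices act like \<open>n t = d\<close>. On
  \<open>2 k\<close> vertices the dimension equals the order of the moment, and a net of size
  exponential in \<open>k\<close> costs a constant factor in the norm. Averaging over the common
  non-neighbours along with the edges spares any conditioning on them. The two bounds meet because
  \<open>s = sqrt (n q ^ l / p)\<close> satisfies \<open>sqrt d = p s\<close> and
  \<open>n q ^ l = p s ^ 2\<close>, so that \<open>R / p\<close> and \<open>n q ^ l / R\<close> both
  have order \<open>s\<close>. The extra terms \<open>1\<close> and \<open>q\<close> are absorbed by
  \<open>s \<ge> 1\<close> and \<open>q \<le> sqrt d\<close>, one from each hypothesis on
  \<open>p\<close>.\<close>

lemma sum_PiE_insert:
  fixes \<phi> :: "('i \<Rightarrow> 'a) \<Rightarrow> real"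
  assumes "x \<notin> S"
  shows "(\<Sum>w\<in>PiE (insert x S) T. \<phi> w) = (\<Sum>y\<in>T x. \<Sum>g\<in>PiE S T. \<phi> (g(x := y)))"
  unfolding PiE_insert_eq sum.reindex[OF inj_combinator[OF assms]] sum.cartesian_product
  by (simp add: case_prod_unfold)

fun mat_pow :: "'a set \<Rightarrow> ('a \<Rightarrow> 'a \<Rightarrow> real) \<Rightarrow> nat \<Rightarrow> 'a \<Rightarrow> 'a \<Rightarrow> real" where
  "mat_pow V M 0 = (\<lambda>a b. if a = b then 1 else 0)"
| "mat_pow V M (Suc k) = (\<lambda>a b. \<Sum>c\<in>V. mat_pow V M k a c * M c b)"

lemma mat_pow_add:
  assumes "finite V" "b \<in> V"
  shows "mat_pow V M (j + k) a b = (\<Sum>c\<in>V. mat_pow V M j a c * mat_pow V M k c b)"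
  using assms(2)
proof (induction k arbitrary: b)
  case 0
  then show ?case using assms(1) by (simp add: if_distrib cong: if_cong)
next
  case (Suc k)
  have "mat_pow V M (j + Suc k) a b = (\<Sum>d\<in>V. (\<Sum>c\<in>V. mat_pow V M j a c * mat_pow V M k c d) * M d b)"
    using Suc.IH by simp
  also have "\<dots> = (\<Sum>c\<in>V. \<Sum>d\<in>V. mat_pow V M j a c * mat_pow V M k c d * M d b)"
    by (subst sum.swap) (simp add: sum_distrib_right)
  finally show ?case by (simp add: sum_distrib_left mult.assoc)
qed

lemma mat_pow_sym:
  assumes "finite V" "\<And>a b. a \<in> V \<Longrightarrow> b \<in> V \<Longrightarrow> M a b = M b a" "a \<in> V" "b \<in> V"
  shows "mat_pow V M k a b = mat_pow V M k b a"
  using assms(3,4)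
proof (induction k arbitrary: a b)
  case (Suc k)
  have "mat_pow V M (1 + k) b a = (\<Sum>c\<in>V. mat_pow V M 1 b c * mat_pow V M k c a)"
    by (rule mat_pow_add[OF assms(1)]) (use Suc in auto)
  also have "\<dots> = (\<Sum>c\<in>V. mat_pow V M k a c * M c b)"
  proof (rule sum.cong)
    fix c assume c: "c \<in> V"
    have "mat_pow V M 1 b c = M b c"
      using assms(1) Suc.prems by (simp add: if_distrib if_distribR sum.delta' cong: if_cong)
    then show "mat_pow V M 1 b c * mat_pow V M k c a = mat_pow V M k a c * M c b"
      using Suc c assms(2)[of b c] by simp
  qed simp
  finally show ?case by simp
qed simp

lemma trace_mat_pow_double:
  assumes "finite V" "\<And>a b. a \<in> V \<Longrightarrow> b \<in> V \<Longrightarrow> M a b = M b a"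
  shows "(\<Sum>a\<in>V. mat_pow V M (2 * k) a a) = (\<Sum>a\<in>V. \<Sum>b\<in>V. (mat_pow V M k a b)\<^sup>2)"
proof (rule sum.cong)
  fix a assume a: "a \<in> V"
  have "mat_pow V M (k + k) a a = (\<Sum>c\<in>V. mat_pow V M k a c * mat_pow V M k c a)"
    by (rule mat_pow_add[OF assms(1) a])
  also have "\<dots> = (\<Sum>c\<in>V. (mat_pow V M k a c)\<^sup>2)"
    by (rule sum.cong) (use mat_pow_sym[OF assms] a in \<open>auto simp: power2_eq_square\<close>)
  finally show "mat_pow V M (2 * k) a a = (\<Sum>b\<in>V. (mat_pow V M k a b)\<^sup>2)"
    by (simp add: mult_2)
qed simp

lemma quadratic_form_power_le:
  assumes "finite V" "\<And>a b. a \<in> V \<Longrightarrow> b \<in> V \<Longrightarrow> M a b = M b a"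
  shows "(\<Sum>a\<in>V. \<Sum>b\<in>V. x a * M a b * x b) ^ (2 ^ s)
    \<le> (\<Sum>a\<in>V. (x a)\<^sup>2) ^ (2 ^ s - 1) * (\<Sum>a\<in>V. \<Sum>b\<in>V. x a * mat_pow V M (2 ^ s) a b * x b)"
proof (induction s)
  case 0
  have "(\<Sum>a\<in>V. \<Sum>b\<in>V. x a * M a b * x b) = (\<Sum>a\<in>V. \<Sum>b\<in>V. x a * mat_pow V M (Suc 0) a b * x b)"
    using assms(1) by (intro sum.cong) (auto simp: if_distrib if_distribR sum.delta' cong: if_cong)
  then show ?case by simp
next
  case (Suc s)
  define N where "N = (\<Sum>a\<in>V. (x a)\<^sup>2)"
  define P where "P = mat_pow V M (2 ^ s)"
  define y where "y a = (\<Sum>b\<in>V. P a b * x b)" for a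
  define q where "q = (\<Sum>a\<in>V. \<Sum>b\<in>V. x a * M a b * x b)"
  have N0: "N \<ge> 0" unfolding N_def by (simp add: sum_nonneg)
  have sym: "P a b = P b a" if "a \<in> V" "b \<in> V" for a b
    unfolding P_def using that by (intro mat_pow_sym assms)
  have A: "(\<Sum>a\<in>V. \<Sum>b\<in>V. x a * P a b * x b) = (\<Sum>a\<in>V. x a * y a)"
    by (simp add: y_def sum_distrib_left mult.assoc)
  have B: "(\<Sum>a\<in>V. \<Sum>b\<in>V. x a * mat_pow V M (2 ^ Suc s) a b * x b) = (\<Sum>a\<in>V. (y a)\<^sup>2)"
  proof -
    have "(\<Sum>a\<in>V. \<Sum>b\<in>V. x a * mat_pow V M (2 ^ Suc s) a b * x b)
        = (\<Sum>a\<in>V. \<Sum>b\<in>V. x a * (\<Sum>c\<in>V. P a c * P c b) * x b)"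
      using mat_pow_add[OF assms(1), of _ M "2 ^ s" "2 ^ s"] by (simp add: mult_2 P_def)
    also have "\<dots> = (\<Sum>a\<in>V. \<Sum>b\<in>V. \<Sum>c\<in>V. (P c a * x a) * (P c b * x b))"
      unfolding sum_distrib_left sum_distrib_right
      by (intro sum.cong refl) (simp add: sym)
    also have "\<dots> = (\<Sum>a\<in>V. \<Sum>c\<in>V. \<Sum>b\<in>V. (P c a * x a) * (P c b * x b))"
      by (intro sum.cong refl sum.swap)
    also have "\<dots> = (\<Sum>c\<in>V. \<Sum>a\<in>V. \<Sum>b\<in>V. (P c a * x a) * (P c b * x b))"
      by (rule sum.swap)
    also have "\<dots> = (\<Sum>c\<in>V. (y c)\<^sup>2)"
      by (simp add: y_def power2_eq_square sum_product)
    finally show ?thesis .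
  qed
  \<comment> \<open>Squaring the induction hypothesis needs a nonnegative left side. An even power
    provides it; for \<open>s = 0\<close> the form may be negative, but then the hypothesis is an
    equality.\<close>
  have "(q ^ 2 ^ s)\<^sup>2 \<le> (N ^ (2 ^ s - 1) * (\<Sum>a\<in>V. x a * y a))\<^sup>2"
    if "s \<noteq> 0"
    by (rule power_mono) (use Suc.IH that in \<open>auto simp: A[symmetric] q_def N_def P_def zero_le_even_power\<close>)
  moreover have "q = (\<Sum>a\<in>V. x a * y a)" if "s = 0"
    unfolding q_def A[symmetric] P_def that
    using assms(1) by (intro sum.cong) (auto simp: if_distrib if_distribR sum.delta' cong: if_cong)
  ultimately have "(q ^ 2 ^ s)\<^sup>2 \<le> (N ^ (2 ^ s - 1) * (\<Sum>a\<in>V. x a * y a))\<^sup>2"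
    by (cases "s = 0") auto
  also have "\<dots> \<le> (N ^ (2 ^ s - 1))\<^sup>2 * (N * (\<Sum>a\<in>V. (y a)\<^sup>2))"
    unfolding power_mult_distrib N_def
    by (rule mult_left_mono[OF Cauchy_Schwarz_ineq_sum]) simp
  also have "\<dots> = N ^ (2 * (2 ^ s - 1) + 1) * (\<Sum>a\<in>V. (y a)\<^sup>2)"
    by (simp add: power_add power_mult mult.assoc power_even_eq flip: power_mult)
  also have "2 * (2 ^ s - 1) + 1 = (2 ^ Suc s - 1 :: nat)"
    using one_le_power[of "2::nat" s] unfolding power_Suc by arith
  also have "(q ^ 2 ^ s)\<^sup>2 = q ^ 2 ^ Suc s"
    by (simp add: power_mult[symmetric] mult.commute)
  finally show ?case by (simp only: q_def B N_def)
qed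

text \<open>The last step bounds \<open>|M\<^sup>kx|\<^sup>2\<close> by \<open>|x|\<^sup>2\<close> times the squared Frobenius norm of \<open>M\<^sup>k\<close>, so no
  spectral theorem is needed.\<close>

lemma quadratic_form_power_le_trace:
  assumes "finite V" "\<And>a b. a \<in> V \<Longrightarrow> b \<in> V \<Longrightarrow> M a b = M b a"
  shows "(\<Sum>a\<in>V. \<Sum>b\<in>V. x a * M a b * x b) ^ (2 ^ Suc s)
    \<le> (\<Sum>a\<in>V. (x a)\<^sup>2) ^ (2 ^ Suc s) * (\<Sum>a\<in>V. mat_pow V M (2 ^ Suc s) a a)"
proof -
  define N where "N = (\<Sum>a\<in>V. (x a)\<^sup>2)"
  define Q where "Q = mat_pow V M (2 ^ s)"
  have N0: "N \<ge> 0" unfolding N_def by (simp add: sum_nonneg)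
  have sym: "Q a b = Q b a" if "a \<in> V" "b \<in> V" for a b
    unfolding Q_def using that by (intro mat_pow_sym assms)
  have "(\<Sum>a\<in>V. \<Sum>b\<in>V. x a * mat_pow V M (2 ^ Suc s) a b * x b)
        = (\<Sum>a\<in>V. \<Sum>b\<in>V. x a * (\<Sum>c\<in>V. Q a c * Q c b) * x b)"
    using mat_pow_add[OF assms(1), of _ M "2 ^ s" "2 ^ s"] by (simp add: mult_2 Q_def)
  also have "\<dots> = (\<Sum>a\<in>V. \<Sum>b\<in>V. \<Sum>c\<in>V. (Q c a * x a) * (Q c b * x b))"
    unfolding sum_distrib_left sum_distrib_right
    by (intro sum.cong refl) (simp add: sym)
  also have "\<dots> = (\<Sum>a\<in>V. \<Sum>c\<in>V. \<Sum>b\<in>V. (Q c a * x a) * (Q c b * x b))"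
    by (intro sum.cong refl sum.swap)
  also have "\<dots> = (\<Sum>c\<in>V. \<Sum>a\<in>V. \<Sum>b\<in>V. (Q c a * x a) * (Q c b * x b))"
    by (rule sum.swap)
  also have "\<dots> = (\<Sum>c\<in>V. (\<Sum>a\<in>V. Q c a * x a)\<^sup>2)"
    by (simp add: power2_eq_square sum_product)
  also have "\<dots> \<le> (\<Sum>c\<in>V. (\<Sum>a\<in>V. (Q c a)\<^sup>2) * N)"
    unfolding N_def by (rule sum_mono) (rule Cauchy_Schwarz_ineq_sum)
  also have "\<dots> = N * (\<Sum>a\<in>V. mat_pow V M (2 ^ Suc s) a a)"
    using trace_mat_pow_double[OF assms, where k = "2 ^ s"] by (simp add: Q_def sum_distrib_left mult.commute)
  finally have "(\<Sum>a\<in>V. \<Sum>b\<in>V. x a * M a b * x b) ^ (2 ^ Suc s)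
      \<le> N ^ (2 ^ Suc s - 1) * (N * (\<Sum>a\<in>V. mat_pow V M (2 ^ Suc s) a a))"
    using quadratic_form_power_le[OF assms, where x = x and s = "Suc s"] N0
    unfolding N_def[symmetric] by (meson mult_left_mono order_trans zero_le_power)
  also have "\<dots> = N ^ (Suc (2 ^ Suc s - 1)) * (\<Sum>a\<in>V. mat_pow V M (2 ^ Suc s) a a)"
    by (simp only: power_Suc2 mult.assoc)
  finally show ?thesis by (simp add: N_def)
qed

text \<open>The trace of the \<open>2k\<close>-th power is the sum of the squared lengths of the
  rows of the \<open>k\<close>-th power, and each further factor \<open>M\<close> stretches a row by
  at most \<open>B\<close>.\<close>

lemma trace_mat_pow_le:
  assumes "finite V" and sym: "\<And>a b. a \<in> V \<Longrightarrow> b \<in> V \<Longrightarrow> M a b = M b a"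
    and bd: "\<And>x. (\<Sum>a\<in>V. (\<Sum>b\<in>V. M a b * x b)\<^sup>2) \<le> B\<^sup>2 * (\<Sum>b\<in>V. (x b)\<^sup>2)"
  shows "(\<Sum>a\<in>V. mat_pow V M (2 * k) a a) \<le> real (card V) * B ^ (2 * k)"
proof -
  have "(\<Sum>b\<in>V. (mat_pow V M k a b)\<^sup>2) \<le> B ^ (2 * k)" if "a \<in> V" for a
  proof (induction k)
    case 0
    have "(\<Sum>b\<in>V. (if a = b then 1 else 0 :: real)\<^sup>2) = (\<Sum>b\<in>V. if a = b then 1 else 0)"
      by (rule sum.cong) auto
    then show ?case using assms(1) by simp
  next
    case (Suc k)
    have "(\<Sum>b\<in>V. (mat_pow V M (Suc k) a b)\<^sup>2) = (\<Sum>b\<in>V. (\<Sum>c\<in>V. M b c * mat_pow V M k a c)\<^sup>2)"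
      by (simp add: sym mult.commute cong: sum.cong)
    also have "\<dots> \<le> B\<^sup>2 * (\<Sum>b\<in>V. (mat_pow V M k a b)\<^sup>2)"
      by (rule bd)
    also have "\<dots> \<le> B\<^sup>2 * B ^ (2 * k)"
      by (rule mult_left_mono[OF Suc]) simp
    finally show ?case by (simp add: power2_eq_square)
  qed
  then have "(\<Sum>a\<in>V. \<Sum>b\<in>V. (mat_pow V M k a b)\<^sup>2) \<le> (\<Sum>a\<in>V. B ^ (2 * k))"
    by (intro sum_mono)
  then show ?thesis by (subst trace_mat_pow_double[OF assms(1) sym]) auto
qed

section \<open>Traces of powers as sums over closed walks\<close>

definition closed_walks :: "'a set \<Rightarrow> nat \<Rightarrow> (nat \<Rightarrow> 'a) set" where
  "closed_walks V N = {w \<in> {..N} \<rightarrow>\<^sub>E V. w 0 = w N}"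

lemma finite_closed_walks: "finite V \<Longrightarrow> finite (closed_walks V N)"
  by (simp add: closed_walks_def finite_PiE)

text \<open>The arbitrary weight \<open>h\<close> on the endpoints carries the induction: when the
  last vertex is split off, the factor of the last step becomes part of the weight of the shorter
  walk.\<close>

lemma sum_walks:
  assumes "finite V"
  shows "(\<Sum>w\<in>{..N} \<rightarrow>\<^sub>E V. (\<Prod>i<N. M (w i) (w (Suc i))) * h (w 0) (w N))
    = (\<Sum>a\<in>V. \<Sum>b\<in>V. mat_pow V M N a b * h a b)"
proof (induction N arbitrary: h)
  case 0
  have "(\<Sum>w\<in>{..0::nat} \<rightarrow>\<^sub>E V. h (w 0) (w 0)) = (\<Sum>a\<in>V. h a a)"
    unfolding atMost_0 by (subst sum_PiE_insert) simp_all
  then show ?case using assms by (simp add: if_distrib if_distribR sum.delta cong: if_cong)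
next
  case (Suc N)
  have "{..Suc N} = insert (Suc N) {..N}" by auto
  then have "(\<Sum>w\<in>{..Suc N} \<rightarrow>\<^sub>E V. (\<Prod>i<Suc N. M (w i) (w (Suc i))) * h (w 0) (w (Suc N)))
     = (\<Sum>b\<in>V. \<Sum>w\<in>{..N} \<rightarrow>\<^sub>E V. (\<Prod>i<N. M (w i) (w (Suc i))) * (M (w N) b * h (w 0) b))"
    by (simp add: sum_PiE_insert mult.assoc)
  also have "\<dots> = (\<Sum>b\<in>V. \<Sum>a\<in>V. \<Sum>c\<in>V. mat_pow V M N a c * (M c b * h a b))"
    by (simp add: Suc.IH[of "\<lambda>a c. M c _ * h a _"])
  also have "\<dots> = (\<Sum>a\<in>V. \<Sum>b\<in>V. mat_pow V M (Suc N) a b * h a b)"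
    by (subst sum.swap) (simp add: sum_distrib_right mult.assoc)
  finally show ?case .
qed

lemma trace_mat_pow_eq_sum_closed_walks:
  assumes "finite V"
  shows "(\<Sum>a\<in>V. mat_pow V M N a a) = (\<Sum>w\<in>closed_walks V N. \<Prod>i<N. M (w i) (w (Suc i)))"
proof -
  have "(\<Sum>w\<in>closed_walks V N. \<Prod>i<N. M (w i) (w (Suc i)))
      = (\<Sum>w\<in>{..N} \<rightarrow>\<^sub>E V. (\<Prod>i<N. M (w i) (w (Suc i))) * (if w 0 = w N then 1 else 0))"
    unfolding closed_walks_def using assms
    by (subst sum.inter_filter) (auto simp: finite_PiE intro!: sum.cong)
  also have "\<dots> = (\<Sum>a\<in>V. \<Sum>b\<in>V. mat_pow V M N a b * (if a = b then 1 else 0))"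
    by (rule sum_walks[OF assms])
  finally show ?thesis using assms by (simp add: if_distrib sum.delta cong: if_cong)
qed

section \<open>Expectations over the random graph\<close>

lemma finite_vertex_pairs: "finite (vertex_pairs n)"
  unfolding vertex_pairs_def by (rule finite_subset[of _ "Pow {1..n}"]) auto

lemma doubleton_in_vertex_pairs: "{i, j} \<in> vertex_pairs n \<longleftrightarrow> i \<in> {1..n} \<and> j \<in> {1..n} \<and> i \<noteq> j"
  by (auto simp: vertex_pairs_def card_insert_if)

lemma set_pmf_Gnp: "set_pmf (Gnp n p) \<subseteq> Pow (vertex_pairs n)"
  by (auto simp: Gnp_def)

lemma integrable_Gnp:
  fixes \<phi> :: "nat set set \<Rightarrow> real"
  shows "integrable (measure_pmf (Gnp n p)) \<phi>"
  by (rule integrable_measure_pmf_finite, rule finite_subset[OF set_pmf_Gnp])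
     (simp add: finite_vertex_pairs)

lemma expectation_Gnp:
  fixes \<phi> :: "nat set set \<Rightarrow> real"
  assumes p: "0 \<le> p" "p \<le> 1"
  shows "measure_pmf.expectation (Gnp n p) \<phi>
    = (\<Sum>S\<in>Pow (vertex_pairs n). \<phi> S * (\<Prod>e\<in>vertex_pairs n. if e \<in> S then p else 1 - p))"
proof -
  let ?P = "vertex_pairs n"
  let ?A = "(\<lambda>S e. e \<in> S) ` Pow ?P"
  let ?D = "Pi_pmf ?P False (\<lambda>_. bernoulli_pmf p)"
  have inj: "inj_on (\<lambda>S e. e \<in> S) (Pow ?P)"
    by (auto simp: inj_on_def fun_eq_iff)
  have "measure_pmf.expectation (Gnp n p) \<phi> = measure_pmf.expectation ?D (\<lambda>f. \<phi> {e \<in> ?P. f e})"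
    unfolding Gnp_def by simp
  also have "\<dots> = (\<Sum>f\<in>?A. \<phi> {e \<in> ?P. f e} * pmf ?D f)"
  proof (rule integral_measure_pmf_real)
    show "finite ?A" by (simp add: finite_vertex_pairs)
    fix f assume "f \<in> set_pmf ?D"
    then have "\<forall>x. x \<notin> ?P \<longrightarrow> \<not> f x"
      using set_Pi_pmf_subset[OF finite_vertex_pairs[of n], of False] by fastforce
    then have "{e. f e} \<in> Pow ?P" by auto
    then show "f \<in> ?A" by (intro image_eqI[of _ _ "{e. f e}"]) auto
  qed
  also have "\<dots> = (\<Sum>S\<in>Pow ?P. \<phi> {e \<in> ?P. e \<in> S} * pmf ?D (\<lambda>e. e \<in> S))"
    by (simp add: sum.reindex[OF inj])
  also have "\<dots> = (\<Sum>S\<in>Pow ?P. \<phi> S * (\<Prod>e\<in>?P. if e \<in> S then p else 1 - p))"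
  proof (rule sum.cong)
    fix S assume S: "S \<in> Pow ?P"
    then have "{e \<in> ?P. e \<in> S} = S" by auto
    moreover have "pmf ?D (\<lambda>e. e \<in> S) = (\<Prod>e\<in>?P. pmf (bernoulli_pmf p) (e \<in> S))"
      using S by (intro pmf_Pi' finite_vertex_pairs) auto
    moreover have "\<dots> = (\<Prod>e\<in>?P. if e \<in> S then p else 1 - p)"
      using p by (intro prod.cong) auto
    ultimately show "\<phi> {e \<in> ?P. e \<in> S} * pmf ?D (\<lambda>e. e \<in> S)
        = \<phi> S * (\<Prod>e\<in>?P. if e \<in> S then p else 1 - p)" by simp
  qed simp
  finally show ?thesis .
qed

text \<open>This is independence of the pairs. Multiplying out the product on the right means
  choosing "edge" or "non-edge" for every pair, which is a sum over all graphs.\<close>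

lemma expectation_Gnp_prod_all:
  assumes p: "0 \<le> p" "p \<le> 1"
  shows "measure_pmf.expectation (Gnp n p) (\<lambda>E. \<Prod>e\<in>vertex_pairs n. h e (e \<in> E) :: real)
    = (\<Prod>e\<in>vertex_pairs n. p * h e True + (1 - p) * h e False)"
proof -
  let ?P = "vertex_pairs n"
  have "(\<Prod>e\<in>?P. h e (e \<in> S)) * (\<Prod>e\<in>?P. if e \<in> S then p else 1 - p)
     = (\<Prod>e\<in>S. p * h e True) * (\<Prod>e\<in>?P-S. (1 - p) * h e False)" if "S \<in> Pow ?P" for S
  proof -
    have "(\<Prod>e\<in>?P. h e (e \<in> S)) * (\<Prod>e\<in>?P. if e \<in> S then p else 1 - p)
        = (\<Prod>e\<in>?P. h e (e \<in> S) * (if e \<in> S then p else 1 - p))"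
      by (simp add: prod.distrib)
    also have "\<dots> = (\<Prod>e\<in>?P-S. h e (e \<in> S) * (if e \<in> S then p else 1 - p))
        * (\<Prod>e\<in>S. h e (e \<in> S) * (if e \<in> S then p else 1 - p))"
      using that by (intro prod.subset_diff finite_vertex_pairs) auto
    also have "\<dots> = (\<Prod>e\<in>?P-S. (1 - p) * h e False) * (\<Prod>e\<in>S. p * h e True)"
      by (rule arg_cong2[where f = "(*)"]; rule prod.cong) (auto simp: mult.commute)
    finally show ?thesis by simp
  qed
  then show ?thesis
    unfolding expectation_Gnp[OF p] prod_add[OF finite_vertex_pairs] by (rule sum.cong[OF refl])
qed

lemma expectation_Gnp_prod:
  assumes p: "0 \<le> p" "p \<le> 1" and Q: "Q \<subseteq> vertex_pairs n"
  shows "measure_pmf.expectation (Gnp n p) (\<lambda>E. \<Prod>e\<in>Q. h e (e \<in> E) :: real)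
    = (\<Prod>e\<in>Q. p * h e True + (1 - p) * h e False)"
proof -
  define g where "g e b = (if e \<in> Q then h e b else 1)" for e b
  have *: "(\<Prod>e\<in>vertex_pairs n. f e) = (\<Prod>e\<in>Q. f e)" if "\<And>e. e \<notin> Q \<Longrightarrow> f e = 1" for f :: "nat set \<Rightarrow> real"
    by (rule prod.mono_neutral_right[OF finite_vertex_pairs Q]) (use that in auto)
  have "(\<lambda>E. \<Prod>e\<in>Q. h e (e \<in> E)) = (\<lambda>E. \<Prod>e\<in>vertex_pairs n. g e (e \<in> E))"
    by (subst *) (auto simp: g_def intro!: prod.cong)
  then have "measure_pmf.expectation (Gnp n p) (\<lambda>E. \<Prod>e\<in>Q. h e (e \<in> E))
     = (\<Prod>e\<in>vertex_pairs n. p * g e True + (1 - p) * g e False)"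
    using expectation_Gnp_prod_all[OF p, of n g] by simp
  also have "\<dots> = (\<Prod>e\<in>Q. p * h e True + (1 - p) * h e False)"
    by (subst *) (auto simp: g_def intro!: prod.cong)
  finally show ?thesis .
qed

section \<open>Comparison of closed walks in vertex sets of different sizes\<close>

definition walk_edges :: "(nat \<Rightarrow> 'a) \<Rightarrow> nat \<Rightarrow> 'a set set" where
  "walk_edges w N = (\<lambda>i. {w i, w (Suc i)}) ` {..<N}"

definition edge_mult :: "(nat \<Rightarrow> 'a) \<Rightarrow> nat \<Rightarrow> 'a set \<Rightarrow> nat" where
  "edge_mult w N e = card {i \<in> {..<N}. {w i, w (Suc i)} = e}"

text \<open>The closed walks that can survive averaging: a loop meets a zero diagonal entry, and an
  edge used exactly once contributes the mean of a centered variable.\<close>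

definition heavy_walks :: "'a set \<Rightarrow> nat \<Rightarrow> (nat \<Rightarrow> 'a) set" where
  "heavy_walks V N = {w \<in> closed_walks V N. (\<forall>i<N. w i \<noteq> w (Suc i)) \<and>
     (\<forall>i<N. 2 \<le> edge_mult w N {w i, w (Suc i)})}"

lemma finite_walk_edges: "finite (walk_edges w N)"
  by (simp add: walk_edges_def)

lemma prod_walk:
  "(\<Prod>i<N. g {w i, w (Suc i)}) = (\<Prod>e\<in>walk_edges w N. g e ^ edge_mult w N e)"
  for g :: "'a set \<Rightarrow> real"
proof -
  have "(\<Prod>i<N. g {w i, w (Suc i)})
      = (\<Prod>e\<in>walk_edges w N. \<Prod>i\<in>{i\<in>{..<N}. {w i, w (Suc i)} = e}. g {w i, w (Suc i)})"
    unfolding walk_edges_def by (rule prod.image_gen) simp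
  also have "\<dots> = (\<Prod>e\<in>walk_edges w N. g e ^ edge_mult w N e)"
    unfolding edge_mult_def by (intro prod.cong refl) simp
  finally show ?thesis .
qed

text \<open>A walk is connected: every vertex after the first is entered for the first time along an
  edge of its own.\<close>

lemma card_walk_vertices_le: "card (w ` {..N}) \<le> card (walk_edges w N) + 1"
proof -
  define t where "t x = (LEAST i. w i = x)" for x
  have t: "w (t x) = x" "t x \<le> i" if "w i = x" for x i
    using that unfolding t_def by (auto intro: LeastI Least_le)
  define f where "f x = {w (t x - 1), x}" for x
  let ?R = "w ` {..N} - {w 0}"
  have tpos: "0 < t x" "t x \<le> N" if x: "x \<in> ?R" for x
  proof -
    obtain i where i: "w i = x" "i \<le> N" using x by auto
    have "t x \<noteq> 0"
    proof
      assume "t x = 0"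
      then have "w 0 = x" using t(1)[OF i(1)] by simp
      then show False using x by simp
    qed
    then show "0 < t x" "t x \<le> N" using t(2)[OF i(1)] i(2) by auto
  qed
  have wt: "w (t x) = x" if "x \<in> ?R" for x using that t(1) by auto
  have "inj_on f ?R"
  proof (rule inj_onI, rule ccontr)
    fix x y assume xy: "x \<in> ?R" "y \<in> ?R" "f x = f y" "x \<noteq> y"
    then have *: "w (t x - 1) = y \<and> x = w (t y - 1)"
      unfolding f_def doubleton_eq_iff by blast
    have y: "w (t x - 1) = y" by (rule *[THEN conjunct1])
    have x: "w (t y - 1) = x" by (rule *[THEN conjunct2, symmetric])
    have "t y \<le> t x - 1" "t x \<le> t y - 1" by (rule t(2)[OF y], rule t(2)[OF x])
    then show False using tpos(1)[OF xy(1)] tpos(1)[OF xy(2)] by linarith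
  qed
  moreover have "f ` ?R \<subseteq> walk_edges w N"
  proof
    fix e assume "e \<in> f ` ?R"
    then obtain x where x: "x \<in> ?R" "e = f x" by auto
    have "e = {w (t x - 1), w (Suc (t x - 1))}"
      using x wt[OF x(1)] tpos[OF x(1)] by (simp add: f_def)
    moreover have "t x - 1 < N" using tpos[OF x(1)] by linarith
    ultimately show "e \<in> walk_edges w N"
      unfolding walk_edges_def by (intro image_eqI[where x = "t x - 1"]) simp_all
  qed
  ultimately have "card ?R \<le> card (walk_edges w N)"
    by (rule card_inj_on_le[OF _ _ finite_walk_edges])
  moreover have "Suc (card ?R) = card (w ` {..N})"
    by (rule card_Suc_Diff1) simp_all
  ultimately show ?thesis by linarith
qed

lemma card_heavy_walk_edges:
  assumes "w \<in> heavy_walks V N"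
  shows "2 * card (walk_edges w N) \<le> N"
proof -
  have "2 * card (walk_edges w N) = (\<Sum>e\<in>walk_edges w N. 2)" by simp
  also have "\<dots> \<le> (\<Sum>e\<in>walk_edges w N. edge_mult w N e)"
    using assms by (intro sum_mono) (auto simp: heavy_walks_def walk_edges_def)
  also have "\<dots> = card {..<N}"
    unfolding edge_mult_def walk_edges_def card_eq_sum by (subst sum.image_gen[of "{..<N}"]) auto
  finally show ?thesis by simp
qed

text \<open>A canonical code for the partition of the positions by equality of the visited vertices:
  each position is sent to the first visit of its vertex. Being a function into positions, it can be
  compared between walks in different vertex sets, and its image has one element per visited
  vertex.\<close>

definition walk_shape :: "nat \<Rightarrow> (nat \<Rightarrow> 'a) \<Rightarrow> nat \<Rightarrow> nat" where
  "walk_shape N w = (\<lambda>i\<in>{..N}. LEAST j. w j = w i)"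

lemma walk_shape:
  assumes "i \<le> N"
  shows "w (walk_shape N w i) = w i" "walk_shape N w i \<le> i"
  using assms unfolding walk_shape_def by (auto intro: LeastI Least_le)

lemma walk_shape_eq_iff:
  assumes "i \<le> N" "j \<le> N"
  shows "walk_shape N w i = walk_shape N w j \<longleftrightarrow> w i = w j"
proof
  show "walk_shape N w i = walk_shape N w j \<Longrightarrow> w i = w j"
    using walk_shape(1)[OF assms(1), of w] walk_shape(1)[OF assms(2), of w] by simp
qed (use assms in \<open>simp add: walk_shape_def\<close>)

lemma walk_shape_cong:
  assumes "\<And>i j. i \<le> N \<Longrightarrow> j \<le> N \<Longrightarrow> w i = w j \<longleftrightarrow> w' i = w' j"
  shows "walk_shape N w = walk_shape N w'"
proof
  fix i
  show "walk_shape N w i = walk_shape N w' i"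
  proof (cases "i \<le> N")
    case True
    have "w' (walk_shape N w i) = w' i"
      using assms[of "walk_shape N w i" i] walk_shape[OF True, of w] True by simp
    moreover have "w (walk_shape N w' i) = w i"
      using assms[of "walk_shape N w' i" i] walk_shape[OF True, of w'] True by simp
    moreover have "walk_shape N w i = (LEAST j. w j = w i)" "walk_shape N w' i = (LEAST j. w' j = w' i)"
      using True by (simp_all add: walk_shape_def)
    ultimately have "walk_shape N w' i \<le> walk_shape N w i" "walk_shape N w i \<le> walk_shape N w' i"
      by (metis Least_le)+
    then show ?thesis by simp
  qed (simp add: walk_shape_def)
qed

text \<open>Closedness, looplessness and edge multiplicities are all expressed by equalities between
  visited vertices, so they depend only on the equality pattern.\<close>

lemma heavy_walks_cong:
  assumes w: "w \<in> heavy_walks V N" and w': "w' \<in> {..N} \<rightarrow>\<^sub>E U"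
    and eq: "\<And>i j. i \<le> N \<Longrightarrow> j \<le> N \<Longrightarrow> w i = w j \<longleftrightarrow> w' i = w' j"
  shows "w' \<in> heavy_walks U N"
proof -
  have edge: "{w' i, w' (Suc i)} = {w' j, w' (Suc j)} \<longleftrightarrow> {w i, w (Suc i)} = {w j, w (Suc j)}"
    if "i < N" "j < N" for i j
    using that eq[of i j] eq[of "Suc i" "Suc j"] eq[of i "Suc j"] eq[of "Suc i" j]
    by (simp add: doubleton_eq_iff)
  have mult: "edge_mult w' N {w' i, w' (Suc i)} = edge_mult w N {w i, w (Suc i)}" if "i < N" for i
    unfolding edge_mult_def using edge that by (intro arg_cong[where f = card]) auto
  show ?thesis
    using w w' eq[of 0 N] eq[of _ "Suc _"] mult
    by (auto simp: heavy_walks_def closed_walks_def)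
qed

lemma card_walk_shape: "card (walk_shape N w ` {..N}) = card (w ` {..N})"
proof -
  have "w ` walk_shape N w ` {..N} = w ` {..N}"
    unfolding image_image by (rule image_cong) (simp_all add: walk_shape(1))
  moreover have "inj_on w (walk_shape N w ` {..N})"
  proof (rule inj_onI)
    fix x y assume "x \<in> walk_shape N w ` {..N}" "y \<in> walk_shape N w ` {..N}" and eq: "w x = w y"
    then obtain i j where ij: "i \<le> N" "x = walk_shape N w i" "j \<le> N" "y = walk_shape N w j" by auto
    then have "w i = w j" using eq walk_shape(1)[of i N w] walk_shape(1)[of j N w] by simp
    then show "x = y" using walk_shape_eq_iff[of i N j w] ij by simp
  qed
  ultimately show ?thesis using card_image[of w "walk_shape N w ` {..N}"] by simp
qed

lemma walk_shape_idem:
  assumes "i \<in> walk_shape N w ` {..N}"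
  shows "walk_shape N w i = i" "i \<le> N"
proof -
  obtain j where j: "j \<le> N" "i = walk_shape N w j" using assms by auto
  show i: "i \<le> N" using walk_shape(2)[OF j(1), of w] j by simp
  have "w i = w j" using walk_shape(1)[OF j(1), of w] j(2) by simp
  then show "walk_shape N w i = i" using walk_shape_eq_iff[OF i j(1), of w] j(2) by simp
qed

text \<open>Given its shape, a walk is determined by its values at the first visits, and there are
  as many of these as vertices visited by \<open>w0\<close>.\<close>

lemma card_walks_of_shape_le:
  assumes "finite V"
  shows "card {w \<in> heavy_walks V N. walk_shape N w = walk_shape N w0} \<le> card V ^ card (w0 ` {..N})"
proof -
  define s where "s = walk_shape N w0"
  define R where "R = s ` {..N}"
  have finR: "finite R" by (simp add: R_def)
  have RN: "R \<subseteq> {..N}" using walk_shape_idem(2)[of _ N w0] by (auto simp: R_def s_def)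
  have "card {w \<in> heavy_walks V N. walk_shape N w = s} \<le> card (R \<rightarrow>\<^sub>E V)"
  proof (rule card_inj_on_le)
    show "finite (R \<rightarrow>\<^sub>E V)" using assms finR by (simp add: finite_PiE)
    show "(\<lambda>w. restrict w R) ` {w \<in> heavy_walks V N. walk_shape N w = s} \<subseteq> R \<rightarrow>\<^sub>E V"
      using RN by (auto simp: heavy_walks_def closed_walks_def)
    show "inj_on (\<lambda>w. restrict w R) {w \<in> heavy_walks V N. walk_shape N w = s}"
    proof (rule inj_onI)
      fix w w' assume w: "w \<in> {w \<in> heavy_walks V N. walk_shape N w = s}"
        and w': "w' \<in> {w \<in> heavy_walks V N. walk_shape N w = s}"
        and eq: "restrict w R = restrict w' R"
      have "w i = w' i" if i: "i \<le> N" for i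
      proof -
        have "w i = w (s i)" "w' i = w' (s i)"
          using w w' walk_shape(1)[OF i, of w] walk_shape(1)[OF i, of w'] by auto
        moreover have "s i \<in> R" using i by (simp add: R_def)
        then have "w (s i) = w' (s i)" using fun_cong[OF eq, of "s i"] by simp
        ultimately show ?thesis by simp
      qed
      moreover have "w \<in> {..N} \<rightarrow>\<^sub>E V" "w' \<in> {..N} \<rightarrow>\<^sub>E V"
        using w w' by (simp_all add: heavy_walks_def closed_walks_def)
      ultimately show "w = w'" by (intro PiE_ext) auto
    qed
  qed
  also have "\<dots> = card V ^ card R" using finR by (simp add: card_PiE)
  also have "card R = card (w0 ` {..N})" unfolding R_def s_def by (rule card_walk_shape)
  finally show ?thesis by (simp add: s_def)
qed

text \<open>Conversely, every injection of the set of first visits into \<open>U\<close>, composed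
  with the shape, is a walk with the same equality pattern. The falling factorial counts these
  injections.\<close>

lemma card_walks_of_shape_ge:
  assumes "finite U" and w0: "w0 \<in> heavy_walks V N"
  shows "(\<Prod>j\<in>{0..<card (w0 ` {..N})}. card U - j)
    \<le> card {w \<in> heavy_walks U N. walk_shape N w = walk_shape N w0}"
proof -
  define s where "s = walk_shape N w0"
  define R where "R = s ` {..N}"
  have finR: "finite R" by (simp add: R_def)
  have RN: "i \<le> N" "s i = i" if "i \<in> R" for i
    using walk_shape_idem[of i N w0] that by (simp_all add: R_def s_def)
  have sR: "s i \<in> R" if "i \<le> N" for i using that by (simp add: R_def)
  let ?I = "{f \<in> R \<rightarrow>\<^sub>E U. inj_on f R}"
  let ?g = "\<lambda>f. \<lambda>i\<in>{..N}. f (s i)"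
  have "card ?I \<le> card {w \<in> heavy_walks U N. walk_shape N w = s}"
  proof (rule card_inj_on_le)
    show "finite {w \<in> heavy_walks U N. walk_shape N w = s}"
      using finite_closed_walks[OF assms(1)] by (simp add: heavy_walks_def)
    show "inj_on ?g ?I"
    proof (rule inj_onI)
      fix f f' assume f: "f \<in> ?I" "f' \<in> ?I" and eq: "?g f = ?g f'"
      have "f x = f' x" if "x \<in> R" for x
        using fun_cong[OF eq, of x] RN[OF that] by simp
      moreover have "f \<in> R \<rightarrow>\<^sub>E U" "f' \<in> R \<rightarrow>\<^sub>E U" using f by simp_all
      ultimately show "f = f'" by (intro PiE_ext) auto
    qed
    show "?g ` ?I \<subseteq> {w \<in> heavy_walks U N. walk_shape N w = s}"
    proof (rule image_subsetI)
      fix f assume f: "f \<in> ?I"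
      have pat: "w0 i = w0 j \<longleftrightarrow> ?g f i = ?g f j" if "i \<le> N" "j \<le> N" for i j
      proof -
        have "w0 i = w0 j \<longleftrightarrow> s i = s j" using walk_shape_eq_iff[OF that, of w0] by (simp add: s_def)
        also have "\<dots> \<longleftrightarrow> f (s i) = f (s j)"
          using f sR[OF that(1)] sR[OF that(2)] by (auto dest: inj_onD)
        finally show ?thesis using that by simp
      qed
      have "?g f \<in> {..N} \<rightarrow>\<^sub>E U" using f sR by auto
      then have "?g f \<in> heavy_walks U N" by (rule heavy_walks_cong[OF w0]) (rule pat)
      moreover have "s = walk_shape N (?g f)"
        using walk_shape_cong[of N w0 "?g f", OF pat] by (simp only: s_def)
      ultimately show "?g f \<in> {w \<in> heavy_walks U N. walk_shape N w = s}" by simp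
    qed
  qed
  moreover have "card ?I = (\<Prod>j\<in>{0..<card R}. card U - j)"
    using card_inj_on_subset_funcset[OF finR assms(1) subset_refl] by simp
  moreover have "card R = card (w0 ` {..N})" unfolding R_def s_def by (rule card_walk_shape)
  ultimately show ?thesis by (simp add: s_def)
qed

text \<open>Closed walks of a given shape with \<open>m\<close> vertices correspond to injections of an \<open>m\<close>-set. Hence
  the walks in a large vertex set, discounted by \<open>t\<close> per vertex, are dominated by the walks in a
  vertex set of size about \<open>t |V|\<close>.\<close>

lemma heavy_walks_comparison:
  assumes V: "finite V" and U: "finite U" and t: "0 \<le> t"
    and size: "real (card V) * t \<le> real (card U) - real k" and k: "k \<le> card U"
  shows "(\<Sum>w\<in>heavy_walks V (2 * k). t ^ card (w ` {..2 * k})) \<le> real (card (heavy_walks U (2 * k)))"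
proof -
  define N where "N = 2 * k"
  define HV where "HV = heavy_walks V N"
  define HU where "HU = heavy_walks U N"
  have finV: "finite HV" and finU: "finite HU"
    using finite_closed_walks[OF V] finite_closed_walks[OF U] by (simp_all add: HV_def HU_def heavy_walks_def)
  define S where "S = walk_shape N ` HV"
  have finS: "finite S" using finV by (simp add: S_def)
  have shape_le: "(\<Sum>w\<in>{w \<in> HV. walk_shape N w = s}. t ^ card (w ` {..N}))
      \<le> real (card {w \<in> HU. walk_shape N w = s})" if "s \<in> S" for s
  proof -
    obtain w0 where w0: "w0 \<in> heavy_walks V N" "s = walk_shape N w0" using \<open>s \<in> S\<close> by (auto simp: S_def HV_def)
    define m where "m = card (w0 ` {..N})"
    \<comment> \<open>At least \<open>m - 1\<close> distinct edges, each used twice within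
      \<open>2k\<close> steps. Hence every index \<open>j < m\<close> of the falling factorial is at
      most \<open>k\<close>, the number subtracted in the hypothesis \<open>size\<close>.\<close>
    have m: "m \<le> k + 1"
      using card_walk_vertices_le[of w0 N] card_heavy_walk_edges[OF w0(1)] by (simp add: m_def N_def)
    have "(\<Sum>w\<in>{w \<in> HV. walk_shape N w = s}. t ^ card (w ` {..N}))
        = (\<Sum>w\<in>{w \<in> HV. walk_shape N w = s}. t ^ m)"
    proof (rule sum.cong[OF refl])
      fix w assume "w \<in> {w \<in> HV. walk_shape N w = s}"
      then show "t ^ card (w ` {..N}) = t ^ m"
        using card_walk_shape[of N w] card_walk_shape[of N w0] w0(2) by (simp add: m_def)
    qed
    also have "\<dots> = t ^ m * real (card {w \<in> HV. walk_shape N w = s})" by simp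
    also have "\<dots> \<le> t ^ m * real (card V ^ m)"
      unfolding m_def w0(2) HV_def
      by (intro mult_left_mono of_nat_mono card_walks_of_shape_le V) (use t in simp)
    also have "\<dots> = (real (card V) * t) ^ m" by (simp add: power_mult_distrib)
    also have "\<dots> \<le> (real (card U) - real k) ^ m" using size t by (intro power_mono) auto
    also have "\<dots> = (\<Prod>j\<in>{0..<m}. real (card U) - real k)" by simp
    also have "\<dots> \<le> (\<Prod>j\<in>{0..<m}. real (card U - j))"
    proof (rule prod_mono)
      fix j assume "j \<in> {0..<m}"
      then have "j \<le> k" using m by simp
      then show "0 \<le> real (card U) - real k \<and> real (card U) - real k \<le> real (card U - j)"
        using k by simp
    qed
    also have "\<dots> \<le> real (card {w \<in> HU. walk_shape N w = s})"
      unfolding of_nat_prod[symmetric] HU_def m_def w0(2)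
      by (intro of_nat_mono card_walks_of_shape_ge[OF U w0(1)])
    finally show ?thesis .
  qed
  have "(\<Sum>w\<in>HV. t ^ card (w ` {..N}))
      = (\<Sum>s\<in>S. \<Sum>w\<in>{w \<in> HV. walk_shape N w = s}. t ^ card (w ` {..N}))"
    unfolding S_def by (rule sum.image_gen[OF finV])
  also have "\<dots> \<le> (\<Sum>s\<in>S. real (card {w \<in> HU. walk_shape N w = s}))"
    by (rule sum_mono[OF shape_le])
  also have "\<dots> = real (\<Sum>s\<in>S. card {w \<in> HU. walk_shape N w = s})"
    by simp
  also have "(\<Sum>s\<in>S. card {w \<in> HU. walk_shape N w = s}) = card (\<Union>s\<in>S. {w \<in> HU. walk_shape N w = s})"
    using finS finU by (intro card_UN_disjoint[symmetric]) auto
  also have "real \<dots> \<le> real (card HU)"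
    using finU by (intro of_nat_mono card_mono) auto
  finally show ?thesis by (simp add: N_def HV_def HU_def)
qed

section \<open>Trace moments of the matrices of vertex links\<close>

definition nonnbrs :: "nat \<Rightarrow> nat set set \<Rightarrow> nat set \<Rightarrow> nat set" where
  "nonnbrs n E K = {v \<in> {1..n} - K. \<forall>u\<in>K. {u, v} \<notin> E}"

definition link_matrix :: "nat \<Rightarrow> real \<Rightarrow> nat set \<Rightarrow> nat set set \<Rightarrow> nat \<Rightarrow> nat \<Rightarrow> real" where
  "link_matrix n p K E i j = (if i \<noteq> j \<and> i \<in> nonnbrs n E K \<and> j \<in> nonnbrs n E K
     then of_bool ({i, j} \<in> E) - p else 0)"

text \<open>Edge probability \<open>1/3\<close> makes the entries centered. Symmetric signs would
  not serve: their odd moments vanish, while heavy walks may use an edge an odd number of times and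
  have to be counted.\<close>

definition biased_matrix :: "nat set set \<Rightarrow> nat \<Rightarrow> nat \<Rightarrow> real" where
  "biased_matrix E i j = (if i = j then 0 else if {i, j} \<in> E then 2 else - 1)"

lemma link_matrix_sym: "link_matrix n p K E i j = link_matrix n p K E j i"
  by (auto simp: link_matrix_def insert_commute)

lemma biased_matrix_sym: "biased_matrix E i j = biased_matrix E j i"
  by (auto simp: biased_matrix_def insert_commute)

lemma edge_mult_ge_1:
  assumes "e \<in> walk_edges w N"
  shows "1 \<le> edge_mult w N e"
proof -
  obtain i where i: "i < N" "e = {w i, w (Suc i)}" using assms unfolding walk_edges_def by blast
  then have "i \<in> {i \<in> {..<N}. {w i, w (Suc i)} = e}" by simp
  then have "0 < card {i \<in> {..<N}. {w i, w (Suc i)} = e}" by (intro card_gt_0_iff[THEN iffD2] conjI) auto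
  then show ?thesis unfolding edge_mult_def by linarith
qed

lemma walk_edges_subset:
  assumes "w \<in> closed_walks {1..n} N" "\<And>i. i < N \<Longrightarrow> w i \<noteq> w (Suc i)"
  shows "walk_edges w N \<subseteq> vertex_pairs n"
proof
  fix e assume "e \<in> walk_edges w N"
  then obtain i where i: "i < N" "e = {w i, w (Suc i)}" unfolding walk_edges_def by blast
  have "w i \<in> {1..n}" "w (Suc i) \<in> {1..n}"
    using assms(1) i(1) by (auto simp: closed_walks_def PiE_def Pi_def)
  then show "e \<in> vertex_pairs n" using assms(2)[OF i(1)] i(2) doubleton_in_vertex_pairs by blast
qed

lemma prod_link_matrix_walk:
  assumes "0 < N" "w 0 = w N" and loopless: "\<And>i. i < N \<Longrightarrow> w i \<noteq> w (Suc i)"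
  shows "(\<Prod>i<N. link_matrix n p K E (w i) (w (Suc i)))
    = (\<Prod>e\<in>walk_edges w N. (of_bool (e \<in> E) - p) ^ edge_mult w N e)
      * (\<Prod>v\<in>w ` {..N}. of_bool (v \<in> nonnbrs n E K))"
proof (cases "\<forall>v\<in>w ` {..N}. v \<in> nonnbrs n E K")
  case True
  have "(\<Prod>i<N. link_matrix n p K E (w i) (w (Suc i))) = (\<Prod>i<N. of_bool ({w i, w (Suc i)} \<in> E) - p)"
    by (rule prod.cong[OF refl]) (use True loopless in \<open>auto simp: link_matrix_def\<close>)
  also have "\<dots> = (\<Prod>e\<in>walk_edges w N. (of_bool (e \<in> E) - p) ^ edge_mult w N e)"
    by (rule prod_walk)
  finally have "(\<Prod>i<N. link_matrix n p K E (w i) (w (Suc i)))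
      = (\<Prod>e\<in>walk_edges w N. (of_bool (e \<in> E) - p) ^ edge_mult w N e)" .
  moreover have "(\<Prod>v\<in>w ` {..N}. of_bool (v \<in> nonnbrs n E K)) = (1::real)"
    by (rule prod.neutral) (use True in simp)
  ultimately show ?thesis by simp
next
  case False
  then obtain v where v: "v \<in> w ` {..N}" "v \<notin> nonnbrs n E K" by blast
  then obtain j where j: "j \<le> N" "v = w j" by blast
  \<comment> \<open>A zero factor is needed at the start of some step. Position \<open>N\<close>
    starts none, but the walk is closed and visits the same vertex at position 0.\<close>
  define i where "i = (if j = N then 0 else j)"
  have i: "i < N" "v = w i" using j assms(1,2) by (auto simp: i_def)
  have "(\<Prod>i<N. link_matrix n p K E (w i) (w (Suc i))) = 0"
    by (rule prod_zero) (use i v in \<open>auto simp: link_matrix_def intro!: bexI[of _ i]\<close>)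
  moreover have "(\<Prod>v\<in>w ` {..N}. of_bool (v \<in> nonnbrs n E K)) = (0::real)"
    by (intro prod_zero bexI[OF _ v(1)]) (use v in simp_all)
  ultimately show ?thesis by (simp only: mult_zero_right)
qed

section \<open>The expectation of a single walk\<close>

definition cross_pairs :: "nat set \<Rightarrow> nat set \<Rightarrow> nat set set" where
  "cross_pairs K W = (\<lambda>(u, v). {u, v}) ` (K \<times> W)"

lemma cross_pairs_cases: "e \<in> cross_pairs K W \<Longrightarrow> \<exists>u v. e = {u, v} \<and> u \<in> K \<and> v \<in> W"
proof -
  assume "e \<in> cross_pairs K W"
  then obtain x where "x \<in> K \<times> W" "e = (case x of (u, v) \<Rightarrow> {u, v})"
    unfolding cross_pairs_def by (rule imageE)
  then show ?thesis by (intro exI[of _ "fst x"] exI[of _ "snd x"]) (simp add: case_prod_unfold mem_Times_iff)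
qed

lemma inj_on_cross_pairs:
  assumes "K \<inter> W = {}"
  shows "inj_on (\<lambda>(u, v). {u, v}) (K \<times> W)"
proof (rule inj_onI, clarify)
  fix a b c d assume "a \<in> K" "b \<in> W" "c \<in> K" "d \<in> W" "{a, b} = {c, d}"
  moreover from this have "a \<noteq> d" using assms by blast
  ultimately show "a = c \<and> b = d" unfolding doubleton_eq_iff by blast
qed

lemma cross_pairs_subset:
  assumes "K \<subseteq> {1..n}" "W \<subseteq> {1..n}" "K \<inter> W = {}"
  shows "cross_pairs K W \<subseteq> vertex_pairs n"
proof
  fix e assume "e \<in> cross_pairs K W"
  then obtain u v where uv: "e = {u, v}" "u \<in> K" "v \<in> W" using cross_pairs_cases by metis
  have "u \<in> {1..n}" "v \<in> {1..n}" by (rule subsetD[OF assms(1) uv(2)], rule subsetD[OF assms(2) uv(3)])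
  moreover have "u \<noteq> v" using uv(2,3) assms(3) by blast
  ultimately show "e \<in> vertex_pairs n" by (simp add: uv(1) doubleton_in_vertex_pairs)
qed

lemma card_cross_pairs: "K \<inter> W = {} \<Longrightarrow> card (cross_pairs K W) = card K * card W"
  by (simp add: cross_pairs_def card_image[OF inj_on_cross_pairs] card_cartesian_product)

lemma prod_nonnbrs:
  assumes "finite K" "W \<subseteq> {1..n}" "K \<inter> W = {}"
  shows "(\<Prod>v\<in>W. of_bool (v \<in> nonnbrs n E K) :: real) = (\<Prod>e\<in>cross_pairs K W. of_bool (e \<notin> E))"
proof -
  have "(\<Prod>v\<in>W. of_bool (v \<in> nonnbrs n E K)) = (\<Prod>v\<in>W. \<Prod>u\<in>K. of_bool ({u, v} \<notin> E) :: real)"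
  proof (rule prod.cong[OF refl])
    fix v assume v: "v \<in> W"
    then have "v \<in> nonnbrs n E K \<longleftrightarrow> (\<forall>u\<in>K. {u, v} \<notin> E)"
      using assms(2,3) unfolding nonnbrs_def by blast
    moreover have "(\<Prod>u\<in>K. of_bool ({u, v} \<notin> E) :: real) = of_bool (\<forall>u\<in>K. {u, v} \<notin> E)"
      using assms(1) by (induction K rule: finite_induct) simp_all
    ultimately show "of_bool (v \<in> nonnbrs n E K) = (\<Prod>u\<in>K. of_bool ({u, v} \<notin> E) :: real)"
      by simp
  qed
  also have "\<dots> = (\<Prod>u\<in>K. \<Prod>v\<in>W. of_bool ({u, v} \<notin> E))" by (rule prod.swap)
  also have "\<dots> = (\<Prod>x\<in>K \<times> W. of_bool ((case x of (u, v) \<Rightarrow> {u, v}) \<notin> E))"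
    by (simp add: prod.cartesian_product case_prod_unfold)
  also have "\<dots> = (\<Prod>e\<in>cross_pairs K W. of_bool (e \<notin> E))"
    unfolding cross_pairs_def by (simp only: prod.reindex[OF inj_on_cross_pairs[OF assms(3)]] o_def)
  finally show ?thesis .
qed

text \<open>The edges of the walk lie inside its vertex set \<open>W\<close>, while the pairs
  deciding whether \<open>W\<close> avoids the neighbours of \<open>K\<close> all meet
  \<open>K\<close>. As \<open>K\<close> misses \<open>W\<close>, these are disjoint families of
  independent pairs, with \<open>card K * card W\<close> pairs in the second.\<close>

lemma expectation_link_matrix_walk:
  assumes p: "0 \<le> p" "p \<le> 1" and w: "w \<in> closed_walks {1..n} N" and "0 < N"
    and loopless: "\<And>i. i < N \<Longrightarrow> w i \<noteq> w (Suc i)"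
    and K: "K \<subseteq> {1..n}" "K \<inter> w ` {..N} = {}"
  shows "measure_pmf.expectation (Gnp n p) (\<lambda>E. \<Prod>i<N. link_matrix n p K E (w i) (w (Suc i)))
    = (\<Prod>e\<in>walk_edges w N. p * (1 - p) ^ edge_mult w N e + (1 - p) * (- p) ^ edge_mult w N e)
      * (1 - p) ^ (card K * card (w ` {..N}))"
proof -
  define W where "W = w ` {..N}"
  define D where "D = walk_edges w N"
  define F where "F = cross_pairs K W"
  define h where "h e b = (if e \<in> D then (of_bool b - p) ^ edge_mult w N e else of_bool (\<not> b))" for e b
  have W: "W \<subseteq> {1..n}" using w by (auto simp: W_def closed_walks_def)
  have KW: "K \<inter> W = {}" using K(2) by (simp add: W_def)
  have finK: "finite K" using K(1) by (rule finite_subset) simp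
  have F: "F \<subseteq> vertex_pairs n" unfolding F_def by (rule cross_pairs_subset[OF K(1) W KW])
  have D: "D \<subseteq> vertex_pairs n" unfolding D_def using w loopless by (rule walk_edges_subset)
  have DW: "e \<subseteq> W" if "e \<in> D" for e
  proof -
    obtain i where i: "i < N" "e = {w i, w (Suc i)}" using \<open>e \<in> D\<close> unfolding D_def walk_edges_def by blast
    moreover have "w i \<in> W" "w (Suc i) \<in> W"
      unfolding W_def by (rule imageI, use i in simp)+
    ultimately show ?thesis by simp
  qed
  have DF: "D \<inter> F = {}"
  proof (rule ccontr)
    assume "D \<inter> F \<noteq> {}"
    then obtain e where e: "e \<in> D" "e \<in> F" by blast
    obtain u v where "e = {u, v}" "u \<in> K" using cross_pairs_cases[OF e(2)[unfolded F_def]] by metis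
    then have "u \<in> K \<inter> W" using DW[OF e(1)] by simp
    then show False using KW by simp
  qed
  have fin: "finite D" "finite F"
    using finite_subset[OF F finite_vertex_pairs] by (simp_all add: D_def finite_walk_edges)
  have split: "(\<Prod>e\<in>D \<union> F. g e) = (\<Prod>e\<in>D. g e) * (\<Prod>e\<in>F. g e)" for g :: "nat set \<Rightarrow> real"
    using fin DF by (rule prod.union_disjoint)
  have notD: "e \<notin> D" if "e \<in> F" for e using DF that by blast
  have "(\<Prod>i<N. link_matrix n p K E (w i) (w (Suc i))) = (\<Prod>e\<in>D \<union> F. h e (e \<in> E))" for E
  proof -
    have "(\<Prod>e\<in>F. of_bool (e \<notin> E)) = (\<Prod>e\<in>F. h e (e \<in> E))"
      by (rule prod.cong[OF refl]) (simp add: h_def notD)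
    then have 1: "(\<Prod>v\<in>W. of_bool (v \<in> nonnbrs n E K)) = (\<Prod>e\<in>F. h e (e \<in> E))"
      unfolding F_def prod_nonnbrs[OF finK W KW] .
    have 2: "(\<Prod>e\<in>D. (of_bool (e \<in> E) - p) ^ edge_mult w N e) = (\<Prod>e\<in>D. h e (e \<in> E))"
      by (rule prod.cong[OF refl]) (simp add: h_def)
    have "w 0 = w N" using w by (simp add: closed_walks_def)
    then have "(\<Prod>i<N. link_matrix n p K E (w i) (w (Suc i)))
        = (\<Prod>e\<in>D. (of_bool (e \<in> E) - p) ^ edge_mult w N e) * (\<Prod>v\<in>W. of_bool (v \<in> nonnbrs n E K))"
      unfolding D_def W_def using \<open>0 < N\<close> loopless by (intro prod_link_matrix_walk)
    then show ?thesis unfolding 1 2 split .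
  qed
  then have "measure_pmf.expectation (Gnp n p) (\<lambda>E. \<Prod>i<N. link_matrix n p K E (w i) (w (Suc i)))
    = (\<Prod>e\<in>D \<union> F. p * h e True + (1 - p) * h e False)"
    using expectation_Gnp_prod[OF p, of "D \<union> F" n h] D F by simp
  also have "\<dots> = (\<Prod>e\<in>D. p * (1 - p) ^ edge_mult w N e + (1 - p) * (- p) ^ edge_mult w N e)
      * (\<Prod>e\<in>F. 1 - p)"
    unfolding split by (rule arg_cong2[where f = "(*)"]; rule prod.cong) (simp_all add: h_def notD)
  also have "(\<Prod>e\<in>F. 1 - p) = (1 - p) ^ (card K * card W)"
    by (simp add: F_def card_cross_pairs[OF KW])
  finally show ?thesis by (simp add: D_def W_def)
qed

text \<open>A centered indicator is bounded by 1 in absolute value, so its moments of order at least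
  2 are at most its variance.\<close>

lemma centered_bernoulli_moment_le:
  fixes p :: real
  assumes "0 \<le> p" "p \<le> 1" "2 \<le> m"
  shows "\<bar>p * (1 - p) ^ m + (1 - p) * (- p) ^ m\<bar> \<le> p * (1 - p)"
proof -
  have "\<bar>p * (1 - p) ^ m + (1 - p) * (- p) ^ m\<bar> \<le> \<bar>p * (1 - p) ^ m\<bar> + \<bar>(1 - p) * (- p) ^ m\<bar>"
    by (rule abs_triangle_ineq)
  also have "\<dots> = p * (1 - p) ^ m + (1 - p) * p ^ m"
    using assms by (simp add: abs_mult power_abs)
  also have "\<dots> \<le> p * (1 - p) ^ 2 + (1 - p) * p ^ 2"
    using assms by (intro add_mono mult_left_mono power_decreasing) auto
  also have "\<dots> = p * (1 - p)" by (simp add: power2_eq_square algebra_simps)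
  finally show ?thesis .
qed

text \<open>The expectation vanishes if the walk has a loop, meets \<open>K\<close>, or uses an edge
  only once. Otherwise each of the at least \<open>m - 1\<close> edges contributes at most
  \<open>p * (1 - p)\<close>, where \<open>m\<close> is the number of vertices. The division by
  \<open>p * (1 - p)\<close> makes up for the difference between \<open>m - 1\<close> and
  \<open>m\<close>.\<close>

lemma expectation_link_matrix_walk_le:
  assumes p: "0 < p" "p < 1" and w: "w \<in> closed_walks {1..n} N" and "0 < N" and K: "K \<subseteq> {1..n}"
  shows "measure_pmf.expectation (Gnp n p) (\<lambda>E. \<Prod>i<N. link_matrix n p K E (w i) (w (Suc i)))
    \<le> (if w \<in> heavy_walks {1..n} N then (p * (1 - p) ^ (card K + 1)) ^ card (w ` {..N}) / (p * (1 - p)) else 0)"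
    (is "?L \<le> ?R")
proof -
  have R0: "0 \<le> ?R" using p by simp
  consider (loop) i where "i < N" "w i = w (Suc i)"
    | (meets) "\<And>i. i < N \<Longrightarrow> w i \<noteq> w (Suc i)" "K \<inter> w ` {..N} \<noteq> {}"
    | (ok) "\<And>i. i < N \<Longrightarrow> w i \<noteq> w (Suc i)" "K \<inter> w ` {..N} = {}"
    by blast
  then show ?thesis
  proof cases
    case loop
    have z: "(\<Prod>i<N. link_matrix n p K E (w i) (w (Suc i))) = 0" for E
      by (rule prod_zero) (use loop in \<open>auto simp: link_matrix_def intro!: bexI[of _ i]\<close>)
    show ?thesis unfolding z using R0 by simp
  next
    case meets
    then obtain v where v: "v \<in> w ` {..N}" "v \<in> K" by blast
    have "(\<Prod>v\<in>w ` {..N}. of_bool (v \<in> nonnbrs n E K)) = (0::real)" for E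
      by (intro prod_zero bexI[OF _ v(1)]) (use v in \<open>simp_all add: nonnbrs_def\<close>)
    then have z: "(\<Prod>i<N. link_matrix n p K E (w i) (w (Suc i))) = 0" for E
      using prod_link_matrix_walk[of N w n p K E] \<open>0 < N\<close> meets(1) w by (simp add: closed_walks_def)
    show ?thesis unfolding z using R0 by simp
  next
    case ok
    define D where "D = walk_edges w N"
    define f where "f e = p * (1 - p) ^ edge_mult w N e + (1 - p) * (- p) ^ edge_mult w N e" for e
    define m where "m = card (w ` {..N})"
    have L: "?L = (\<Prod>e\<in>D. f e) * (1 - p) ^ (card K * m)"
      unfolding D_def f_def m_def
      using p w \<open>0 < N\<close> ok K by (intro expectation_link_matrix_walk) auto
    show ?thesis
    proof (cases "w \<in> heavy_walks {1..n} N")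
      case False
      then obtain i where i: "i < N" "edge_mult w N {w i, w (Suc i)} < 2"
        using ok(1) w by (auto simp: heavy_walks_def not_le)
      define e where "e = {w i, w (Suc i)}"
      have e: "e \<in> D" using i(1) unfolding D_def e_def walk_edges_def by (rule imageI[OF lessThan_iff[THEN iffD2]])
      then have "edge_mult w N e = 1" using i(2) edge_mult_ge_1[of e w N] unfolding D_def e_def by linarith
      then have "f e = 0" by (simp add: f_def algebra_simps)
      then have "(\<Prod>e\<in>D. f e) = 0" using e by (intro prod_zero) (auto simp: D_def finite_walk_edges)
      then show ?thesis using L False by simp
    next
      case True
      have "(\<Prod>e\<in>D. f e) \<le> (\<Prod>e\<in>D. \<bar>f e\<bar>)" unfolding abs_prod[symmetric] by simp
      also have "\<dots> \<le> (\<Prod>e\<in>D. p * (1 - p))"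
      proof (rule prod_mono)
        fix e assume "e \<in> D"
        then obtain i where i: "i < N" "e = {w i, w (Suc i)}" unfolding D_def walk_edges_def by blast
        then have "2 \<le> edge_mult w N e" using True by (simp add: heavy_walks_def)
        then show "0 \<le> \<bar>f e\<bar> \<and> \<bar>f e\<bar> \<le> p * (1 - p)"
          unfolding f_def using p centered_bernoulli_moment_le[of p "edge_mult w N e"] by simp
      qed
      also have "\<dots> = (p * (1 - p)) ^ card D" by simp
      also have "\<dots> \<le> (p * (1 - p)) ^ (m - 1)"
        using card_walk_vertices_le[of w N] p
        by (intro power_decreasing) (auto simp: m_def D_def intro: mult_le_one)
      also have "\<dots> = (p * (1 - p)) ^ m / (p * (1 - p))"
      proof -
        have "m \<noteq> 0" unfolding m_def by simp
        then have "(p * (1 - p)) ^ m = (p * (1 - p)) ^ (m - 1) * (p * (1 - p))"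
          by (metis Suc_pred' neq0_conv power_Suc2)
        then show ?thesis using p by simp
      qed
      finally have "?L \<le> (p * (1 - p)) ^ m / (p * (1 - p)) * (1 - p) ^ (card K * m)"
        unfolding L using p by (intro mult_right_mono) auto
      also have "\<dots> = (p * (1 - p) ^ (card K + 1)) ^ m / (p * (1 - p))"
      proof -
        have "(p * (1 - p)) ^ m * (1 - p) ^ (card K * m) = (p * (1 - p) * (1 - p) ^ card K) ^ m"
          by (simp only: power_mult power_mult_distrib)
        also have "p * (1 - p) * (1 - p) ^ card K = p * (1 - p) ^ (card K + 1)" by simp
        finally show ?thesis by simp
      qed
      finally show ?thesis using True by (simp add: m_def)
    qed
  qed
qed

lemma sum_heavy_walks:
  fixes g :: "(nat \<Rightarrow> 'a) \<Rightarrow> real"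
  assumes "finite V"
  shows "(\<Sum>w\<in>closed_walks V N. if w \<in> heavy_walks V N then g w else 0) = (\<Sum>w\<in>heavy_walks V N. g w)"
proof -
  have "closed_walks V N \<inter> heavy_walks V N = heavy_walks V N" by (auto simp: heavy_walks_def)
  then show ?thesis
    using sum.inter_restrict[OF finite_closed_walks[OF assms, of N], of g "heavy_walks V N"] by simp
qed

text \<open>Comparison with \<open>U = {1..2 * k}\<close>, for which the room condition
  \<open>card V * t \<le> card U - k\<close> is exactly the hypothesis \<open>size\<close>.\<close>

lemma expectation_link_trace_le:
  assumes p: "0 < p" "p < 1" and k: "0 < k" and K: "K \<subseteq> {1..n}"
    and size: "real n * (p * (1 - p) ^ (card K + 1)) \<le> real k"
  shows "measure_pmf.expectation (Gnp n p) (\<lambda>E. \<Sum>a\<in>{1..n}. mat_pow {1..n} (link_matrix n p K E) (2 * k) a a)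
    \<le> real (card (heavy_walks {1..2 * k} (2 * k))) / (p * (1 - p))"
proof -
  define N where "N = 2 * k"
  define t where "t = p * (1 - p) ^ (card K + 1)"
  have fin: "finite (closed_walks {1..n} N)" by (simp add: finite_closed_walks)
  have "measure_pmf.expectation (Gnp n p) (\<lambda>E. \<Sum>a\<in>{1..n}. mat_pow {1..n} (link_matrix n p K E) N a a)
    = (\<Sum>w\<in>closed_walks {1..n} N. measure_pmf.expectation (Gnp n p) (\<lambda>E. \<Prod>i<N. link_matrix n p K E (w i) (w (Suc i))))"
    by (simp add: trace_mat_pow_eq_sum_closed_walks integrable_Gnp)
  also have "\<dots> \<le> (\<Sum>w\<in>closed_walks {1..n} N. if w \<in> heavy_walks {1..n} N then t ^ card (w ` {..N}) / (p * (1 - p)) else 0)"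
    unfolding t_def using k by (intro sum_mono expectation_link_matrix_walk_le p K) (simp_all add: N_def)
  also have "\<dots> = (\<Sum>w\<in>heavy_walks {1..n} N. t ^ card (w ` {..N}) / (p * (1 - p)))"
    by (rule sum_heavy_walks) simp
  also have "\<dots> = (\<Sum>w\<in>heavy_walks {1..n} (2 * k). t ^ card (w ` {..2 * k})) / (p * (1 - p))"
    by (simp add: sum_divide_distrib N_def)
  also have "\<dots> \<le> real (card (heavy_walks {1..2 * k} (2 * k))) / (p * (1 - p))"
    using size p by (intro divide_right_mono heavy_walks_comparison) (simp_all add: t_def)
  finally show ?thesis by (simp add: N_def)
qed

text \<open>From \<open>m = 3\<close> on the worst sign still leaves \<open>8/3 - 2/3\<close>. For
  \<open>m = 2\<close> that crude estimate would give only \<open>2/3\<close>, hence the separate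
  case, where the moment is 2.\<close>

lemma biased_moment_ge_1: "2 \<le> m \<Longrightarrow> (1::real) \<le> 1/3 * 2 ^ m + (1 - 1/3) * (- 1) ^ m" for m :: nat
proof -
  assume m: "2 \<le> m"
  show ?thesis
  proof (cases "m = 2")
    case False
    then have "(2::real) ^ 3 \<le> 2 ^ m" using m by (intro power_increasing) auto
    moreover have "(- 1 :: real) ^ m \<ge> - 1" by (cases "even m") auto
    ultimately show ?thesis by simp
  qed simp
qed

text \<open>The two-valued law on \<open>{2, -1}\<close> is centered and all its higher moments are at least 1, so
  the trace moments of its matrix count the walks that survive in \<open>link_matrix\<close>.\<close>

lemma heavy_walks_le_expectation_trace:
  "real (card (heavy_walks {1..r} N))
    \<le> measure_pmf.expectation (Gnp r (1/3)) (\<lambda>E. \<Sum>a\<in>{1..r}. mat_pow {1..r} (biased_matrix E) N a a)"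
proof -
  define Q where "Q w E = (\<Prod>i<N. biased_matrix E (w i) (w (Suc i)))" for w and E :: "nat set set"
  have fin: "finite (closed_walks {1..r} N)" by (simp add: finite_closed_walks)
  have "(if w \<in> heavy_walks {1..r} N then 1 else 0) \<le> measure_pmf.expectation (Gnp r (1/3)) (Q w)"
    if w: "w \<in> closed_walks {1..r} N" for w
  proof (cases "\<forall>i<N. w i \<noteq> w (Suc i)")
    case False
    then obtain i where i: "i < N" "w i = w (Suc i)" by blast
    have "Q w E = 0" for E
      unfolding Q_def by (rule prod_zero) (use i in \<open>auto simp: biased_matrix_def intro!: bexI[of _ i]\<close>)
    moreover have "w \<notin> heavy_walks {1..r} N" using False by (simp add: heavy_walks_def)
    ultimately show ?thesis by simp
  next
    case loopless: True
    define D where "D = walk_edges w N"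
    define f :: "nat set \<Rightarrow> real" where "f e = 1/3 * 2 ^ edge_mult w N e + (1 - 1/3) * (- 1) ^ edge_mult w N e" for e
    have D: "D \<subseteq> vertex_pairs r" unfolding D_def using w loopless by (intro walk_edges_subset) auto
    have QE: "Q w = (\<lambda>E. \<Prod>e\<in>D. (if e \<in> E then 2 else - 1) ^ edge_mult w N e)"
    proof (rule ext)
      fix E
      have "Q w E = (\<Prod>i<N. if {w i, w (Suc i)} \<in> E then 2 else - 1)"
        unfolding Q_def by (rule prod.cong[OF refl]) (use loopless in \<open>simp add: biased_matrix_def\<close>)
      also have "\<dots> = (\<Prod>e\<in>D. (if e \<in> E then 2 else - 1) ^ edge_mult w N e)"
        unfolding D_def by (rule prod_walk)
      finally show "Q w E = (\<Prod>e\<in>D. (if e \<in> E then 2 else - 1) ^ edge_mult w N e)" .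
    qed
    have E: "measure_pmf.expectation (Gnp r (1/3)) (Q w) = (\<Prod>e\<in>D. f e)"
      using expectation_Gnp_prod[OF _ _ D, of "1/3" "\<lambda>e b. (if b then 2 else - 1) ^ edge_mult w N e"]
      unfolding QE f_def by simp
    have f1: "f e = 0" if "edge_mult w N e = 1" for e using that by (simp add: f_def)
    have f2: "1 \<le> f e" if "2 \<le> edge_mult w N e" for e unfolding f_def using that by (rule biased_moment_ge_1)
    \<comment> \<open>Walks that are not heavy must not lower the sum: an edge used once has factor
      0, every other edge a factor at least 1, so no walk contributes negatively.\<close>
    have "0 \<le> f e" if "e \<in> D" for e
      using edge_mult_ge_1[of e w N] that f1[of e] f2[of e] unfolding D_def by (cases "edge_mult w N e = 1") auto
    then have "0 \<le> (\<Prod>e\<in>D. f e)" by (rule prod_nonneg)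
    moreover have "1 \<le> (\<Prod>e\<in>D. f e)" if "w \<in> heavy_walks {1..r} N"
    proof (rule prod_ge_1)
      fix e assume "e \<in> D"
      then obtain i where i: "i < N" "e = {w i, w (Suc i)}" unfolding D_def walk_edges_def by blast
      then show "1 \<le> f e" using that by (intro f2) (simp add: heavy_walks_def)
    qed
    ultimately show ?thesis unfolding E by simp
  qed
  then have "(\<Sum>w\<in>closed_walks {1..r} N. if w \<in> heavy_walks {1..r} N then 1 else 0)
      \<le> (\<Sum>w\<in>closed_walks {1..r} N. measure_pmf.expectation (Gnp r (1/3)) (Q w))"
    by (rule sum_mono)
  moreover have "real (card (heavy_walks {1..r} N))
      = (\<Sum>w\<in>closed_walks {1..r} N. if w \<in> heavy_walks {1..r} N then 1 else 0)"
    by (subst sum_heavy_walks) simp_all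
  moreover have "measure_pmf.expectation (Gnp r (1/3)) (\<lambda>E. \<Sum>a\<in>{1..r}. mat_pow {1..r} (biased_matrix E) N a a)
      = (\<Sum>w\<in>closed_walks {1..r} N. measure_pmf.expectation (Gnp r (1/3)) (Q w))"
  proof -
    have "Q w = (\<lambda>E. \<Prod>i<N. biased_matrix E (w i) (w (Suc i)))" for w by (rule ext) (simp add: Q_def)
    then show ?thesis by (simp add: trace_mat_pow_eq_sum_closed_walks integrable_Gnp)
  qed
  ultimately show ?thesis by simp
qed

section \<open>Operator norms through a grid net\<close>

definition bilin :: "'a set \<Rightarrow> ('a \<Rightarrow> 'a \<Rightarrow> real) \<Rightarrow> ('a \<Rightarrow> real) \<Rightarrow> ('a \<Rightarrow> real) \<Rightarrow> real" where
  "bilin V M x y = (\<Sum>i\<in>V. \<Sum>j\<in>V. x i * M i j * y j)"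

lemma bilin_scale: "bilin V M (\<lambda>i. c * x i) (\<lambda>j. d * y j) = c * d * bilin V M x y"
  unfolding bilin_def sum_distrib_left by (intro sum.cong refl) simp

lemma bilin_split:
  "bilin V M u v = bilin V M (\<lambda>i. u i - x i) v + bilin V M x (\<lambda>j. v j - y j) + bilin V M x y"
  unfolding bilin_def sum.distrib[symmetric] by (intro sum.cong refl) (simp add: algebra_simps)

text \<open>If \<open>S\<close> is the norm of the form and \<open>u, v\<close> are unit vectors with net points \<open>x, y\<close> nearby, then
  \<open>M(u, v) = M(u - x, v) + M(x, v - y) + M(x, y)\<close> gives \<open>S \<le> S/4 + 5S/16 + \<beta>\<close>.\<close>

lemma bilin_le_of_net:
  assumes V: "finite V"
    and net: "\<And>x. (\<Sum>i\<in>V. (x i)\<^sup>2) \<le> 1 \<Longrightarrow> \<exists>y\<in>T. (\<Sum>i\<in>V. (x i - y i)\<^sup>2) \<le> 1/16"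
    and T: "\<And>y. y \<in> T \<Longrightarrow> (\<Sum>i\<in>V. (y i)\<^sup>2) \<le> 25/16"
    and bd: "\<And>x y. x \<in> T \<Longrightarrow> y \<in> T \<Longrightarrow> \<bar>bilin V M x y\<bar> \<le> \<beta>"
    and u: "(\<Sum>i\<in>V. (u i)\<^sup>2) \<le> 1" and v: "(\<Sum>i\<in>V. (v i)\<^sup>2) \<le> 1"
  shows "\<bar>bilin V M u v\<bar> \<le> 3 * \<beta>"
proof -
  define D where "D = {u :: 'a \<Rightarrow> real. (\<Sum>i\<in>V. (u i)\<^sup>2) \<le> 1}"
  define f where "f p = \<bar>bilin V M (fst p) (snd p)\<bar>" for p
  define S where "S = (SUP p\<in>D \<times> D. f p)"
  have coord: "\<bar>u i\<bar> \<le> 1" if "u \<in> D" "i \<in> V" for u i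
  proof -
    have "(u i)\<^sup>2 \<le> (\<Sum>i\<in>V. (u i)\<^sup>2)" using that(2) V by (intro member_le_sum) auto
    then have "(u i)\<^sup>2 \<le> 1" using that(1) unfolding D_def by simp
    then show ?thesis by (simp add: abs_square_le_1)
  qed
  have bdd: "bdd_above (f ` (D \<times> D))"
  proof (rule bdd_aboveI2)
    fix p assume p: "p \<in> D \<times> D"
    have "f p \<le> (\<Sum>i\<in>V. \<Sum>j\<in>V. \<bar>fst p i * M i j * snd p j\<bar>)"
      unfolding f_def bilin_def by (intro order_trans[OF sum_abs] sum_mono order_refl)
    also have "\<dots> \<le> (\<Sum>i\<in>V. \<Sum>j\<in>V. \<bar>M i j\<bar>)"
    proof (intro sum_mono)
      fix i j assume ij: "i \<in> V" "j \<in> V"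
      have "\<bar>fst p i\<bar> * \<bar>M i j\<bar> * \<bar>snd p j\<bar> \<le> 1 * \<bar>M i j\<bar> * 1"
        using p ij by (intro mult_mono coord) auto
      then show "\<bar>fst p i * M i j * snd p j\<bar> \<le> \<bar>M i j\<bar>" by (simp add: abs_mult)
    qed
    finally show "f p \<le> (\<Sum>i\<in>V. \<Sum>j\<in>V. \<bar>M i j\<bar>)" .
  qed
  have S: "\<bar>bilin V M u v\<bar> \<le> S" if "u \<in> D" "v \<in> D" for u v
    using cSUP_upper[OF _ bdd, of "(u, v)"] that unfolding S_def f_def by simp
  have "f p \<le> 9/16 * S + \<beta>" if p: "p \<in> D \<times> D" for p
  proof -
    define u where "u = fst p"
    define v where "v = snd p"
    have uv: "u \<in> D" "v \<in> D" using p by (auto simp: u_def v_def)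
    obtain x where x: "x \<in> T" "(\<Sum>i\<in>V. (u i - x i)\<^sup>2) \<le> 1/16" using net uv(1) unfolding D_def by blast
    obtain y where y: "y \<in> T" "(\<Sum>i\<in>V. (v i - y i)\<^sup>2) \<le> 1/16" using net uv(2) unfolding D_def by blast
    have small: "(\<lambda>i. 4 * (a i - b i)) \<in> D" if "(\<Sum>i\<in>V. (a i - b i)\<^sup>2) \<le> 1/16" for a b
    proof -
      have "(\<Sum>i\<in>V. (4 * (a i - b i))\<^sup>2) = 4\<^sup>2 * (\<Sum>i\<in>V. (a i - b i)\<^sup>2)"
        by (simp only: power_mult_distrib sum_distrib_left)
      then show ?thesis using that unfolding D_def by simp
    qed
    have xD: "(\<lambda>i. 4/5 * x i) \<in> D"
      using T[OF x(1)] by (simp add: D_def power_mult_distrib power_divide sum_distrib_left[symmetric] sum_divide_distrib[symmetric])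
    have "\<bar>bilin V M (\<lambda>i. 4 * (u i - x i)) (\<lambda>i. 1 * v i)\<bar> \<le> S"
      using S[OF small[OF x(2)] uv(2)] by simp
    then have 1: "\<bar>bilin V M (\<lambda>i. u i - x i) v\<bar> \<le> S / 4"
      unfolding bilin_scale by (simp add: abs_mult)
    have "\<bar>bilin V M (\<lambda>i. 4/5 * x i) (\<lambda>i. 4 * (v i - y i))\<bar> \<le> S"
      by (rule S[OF xD small[OF y(2)]])
    then have 2: "\<bar>bilin V M x (\<lambda>i. v i - y i)\<bar> \<le> 5/16 * S"
      unfolding bilin_scale by (simp add: abs_mult)
    have "f p = \<bar>bilin V M (\<lambda>i. u i - x i) v + bilin V M x (\<lambda>j. v j - y j) + bilin V M x y\<bar>"
      unfolding f_def u_def[symmetric] v_def[symmetric] by (subst bilin_split[of V M u v x y]) simp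
    then show ?thesis using 1 2 bd[OF x(1) y(1)] by linarith
  qed
  moreover have "D \<times> D \<noteq> {}"
  proof -
    have "(\<lambda>_. 0) \<in> D" by (simp add: D_def)
    then show ?thesis by blast
  qed
  ultimately have "S \<le> 9/16 * S + \<beta>" unfolding S_def by (intro cSUP_least) auto
  moreover have "\<bar>bilin V M u v\<bar> \<le> S" using u v by (intro S) (simp_all add: D_def)
  \<comment> \<open>This makes \<open>S\<close>, and therefore \<open>\<beta>\<close>, nonnegative,
    so that \<open>S \<le> 16/7 * \<beta>\<close> can be rounded up to
    \<open>3 * \<beta>\<close>.\<close>
  moreover have "0 \<le> \<bar>bilin V M u v\<bar>" by simp
  ultimately show ?thesis by linarith
qed

text \<open>Evaluate the form at the unit vectors in the directions of \<open>M x\<close> and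
  \<open>x\<close>: the value is the ratio of their lengths \<open>p / q\<close>.\<close>

lemma operator_norm_le_of_bilin:
  assumes V: "finite V"
    and bd: "\<And>u v. (\<Sum>i\<in>V. (u i)\<^sup>2) \<le> 1 \<Longrightarrow> (\<Sum>i\<in>V. (v i)\<^sup>2) \<le> 1 \<Longrightarrow> \<bar>bilin V M u v\<bar> \<le> B"
  shows "(\<Sum>a\<in>V. (\<Sum>b\<in>V. M a b * x b)\<^sup>2) \<le> B\<^sup>2 * (\<Sum>b\<in>V. (x b)\<^sup>2)"
proof -
  define y where "y a = (\<Sum>b\<in>V. M a b * x b)" for a
  define p where "p = sqrt (\<Sum>a\<in>V. (y a)\<^sup>2)"
  define q where "q = sqrt (\<Sum>a\<in>V. (x a)\<^sup>2)"
  have p2: "p\<^sup>2 = (\<Sum>a\<in>V. (y a)\<^sup>2)" and q2: "q\<^sup>2 = (\<Sum>a\<in>V. (x a)\<^sup>2)"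
    unfolding p_def q_def by (simp_all add: sum_nonneg)
  have p0: "0 \<le> p" and q0: "0 \<le> q" unfolding p_def q_def by (simp_all add: sum_nonneg)
  have B0: "0 \<le> B" using bd[of "\<lambda>_. 0" "\<lambda>_. 0"] by simp
  have "p \<le> B * q"
  proof (cases "p = 0 \<or> q = 0")
    case True
    have "p = 0" if "q = 0"
    proof -
      have "\<forall>a\<in>V. x a = 0" using q2 that V by (simp add: sum_nonneg_eq_0_iff)
      then have "\<forall>a\<in>V. y a = 0" unfolding y_def by simp
      then show ?thesis using p2 by simp
    qed
    then show ?thesis using True B0 q0 by auto
  next
    case False
    have "\<bar>bilin V M (\<lambda>i. 1 / p * y i) (\<lambda>i. 1 / q * x i)\<bar> \<le> B"
      using False by (intro bd) (simp_all add: power_mult_distrib power_divide sum_divide_distrib[symmetric] flip: p2 q2)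
    moreover have "bilin V M y x = p\<^sup>2"
      unfolding bilin_def p2 y_def by (intro sum.cong refl) (simp add: power2_eq_square sum_distrib_left mult.assoc)
    ultimately have "\<bar>p / q\<bar> \<le> B"
      unfolding bilin_scale using False by (simp add: power2_eq_square field_simps)
    then show ?thesis using False q0 by (simp add: field_simps abs_if split: if_splits)
  qed
  then have "p\<^sup>2 \<le> (B * q)\<^sup>2" using p0 by (intro power_mono)
  then show ?thesis by (simp add: power_mult_distrib p2 q2 y_def)
qed

section \<open>A net of rescaled integer points\<close>

definition grid :: "nat \<Rightarrow> (nat \<Rightarrow> int) set" where
  "grid r = {z \<in> {1..r} \<rightarrow>\<^sub>E {- int (25 * r)..int (25 * r)}. (\<Sum>i\<in>{1..r}. (z i)\<^sup>2) \<le> 25 * int r}"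

text \<open>With mesh \<open>1 / (4 * sqrt r)\<close>, rounding each of \<open>r\<close> coordinates
  moves a vector by at most \<open>1/4\<close>. Rounded unit vectors thus have length at most
  \<open>5/4\<close>, which in integer coordinates is the bound \<open>25 * r\<close> of
  \<open>grid\<close>.\<close>

definition grid_point :: "nat \<Rightarrow> (nat \<Rightarrow> int) \<Rightarrow> nat \<Rightarrow> real" where
  "grid_point r z i = of_int (z i) / (4 * sqrt (real r))"

lemma finite_grid: "finite (grid r)"
  unfolding grid_def by (rule finite_subset[of _ "{1..r} \<rightarrow>\<^sub>E {- int (25 * r)..int (25 * r)}"]) (auto intro: finite_PiE)

lemma sum_half_powers_le:
  "(\<Sum>y\<in>{- int R..int R}. (1/2 :: real) ^ nat \<bar>y\<bar>) = 3 - 2 * (1/2) ^ R"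
proof (induction R)
  case (Suc R)
  have "{- int (Suc R)..int (Suc R)} = insert (int (Suc R)) (insert (- int (Suc R)) {- int R..int R})"
    by auto
  then have "(\<Sum>y\<in>{- int (Suc R)..int (Suc R)}. (1/2 :: real) ^ nat \<bar>y\<bar>)
      = (1/2) ^ Suc R + ((1/2) ^ Suc R + (\<Sum>y\<in>{- int R..int R}. (1/2) ^ nat \<bar>y\<bar>))"
    by (simp add: nat_add_distrib)
  then show ?case using Suc by simp
qed simp

text \<open>The weight \<open>g\<close> is at least 1 on the grid, because
  \<open>\<bar>z i\<bar>\<close> is at most its square for integers and the squares add up to at
  most \<open>25 * r\<close>. Summed over the whole box the weight factorizes, with a geometric
  series below 3 in each coordinate, and \<open>3 * 2 ^ 25 \<le> 2 ^ 27\<close>.\<close>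

lemma card_grid_le: "real (card (grid r)) \<le> (2 ^ 27) ^ r"
proof -
  let ?P = "{1..r} \<rightarrow>\<^sub>E {- int (25 * r)..int (25 * r)}"
  define g where "g z = (\<Prod>i\<in>{1..r}. 2 ^ 25 * (1/2 :: real) ^ nat \<bar>z i\<bar>)" for z :: "nat \<Rightarrow> int"
  have g1: "1 \<le> g z" if "z \<in> grid r" for z
  proof -
    have "int (\<Sum>i\<in>{1..r}. nat \<bar>z i\<bar>) = (\<Sum>i\<in>{1..r}. \<bar>z i\<bar>)" by simp
    also have "\<dots> \<le> (\<Sum>i\<in>{1..r}. (z i)\<^sup>2)"
    proof (rule sum_mono)
      fix i
      have "\<bar>z i\<bar> * 1 \<le> \<bar>z i\<bar> * \<bar>z i\<bar>" if "z i \<noteq> 0" using that by (intro mult_left_mono) auto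
      then show "\<bar>z i\<bar> \<le> (z i)\<^sup>2" by (cases "z i = 0") (simp_all add: power2_eq_square)
    qed
    also have "\<dots> \<le> 25 * int r" using that by (simp add: grid_def)
    finally have le: "(\<Sum>i\<in>{1..r}. nat \<bar>z i\<bar>) \<le> 25 * r" by linarith
    have "g z = (2 ^ 25) ^ r * (1/2) ^ (\<Sum>i\<in>{1..r}. nat \<bar>z i\<bar>)"
      unfolding g_def prod.distrib power_sum by simp
    also have "\<dots> \<ge> (2 ^ 25) ^ r * (1/2) ^ (25 * r)"
      using le by (intro mult_left_mono power_decreasing) auto
    also have "(2 ^ 25) ^ r * (1/2 :: real) ^ (25 * r) = 1"
      unfolding power_mult power_mult_distrib[symmetric] by simp
    finally show ?thesis .
  qed
  have "real (card (grid r)) = (\<Sum>z\<in>grid r. 1)" by simp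
  also have "\<dots> \<le> (\<Sum>z\<in>grid r. g z)" by (rule sum_mono[OF g1])
  also have "\<dots> \<le> (\<Sum>z\<in>?P. g z)"
    by (rule sum_mono2) (auto simp: grid_def g_def intro!: finite_PiE prod_nonneg)
  also have "\<dots> = (\<Prod>i\<in>{1..r}. \<Sum>y\<in>{- int (25 * r)..int (25 * r)}. 2 ^ 25 * (1/2) ^ nat \<bar>y\<bar>)"
    unfolding g_def by (rule prod_sum_PiE[symmetric]) auto
  also have "\<dots> = (2 ^ 25 * (3 - 2 * (1/2) ^ (25 * r))) ^ r"
    unfolding sum_distrib_left[symmetric] sum_half_powers_le by simp
  also have "\<dots> \<le> (2 ^ 27) ^ r"
  proof (rule power_mono)
    have "(1/2 :: real) ^ (25 * r) \<le> 1" by (rule power_le_one) auto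
    then show "(0::real) \<le> 2 ^ 25 * (3 - 2 * (1/2) ^ (25 * r))" by simp
    have *: "2 ^ 25 * (3 - 2 * y) \<le> 2 ^ 27" if "0 \<le> y" for y :: real using that by simp
    show "2 ^ 25 * (3 - 2 * (1/2) ^ (25 * r)) \<le> (2 ^ 27 :: real)" by (rule *) simp
  qed
  finally show ?thesis .
qed

lemma grid_point_norm:
  assumes "0 < r"
  shows "(\<Sum>i\<in>{1..r}. (grid_point r z i)\<^sup>2) = of_int (\<Sum>i\<in>{1..r}. (z i)\<^sup>2) / (16 * real r)"
  using assms by (simp add: grid_point_def power_divide power_mult_distrib sum_divide_distrib)

lemma grid_point_norm_le:
  assumes "0 < r" "z \<in> grid r"
  shows "(\<Sum>i\<in>{1..r}. (grid_point r z i)\<^sup>2) \<le> 25/16"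
proof -
  have "(\<Sum>i\<in>{1..r}. (z i)\<^sup>2) \<le> 25 * int r" using assms(2) by (simp add: grid_def)
  then have "of_int (\<Sum>i\<in>{1..r}. (z i)\<^sup>2) \<le> (of_int (25 * int r) :: real)" by (rule of_int_le_iff[THEN iffD2])
  then show ?thesis unfolding grid_point_norm[OF assms(1)] using assms(1) by (simp add: field_simps)
qed

lemma grid_approx:
  assumes r: "0 < r" and x: "(\<Sum>i\<in>{1..r}. (x i)\<^sup>2) \<le> 1"
  shows "\<exists>z\<in>grid r. (\<Sum>i\<in>{1..r}. (x i - grid_point r z i)\<^sup>2) \<le> 1/16"
proof -
  define s where "s = 4 * sqrt (real r)"
  define z where "z = (\<lambda>i\<in>{1..r}. \<lfloor>s * x i\<rfloor>)"
  have s: "0 < s" "s\<^sup>2 = 16 * real r" using r by (simp_all add: s_def power_mult_distrib)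
  have near: "(x i - grid_point r z i)\<^sup>2 \<le> (1 / s)\<^sup>2" if "i \<in> {1..r}" for i
  proof -
    have "\<bar>s * x i - of_int \<lfloor>s * x i\<rfloor>\<bar> \<le> 1" by linarith
    moreover have "x i - grid_point r z i = (s * x i - of_int \<lfloor>s * x i\<rfloor>) / s"
    proof -
      have "grid_point r z i = of_int \<lfloor>s * x i\<rfloor> / s" using that by (simp add: grid_point_def z_def s_def)
      then show ?thesis using s(1) by (simp add: field_simps)
    qed
    ultimately have "\<bar>x i - grid_point r z i\<bar> \<le> 1 / s"
      using s(1) by (simp add: abs_divide divide_right_mono)
    then show ?thesis by (rule power2_le_iff_abs_le[THEN iffD2, rotated]) (use s in simp)
  qed
  have "(\<Sum>i\<in>{1..r}. (x i - grid_point r z i)\<^sup>2) \<le> (\<Sum>i\<in>{1..r}. (1 / s)\<^sup>2)"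
    by (rule sum_mono[OF near])
  also have "\<dots> = 1/16" using r s by (simp add: power_divide)
  finally have app: "(\<Sum>i\<in>{1..r}. (x i - grid_point r z i)\<^sup>2) \<le> 1/16" .
  have "L2_set (grid_point r z) {1..r} = L2_set (\<lambda>i. x i + (grid_point r z i - x i)) {1..r}" by simp
  also have "\<dots> \<le> L2_set x {1..r} + L2_set (\<lambda>i. grid_point r z i - x i) {1..r}"
    by (rule L2_set_triangle_ineq)
  also have "\<dots> \<le> 1 + 1/4"
  proof (rule add_mono)
    show "L2_set x {1..r} \<le> 1" unfolding L2_set_def using x by simp
    have "L2_set (\<lambda>i. grid_point r z i - x i) {1..r} \<le> sqrt ((1/4)\<^sup>2)"
    proof -
      have "(\<Sum>i\<in>{1..r}. (grid_point r z i - x i)\<^sup>2) = (\<Sum>i\<in>{1..r}. (x i - grid_point r z i)\<^sup>2)"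
        by (intro sum.cong refl power2_commute)
      then show ?thesis
        unfolding L2_set_def using app by (intro real_sqrt_le_mono) (simp add: power2_eq_square)
    qed
    then show "L2_set (\<lambda>i. grid_point r z i - x i) {1..r} \<le> 1/4" by simp
  qed
  finally have "sqrt (\<Sum>i\<in>{1..r}. (grid_point r z i)\<^sup>2) \<le> 5/4" by (simp add: L2_set_def)
  then have "(\<Sum>i\<in>{1..r}. (grid_point r z i)\<^sup>2) \<le> (5/4)\<^sup>2" by (rule sqrt_le_D)
  then have "of_int (\<Sum>i\<in>{1..r}. (z i)\<^sup>2) \<le> (of_int (25 * int r) :: real)"
    unfolding grid_point_norm[OF r] using r by (simp add: power2_eq_square field_simps)
  then have norm: "(\<Sum>i\<in>{1..r}. (z i)\<^sup>2) \<le> 25 * int r" by (rule of_int_le_iff[THEN iffD1])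
  have "z i \<in> {- int (25 * r)..int (25 * r)}" if "i \<in> {1..r}" for i
  proof -
    have "(z i)\<^sup>2 \<le> (\<Sum>i\<in>{1..r}. (z i)\<^sup>2)" using that by (intro member_le_sum) auto
    then have "(z i)\<^sup>2 \<le> 25 * int r" using norm by linarith
    moreover have "\<bar>z i\<bar> \<le> (z i)\<^sup>2"
    proof (cases "z i = 0")
      case False
      then have "\<bar>z i\<bar> * 1 \<le> \<bar>z i\<bar> * \<bar>z i\<bar>" by (intro mult_left_mono) auto
      then show ?thesis by (simp add: power2_eq_square)
    qed simp
    ultimately have "\<bar>z i\<bar> \<le> 25 * int r" by linarith
    then show ?thesis by auto
  qed
  then have "z \<in> grid r" using norm by (auto simp: grid_def z_def)
  then show ?thesis using app by blast
qed

section \<open>The trace moment of the comparison matrix\<close>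

text \<open>The form suited to centered variables: the linear term cancels in expectation, leaving a
  subgaussian bound on the moment generating function.\<close>

lemma exp_le_add_exp_square: "exp x \<le> x + exp (x\<^sup>2)" for x :: real
proof -
  have sq: "1 + x\<^sup>2 \<le> exp (x\<^sup>2)" by (rule exp_ge_add_one_self)
  consider "x \<le> 0" | "0 \<le> x" "x \<le> 1" | "1 \<le> x" by linarith
  then show ?thesis
  proof cases
    case 1
    have "exp x * (1 - x) \<le> exp x * exp (- x)"
      using exp_ge_add_one_self[of "- x"] by (intro mult_left_mono) auto
    also have "\<dots> = 1" by (simp add: exp_minus)
    also have "\<dots> \<le> (1 + x + x\<^sup>2) * (1 - x)"
    proof -
      have "(1 + x + x\<^sup>2) * (1 - x) = 1 + (- x) * x\<^sup>2" by (simp add: algebra_simps power2_eq_square)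
      moreover have "0 \<le> (- x) * x\<^sup>2" using 1 by (intro mult_nonneg_nonneg) auto
      ultimately show ?thesis by linarith
    qed
    finally have "exp x \<le> 1 + x + x\<^sup>2" using 1 by (simp add: mult_le_cancel_right)
    then show ?thesis using sq by linarith
  next
    case 2
    then have "exp x \<le> 1 + x + x\<^sup>2" by (intro exp_bound)
    then show ?thesis using sq by linarith
  next
    case 3
    then have "x * 1 \<le> x * x" by (intro mult_left_mono) auto
    then have "exp x \<le> exp (x\<^sup>2)" by (simp add: power2_eq_square)
    then show ?thesis using 3 by linarith
  qed
qed

lemma biased_mgf_le: "1/3 * exp (t * 2) + (1 - 1/3) * exp (t * (- 1)) \<le> exp (4 * t\<^sup>2)" for t :: real
proof -
  have "exp (t * 2) \<le> t * 2 + exp (4 * t\<^sup>2)"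
    using exp_le_add_exp_square[of "t * 2"] by (simp add: power_mult_distrib mult.commute)
  moreover have "exp (t * (- 1)) \<le> - t + exp (4 * t\<^sup>2)"
  proof -
    have "exp (t\<^sup>2) \<le> exp (4 * t\<^sup>2)" by simp
    moreover have "exp (- t) \<le> - t + exp (t\<^sup>2)" using exp_le_add_exp_square[of "- t"] by simp
    ultimately show ?thesis unfolding mult_minus1_right by linarith
  qed
  ultimately show ?thesis by simp
qed

text \<open>For \<open>e = {i, j}\<close> this is \<open>x i * y j + x j * y i\<close>. The
  symmetric matrix has one independent variable per unordered pair, and these are the coefficients
  of the bilinear form as a linear form in those variables.\<close>

definition pair_coeff :: "nat \<Rightarrow> (nat \<Rightarrow> real) \<Rightarrow> (nat \<Rightarrow> real) \<Rightarrow> nat set \<Rightarrow> real" where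
  "pair_coeff r x y e = (\<Sum>(i, j)\<in>{p \<in> {1..r} \<times> {1..r}. {fst p, snd p} = e}. x i * y j)"

lemma bilin_biased_matrix:
  "bilin {1..r} (biased_matrix E) x y
    = (\<Sum>e\<in>vertex_pairs r. pair_coeff r x y e * (if e \<in> E then 2 else - 1))"
proof -
  define A where "A = {p \<in> {1..r} \<times> {1..r}. fst p \<noteq> snd p}"
  define f where "f p = {fst p, snd p}" for p :: "nat \<times> nat"
  define g where "g p = x (fst p) * y (snd p) * (if f p \<in> E then 2 else - 1)" for p
  have finA: "finite A" by (simp add: A_def)
  have "bilin {1..r} (biased_matrix E) x y
      = (\<Sum>p\<in>{1..r} \<times> {1..r}. x (fst p) * biased_matrix E (fst p) (snd p) * y (snd p))"
    unfolding bilin_def by (simp add: sum.cartesian_product case_prod_unfold)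
  also have "\<dots> = (\<Sum>p\<in>A. g p)"
    unfolding A_def by (rule sum.mono_neutral_cong_right) (auto simp: biased_matrix_def g_def f_def)
  also have "\<dots> = (\<Sum>e\<in>vertex_pairs r. \<Sum>p\<in>{p \<in> A. f p = e}. g p)"
  proof (rule sum.group[OF finA finite_vertex_pairs, symmetric], rule image_subsetI)
    fix p assume "p \<in> A"
    then show "f p \<in> vertex_pairs r"
      unfolding f_def doubleton_in_vertex_pairs by (simp add: A_def mem_Times_iff)
  qed
  also have "\<dots> = (\<Sum>e\<in>vertex_pairs r. pair_coeff r x y e * (if e \<in> E then 2 else - 1))"
  proof (rule sum.cong[OF refl])
    fix e assume e: "e \<in> vertex_pairs r"
    have "{p \<in> A. f p = e} = {p \<in> {1..r} \<times> {1..r}. {fst p, snd p} = e}"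
    proof (rule Collect_cong)
      fix p
      have "fst p \<noteq> snd p" if "{fst p, snd p} = e"
        using e unfolding that[symmetric] doubleton_in_vertex_pairs by simp
      then show "(p \<in> A \<and> f p = e) = (p \<in> {1..r} \<times> {1..r} \<and> {fst p, snd p} = e)"
        unfolding A_def f_def by blast
    qed
    then show "(\<Sum>p\<in>{p \<in> A. f p = e}. g p) = pair_coeff r x y e * (if e \<in> E then 2 else - 1)"
      unfolding pair_coeff_def sum_distrib_right by (intro sum.cong) (simp_all add: g_def f_def case_prod_unfold)
  qed
  finally show ?thesis .
qed

text \<open>A pair has at most two orderings, and the square of a sum of two terms is at most twice
  the sum of their squares; what remains is part of the product of the two squared norms.\<close>

lemma sum_pair_coeff_square_le:
  "(\<Sum>e\<in>vertex_pairs r. (pair_coeff r x y e)\<^sup>2) \<le> 2 * ((\<Sum>i\<in>{1..r}. (x i)\<^sup>2) * (\<Sum>i\<in>{1..r}. (y i)\<^sup>2))"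
proof -
  define V where "V = {1..r}"
  define f where "f p = {fst p, snd p}" for p :: "nat \<times> nat"
  define g where "g p = (x (fst p) * y (snd p))\<^sup>2" for p
  define A where "A e = {p \<in> V \<times> V. f p = e}" for e
  have finA: "finite (A e)" for e
    by (rule finite_subset[of _ "V \<times> V"]) (simp_all add: A_def V_def)
  have "(pair_coeff r x y e)\<^sup>2 \<le> 2 * (\<Sum>p\<in>A e. g p)" if e: "e \<in> vertex_pairs r" for e
  proof -
    have "card e = 2" using e by (simp add: vertex_pairs_def)
    then have "\<exists>a b. e = {a, b} \<and> a \<noteq> b" by (simp only: card_2_iff)
    then obtain a b where ab: "e = {a, b}" by (elim exE conjE)
    have "A e \<subseteq> {(a, b), (b, a)}"
    proof
      fix p assume "p \<in> A e"
      then have "{fst p, snd p} = {a, b}" by (simp add: A_def f_def ab)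
      then have "(fst p = a \<and> snd p = b) \<or> (fst p = b \<and> snd p = a)" by (simp only: doubleton_eq_iff)
      then show "p \<in> {(a, b), (b, a)}" by (simp add: prod_eq_iff)
    qed
    then have "A e \<subseteq> set [(a, b), (b, a)]" by simp
    then have "card (A e) \<le> card (set [(a, b), (b, a)])" by (rule card_mono[OF finite_set])
    also have "\<dots> \<le> length [(a, b), (b, a)]" by (rule card_length)
    finally have c: "card (A e) \<le> 2" by simp
    have "(pair_coeff r x y e)\<^sup>2 = (\<Sum>p\<in>A e. 1 * (x (fst p) * y (snd p)))\<^sup>2"
      by (simp only: pair_coeff_def A_def V_def f_def case_prod_unfold mult_1)
    also have "\<dots> \<le> (\<Sum>p\<in>A e. 1\<^sup>2) * (\<Sum>p\<in>A e. g p)"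
      unfolding g_def by (rule Cauchy_Schwarz_ineq_sum)
    also have "\<dots> \<le> 2 * (\<Sum>p\<in>A e. g p)"
      using c by (intro mult_right_mono sum_nonneg) (simp_all add: g_def)
    finally show ?thesis .
  qed
  then have "(\<Sum>e\<in>vertex_pairs r. (pair_coeff r x y e)\<^sup>2) \<le> (\<Sum>e\<in>vertex_pairs r. 2 * (\<Sum>p\<in>A e. g p))"
    by (rule sum_mono)
  also have "\<dots> = 2 * (\<Sum>e\<in>vertex_pairs r. \<Sum>p\<in>A e. g p)" by (simp add: sum_distrib_left)
  also have "(\<Sum>e\<in>vertex_pairs r. \<Sum>p\<in>A e. g p) = (\<Sum>p\<in>(\<Union>e\<in>vertex_pairs r. A e). g p)"
  proof (rule sum.UNION_disjoint[symmetric])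
    show "\<forall>i\<in>vertex_pairs r. \<forall>j\<in>vertex_pairs r. i \<noteq> j \<longrightarrow> A i \<inter> A j = {}"
      unfolding A_def by blast
  qed (simp_all add: finA finite_vertex_pairs)
  also have "\<dots> \<le> (\<Sum>p\<in>V \<times> V. g p)"
  proof (rule sum_mono2)
    show "(\<Union>e\<in>vertex_pairs r. A e) \<subseteq> V \<times> V" unfolding A_def by blast
  qed (simp_all add: V_def g_def)
  also have "\<dots> = (\<Sum>i\<in>V. (x i)\<^sup>2) * (\<Sum>i\<in>V. (y i)\<^sup>2)"
    unfolding sum_product sum.cartesian_product by (intro sum.cong refl) (auto simp: g_def power_mult_distrib)
  finally show ?thesis by (simp add: V_def)
qed

lemma expectation_exp_bilin_le:
  "measure_pmf.expectation (Gnp r (1/3)) (\<lambda>E. exp (s * bilin {1..r} (biased_matrix E) x y))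
    \<le> exp (8 * s\<^sup>2 * ((\<Sum>i\<in>{1..r}. (x i)\<^sup>2) * (\<Sum>i\<in>{1..r}. (y i)\<^sup>2)))"
proof -
  let ?P = "vertex_pairs r"
  define c where "c e = s * pair_coeff r x y e" for e
  have "exp (s * bilin {1..r} (biased_matrix E) x y) = (\<Prod>e\<in>?P. exp (c e * (if e \<in> E then 2 else - 1)))" for E
    unfolding bilin_biased_matrix sum_distrib_left exp_sum[OF finite_vertex_pairs] c_def by (simp add: mult.assoc)
  then have "measure_pmf.expectation (Gnp r (1/3)) (\<lambda>E. exp (s * bilin {1..r} (biased_matrix E) x y))
     = (\<Prod>e\<in>?P. 1/3 * exp (c e * 2) + (1 - 1/3) * exp (c e * (- 1)))"
    using expectation_Gnp_prod[of "1/3" ?P r "\<lambda>e b. exp (c e * (if b then 2 else - 1))"] by simp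
  also have "\<dots> \<le> (\<Prod>e\<in>?P. exp (4 * (c e)\<^sup>2))"
    using biased_mgf_le by (intro prod_mono) (auto intro!: add_nonneg_nonneg)
  also have "\<dots> = exp (\<Sum>e\<in>?P. 4 * (c e)\<^sup>2)" by (rule exp_sum[OF finite_vertex_pairs, symmetric])
  also have "(\<Sum>e\<in>?P. 4 * (c e)\<^sup>2) = 4 * s\<^sup>2 * (\<Sum>e\<in>?P. (pair_coeff r x y e)\<^sup>2)"
    by (simp add: c_def power_mult_distrib sum_distrib_left mult.assoc)
  also have "exp \<dots> \<le> exp (4 * s\<^sup>2 * (2 * ((\<Sum>i\<in>{1..r}. (x i)\<^sup>2) * (\<Sum>i\<in>{1..r}. (y i)\<^sup>2))))"
    by (intro iffD2[OF exp_le_cancel_iff] mult_left_mono sum_pair_coeff_square_le) auto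
  finally show ?thesis by (simp add: mult.assoc)
qed

text \<open>The \<open>N\<close>-th power of \<open>y \<le> exp y\<close> at
  \<open>y = \<bar>x\<bar> / N\<close>. It turns exponential moments into moments of order
  \<open>N\<close>.\<close>

lemma power_le_exp_add_exp:
  fixes x :: real
  assumes "0 < N" "even N"
  shows "x ^ N \<le> real N ^ N * (exp x + exp (- x))"
proof -
  have "\<bar>x\<bar> / N \<le> exp (\<bar>x\<bar> / N)" using exp_ge_add_one_self[of "\<bar>x\<bar> / N"] by linarith
  then have "(\<bar>x\<bar> / N) ^ N \<le> exp (\<bar>x\<bar> / N) ^ N" by (intro power_mono) auto
  also have "\<dots> = exp \<bar>x\<bar>" using assms(1) by (simp flip: exp_of_nat_mult)
  also have "\<dots> \<le> exp x + exp (- x)" by (cases "0 \<le> x") simp_all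
  finally have "\<bar>x\<bar> ^ N \<le> (exp x + exp (- x)) * real N ^ N"
    using assms(1) by (simp add: power_divide field_simps)
  then show ?thesis using assms(2) by (simp add: power_even_abs mult.commute)
qed

text \<open>The exponential moment is taken at \<open>s = sqrt N\<close> with
  \<open>N = 2 * k\<close>. This balances the two losses: \<open>(N / s) ^ N\<close> becomes
  \<open>N ^ k\<close>, and the exponent \<open>8 * s ^ 2\<close> times the squared norms stays
  linear in \<open>k\<close>. The product of those norms is at most \<open>625/256\<close>, rounded
  up to \<open>5/2\<close>, which gives \<open>40 * k\<close>.\<close>

lemma expectation_bilin_moment_le:
  assumes k: "0 < k" and x: "(\<Sum>i\<in>{1..2 * k}. (x i)\<^sup>2) \<le> 25/16" and y: "(\<Sum>i\<in>{1..2 * k}. (y i)\<^sup>2) \<le> 25/16"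
  shows "measure_pmf.expectation (Gnp (2 * k) (1/3)) (\<lambda>E. bilin {1..2 * k} (biased_matrix E) x y ^ (2 * k))
    \<le> real (2 * k) ^ k * (2 * exp (40 * real k))"
proof -
  define N where "N = 2 * k"
  define s where "s = sqrt (real N)"
  define Z where "Z E = bilin {1..N} (biased_matrix E) x y" for E
  have N: "0 < N" "even N" using k by (auto simp: N_def)
  have s: "s\<^sup>2 = real N" "0 < s" using N by (auto simp: s_def)
  have sN: "s ^ N = real N ^ k" unfolding N_def power_mult using s by (simp add: N_def)
  have xy: "(\<Sum>i\<in>{1..N}. (x i)\<^sup>2) * (\<Sum>i\<in>{1..N}. (y i)\<^sup>2) \<le> 5/2"
  proof -
    have "(\<Sum>i\<in>{1..N}. (x i)\<^sup>2) * (\<Sum>i\<in>{1..N}. (y i)\<^sup>2) \<le> 25/16 * (25/16)"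
      using x y unfolding N_def by (intro mult_mono sum_nonneg) auto
    then show ?thesis by simp
  qed
  have mgf: "measure_pmf.expectation (Gnp N (1/3)) (\<lambda>E. exp (t * Z E)) \<le> exp (40 * real k)" if "t\<^sup>2 = real N" for t
  proof -
    have "8 * t\<^sup>2 * ((\<Sum>i\<in>{1..N}. (x i)\<^sup>2) * (\<Sum>i\<in>{1..N}. (y i)\<^sup>2)) \<le> 8 * real N * (5/2)"
      unfolding that using xy by (intro mult_left_mono) auto
    also have "\<dots> = 40 * real k" by (simp add: N_def)
    finally have "exp (8 * t\<^sup>2 * ((\<Sum>i\<in>{1..N}. (x i)\<^sup>2) * (\<Sum>i\<in>{1..N}. (y i)\<^sup>2))) \<le> exp (40 * real k)"
      by (simp only: exp_le_cancel_iff)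
    then show ?thesis
      unfolding Z_def by (rule order_trans[OF expectation_exp_bilin_le])
  qed
  have "Z E ^ N \<le> real N ^ k * (exp (s * Z E) + exp (- s * Z E))" for E
  proof -
    have "s ^ N * Z E ^ N \<le> real N ^ N * (exp (s * Z E) + exp (- s * Z E))"
      using power_le_exp_add_exp[OF N, of "s * Z E"] by (simp add: power_mult_distrib)
    moreover have "real N ^ N = real N ^ k * real N ^ k"
    proof -
      have "N = k + k" by (simp add: N_def)
      then show ?thesis by (metis power_add)
    qed
    ultimately have "real N ^ k * Z E ^ N \<le> real N ^ k * (real N ^ k * (exp (s * Z E) + exp (- s * Z E)))"
      by (simp only: sN mult.assoc)
    moreover have "0 < real N ^ k" using N by simp
    ultimately show ?thesis by (simp only: mult_le_cancel_left_pos)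
  qed
  then have "measure_pmf.expectation (Gnp N (1/3)) (\<lambda>E. Z E ^ N)
      \<le> measure_pmf.expectation (Gnp N (1/3)) (\<lambda>E. real N ^ k * (exp (s * Z E) + exp (- s * Z E)))"
    by (intro integral_mono integrable_Gnp)
  also have "\<dots> = real N ^ k * (measure_pmf.expectation (Gnp N (1/3)) (\<lambda>E. exp (s * Z E))
      + measure_pmf.expectation (Gnp N (1/3)) (\<lambda>E. exp (- s * Z E)))"
    by (simp add: integrable_Gnp)
  also have "\<dots> \<le> real N ^ k * (exp (40 * real k) + exp (40 * real k))"
    using s by (intro mult_left_mono add_mono mgf) auto
  finally show ?thesis by (simp add: N_def Z_def)
qed

text \<open>Per unit of \<open>k\<close>: \<open>8 * 2\<close> absorbs the factor \<open>4k\<close>, \<open>9\<close> is the loss \<open>3\<^sup>2\<close> from norm to net, \<open>2 ^ 108\<close> the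
  squared size of the net in dimension \<open>2k\<close>, \<open>2 * k\<close> and \<open>exp 40\<close> come from the moments at net points.\<close>

definition trace_const :: real where
  "trace_const = 8 * 9 * 2 ^ 108 * 2 * 2 * exp 40"

text \<open>The operator norm is at most three times the maximum of the form over pairs of net
  points, and the \<open>2k\<close>-th power of that maximum is at most the sum of the
  \<open>2k\<close>-th powers. Taking the sum inside the expectation multiplies a single moment by
  the squared size of the net, which is only exponential in \<open>k\<close>.\<close>

lemma expectation_biased_trace_le:
  assumes k: "0 < k"
  shows "measure_pmf.expectation (Gnp (2 * k) (1/3)) (\<lambda>E. \<Sum>a\<in>{1..2 * k}. mat_pow {1..2 * k} (biased_matrix E) (2 * k) a a)
    \<le> (trace_const * real k) ^ k"
proof -
  define r where "r = 2 * k"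
  define G where "G = grid_point r ` grid r"
  define Z where "Z E q = bilin {1..r} (biased_matrix E) (fst q) (snd q)" for E and q :: "(nat \<Rightarrow> real) \<times> (nat \<Rightarrow> real)"
  have r: "0 < r" using k by (simp add: r_def)
  have finG: "finite G" by (simp add: G_def finite_grid)
  have G_ne: "G \<noteq> {}" using grid_approx[OF r, of "\<lambda>_. 0"] by (auto simp: G_def)
  have cardG: "real (card G) \<le> (2 ^ 27) ^ r"
    using card_image_le[OF finite_grid[of r], of "grid_point r"] card_grid_le[of r] unfolding G_def by linarith
  have normG: "(\<Sum>i\<in>{1..r}. (y i)\<^sup>2) \<le> 25/16" if "y \<in> G" for y
    using that grid_point_norm_le[OF r] by (auto simp: G_def)
  have approx: "\<exists>y\<in>G. (\<Sum>i\<in>{1..r}. (x i - y i)\<^sup>2) \<le> 1/16" if "(\<Sum>i\<in>{1..r}. (x i)\<^sup>2) \<le> 1" for x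
    using grid_approx[OF r that] unfolding G_def by blast
  have tr: "(\<Sum>a\<in>{1..r}. mat_pow {1..r} (biased_matrix E) r a a) \<le> real r * 9 ^ k * (\<Sum>q\<in>G \<times> G. Z E q ^ r)" for E
  proof -
    have "finite ((\<lambda>q. \<bar>Z E q\<bar>) ` (G \<times> G))" "(\<lambda>q. \<bar>Z E q\<bar>) ` (G \<times> G) \<noteq> {}" using finG G_ne by auto
    then have "Max ((\<lambda>q. \<bar>Z E q\<bar>) ` (G \<times> G)) \<in> (\<lambda>q. \<bar>Z E q\<bar>) ` (G \<times> G)" by (rule Max_in)
    then obtain q where q: "q \<in> G \<times> G" "Max ((\<lambda>q. \<bar>Z E q\<bar>) ` (G \<times> G)) = \<bar>Z E q\<bar>" by blast
    define \<beta> where "\<beta> = \<bar>Z E q\<bar>"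
    have bd: "\<bar>bilin {1..r} (biased_matrix E) x y\<bar> \<le> \<beta>" if "x \<in> G" "y \<in> G" for x y
    proof -
      have "\<bar>Z E (x, y)\<bar> \<le> Max ((\<lambda>q. \<bar>Z E q\<bar>) ` (G \<times> G))"
        by (rule Max_ge) (use finG that in auto)
      then have "\<bar>Z E (x, y)\<bar> \<le> \<beta>" by (simp only: q(2) \<beta>_def)
      then show ?thesis by (simp add: Z_def)
    qed
    have "(\<Sum>a\<in>{1..r}. mat_pow {1..r} (biased_matrix E) (2 * k) a a) \<le> real (card {1..r}) * (3 * \<beta>) ^ (2 * k)"
    proof (rule trace_mat_pow_le)
      show "(\<Sum>a\<in>{1..r}. (\<Sum>b\<in>{1..r}. biased_matrix E a b * x b)\<^sup>2) \<le> (3 * \<beta>)\<^sup>2 * (\<Sum>b\<in>{1..r}. (x b)\<^sup>2)" for x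
      proof (rule operator_norm_le_of_bilin)
        fix u v :: "nat \<Rightarrow> real"
        assume uv: "(\<Sum>i\<in>{1..r}. (u i)\<^sup>2) \<le> 1" "(\<Sum>i\<in>{1..r}. (v i)\<^sup>2) \<le> 1"
        show "\<bar>bilin {1..r} (biased_matrix E) u v\<bar> \<le> 3 * \<beta>"
        proof (rule bilin_le_of_net[where T = G])
          show "\<exists>y\<in>G. (\<Sum>i\<in>{1..r}. (x i - y i)\<^sup>2) \<le> 1/16" if "(\<Sum>i\<in>{1..r}. (x i)\<^sup>2) \<le> 1" for x
            using that by (rule approx)
          show "(\<Sum>i\<in>{1..r}. (y i)\<^sup>2) \<le> 25/16" if "y \<in> G" for y using that by (rule normG)
          show "\<bar>bilin {1..r} (biased_matrix E) x y\<bar> \<le> \<beta>" if "x \<in> G" "y \<in> G" for x y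
            using that by (rule bd)
        qed (use uv in simp_all)
      qed simp
    qed (simp_all add: biased_matrix_sym)
    also have "\<dots> = real r * 9 ^ k * \<beta> ^ r"
      by (simp add: power_mult_distrib power_mult r_def)
    also have "\<beta> ^ r = Z E q ^ r" unfolding \<beta>_def by (simp add: r_def power_even_abs)
    also have "real r * 9 ^ k * Z E q ^ r \<le> real r * 9 ^ k * (\<Sum>q\<in>G \<times> G. Z E q ^ r)"
      using q(1) finG by (intro mult_left_mono member_le_sum) (auto simp: r_def zero_le_even_power)
    finally show ?thesis by (simp add: r_def)
  qed
  have "measure_pmf.expectation (Gnp r (1/3)) (\<lambda>E. \<Sum>a\<in>{1..r}. mat_pow {1..r} (biased_matrix E) r a a)
     \<le> measure_pmf.expectation (Gnp r (1/3)) (\<lambda>E. real r * 9 ^ k * (\<Sum>q\<in>G \<times> G. Z E q ^ r))"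
    by (intro integral_mono integrable_Gnp tr)
  also have "\<dots> = real r * 9 ^ k * (\<Sum>q\<in>G \<times> G. measure_pmf.expectation (Gnp r (1/3)) (\<lambda>E. Z E q ^ r))"
    by (simp add: integrable_Gnp)
  also have "\<dots> \<le> real r * 9 ^ k * (\<Sum>q\<in>G \<times> G. real (2 * k) ^ k * (2 * exp (40 * real k)))"
  proof (intro mult_left_mono sum_mono)
    fix q assume "q \<in> G \<times> G"
    then show "measure_pmf.expectation (Gnp r (1/3)) (\<lambda>E. Z E q ^ r) \<le> real (2 * k) ^ k * (2 * exp (40 * real k))"
      unfolding Z_def r_def using normG by (intro expectation_bilin_moment_le[OF k]) (auto simp: r_def)
  qed simp
  also have "\<dots> = real r * 9 ^ k * (real (card G) * real (card G) * (real (2 * k) ^ k * (2 * exp (40 * real k))))"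
    by (simp add: card_cartesian_product)
  also have "\<dots> \<le> real r * 9 ^ k * ((2 ^ 27) ^ r * (2 ^ 27) ^ r * (real (2 * k) ^ k * (2 * exp (40 * real k))))"
    by (intro mult_left_mono mult_right_mono mult_mono cardG) auto
  also have "\<dots> = 4 * real k * 9 ^ k * (2 ^ 108) ^ k * real (2 * k) ^ k * exp 40 ^ k"
  proof -
    have "((2::real) ^ 27) ^ r * (2 ^ 27) ^ r = (2 ^ 108) ^ k"
      unfolding power_mult_distrib[symmetric] r_def power_mult by simp
    moreover have "exp (40 * real k) = exp 40 ^ k" using exp_of_nat_mult[of k "40::real"] by (simp add: mult.commute)
    ultimately show ?thesis by (simp add: r_def)
  qed
  also have "\<dots> \<le> (8 * 2) ^ k * 9 ^ k * (2 ^ 108) ^ k * real (2 * k) ^ k * exp 40 ^ k"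
  proof (intro mult_right_mono)
    have "real k \<le> real (2 ^ k)" by (intro of_nat_mono less_imp_le less_exp)
    then have "real k \<le> 2 ^ k" by simp
    moreover have "(4::real) \<le> 8 ^ k" using k power_increasing[of 1 k "8::real"] by simp
    ultimately have "4 * real k \<le> 8 ^ k * 2 ^ k" by (intro mult_mono) auto
    then show "4 * real k \<le> (8 * 2) ^ k" by (simp only: power_mult_distrib)
  qed auto
  also have "\<dots> = (trace_const * real k) ^ k"
    unfolding trace_const_def of_nat_mult by (simp only: power_mult_distrib[symmetric]) (simp add: mult_ac)
  finally show ?thesis by (simp add: r_def)
qed

text \<open>A deterministic count obtained from the average over an auxiliary random graph.\<close>

lemma card_heavy_walks_le:
  "0 < k \<Longrightarrow> real (card (heavy_walks {1..2 * k} (2 * k))) \<le> (trace_const * real k) ^ k"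
  by (rule order_trans[OF heavy_walks_le_expectation_trace expectation_biased_trace_le])

section \<open>Probability estimates\<close>

lemma prob_Gnp_le:
  fixes \<phi> :: "nat set set \<Rightarrow> real"
  assumes "\<And>E. 0 \<le> \<phi> E" "\<And>E. E \<in> A \<Longrightarrow> 1 \<le> \<phi> E"
  shows "measure_pmf.prob (Gnp n p) A \<le> measure_pmf.expectation (Gnp n p) \<phi>"
proof -
  have "measure_pmf.prob (Gnp n p) A = measure_pmf.expectation (Gnp n p) (indicator A)"
    by simp
  also have "\<dots> \<le> measure_pmf.expectation (Gnp n p) \<phi>"
    using assms by (intro integral_mono integrable_Gnp) (auto simp: indicator_def)
  finally show ?thesis .
qed

lemma power_of_two_between:
  assumes "1 \<le> (d :: real)"
  obtains s :: nat where "d \<le> 2 ^ s" "2 ^ s \<le> 2 * d"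
proof -
  define s where "s = nat \<lceil>log 2 d\<rceil>"
  have l0: "0 \<le> log 2 d" using assms by simp
  have 1: "log 2 d \<le> real s" "real s \<le> log 2 d + 1" unfolding s_def using l0 by linarith+
  have "2 powr (log 2 d) \<le> 2 powr (real s)" using 1 by (intro powr_mono) auto
  moreover have "2 powr (real s) \<le> 2 powr (log 2 d + 1)" using 1 by (intro powr_mono) auto
  ultimately show thesis using assms by (intro that[of s]) (simp_all add: powr_realpow powr_add)
qed

text \<open>Chosen so that \<open>(trace_const * (2 * d)) / R ^ 2 = exp (- 1)\<close> for
  \<open>R = norm_const * sqrt d\<close>: Markov's inequality then gains a factor
  \<open>exp (- 1)\<close> for each unit of \<open>k\<close>.\<close>

definition norm_const :: real where
  "norm_const = sqrt (2 * exp 1 * trace_const)"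

lemma trace_const_pos: "0 < trace_const"
  by (simp add: trace_const_def)

lemma norm_const_pos: "0 < norm_const"
  using trace_const_pos by (simp add: norm_const_def)

text \<open>Any violating \<open>x\<close> forces the trace of the power \<open>2 * k\<close> above
  \<open>R ^ (2 * k)\<close>, so one Markov bound covers all vectors at once, and the even exponent
  covers both signs. The lower bound \<open>d \<le> k\<close> meets the comparison's room condition
  and gives \<open>exp (- d)\<close>; the upper bound \<open>k \<le> 2 * d\<close> keeps the norm at
  order \<open>sqrt d\<close>.\<close>

lemma prob_link_norm:
  assumes p: "0 < p" "p < 1" and K: "K \<subseteq> {1..n}"
    and d: "d = real n * (p * (1 - p) ^ (card K + 1))" "1 \<le> d"
  shows "measure_pmf.prob (Gnp n p)
      {E. \<exists>x. norm_const * sqrt d * (\<Sum>a\<in>{1..n}. (x a)\<^sup>2)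
          < \<bar>\<Sum>a\<in>{1..n}. \<Sum>b\<in>{1..n}. x a * link_matrix n p K E a b * x b\<bar>}
    \<le> real n * exp (- d)"
proof -
  obtain s where s: "d \<le> 2 ^ s" "2 ^ s \<le> 2 * d" using power_of_two_between[OF d(2)] .
  define k :: nat where "k = 2 ^ s"
  have k: "0 < k" "d \<le> real k" "real k \<le> 2 * d" using s by (simp_all add: k_def)
  define R where "R = norm_const * sqrt d"
  define T where "T E = (\<Sum>a\<in>{1..n}. mat_pow {1..n} (link_matrix n p K E) (2 * k) a a)" for E
  have R0: "0 < R" using norm_const_pos d(2) by (simp add: R_def)
  have R2: "R ^ (2 * k) = (2 * exp 1 * trace_const * d) ^ k"
  proof -
    have "R\<^sup>2 = 2 * exp 1 * trace_const * d"
      using trace_const_pos d(2) by (simp add: R_def norm_const_def power_mult_distrib)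
    then show ?thesis by (simp only: power_mult)
  qed
  have T0: "0 \<le> T E" for E
  proof -
    have "T E = (\<Sum>a\<in>{1..n}. \<Sum>b\<in>{1..n}. (mat_pow {1..n} (link_matrix n p K E) k a b)\<^sup>2)"
      unfolding T_def by (rule trace_mat_pow_double[OF finite_atLeastAtMost link_matrix_sym])
    then show ?thesis by (simp add: sum_nonneg)
  qed
  have "measure_pmf.prob (Gnp n p) {E. \<exists>x. R * (\<Sum>a\<in>{1..n}. (x a)\<^sup>2)
          < \<bar>\<Sum>a\<in>{1..n}. \<Sum>b\<in>{1..n}. x a * link_matrix n p K E a b * x b\<bar>}
      \<le> measure_pmf.expectation (Gnp n p) (\<lambda>E. T E / R ^ (2 * k))"
  proof (rule prob_Gnp_le)
    show "0 \<le> T E / R ^ (2 * k)" for E using T0 R0 by simp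
    fix E assume "E \<in> {E. \<exists>x. R * (\<Sum>a\<in>{1..n}. (x a)\<^sup>2)
          < \<bar>\<Sum>a\<in>{1..n}. \<Sum>b\<in>{1..n}. x a * link_matrix n p K E a b * x b\<bar>}"
    then obtain x where x: "R * (\<Sum>a\<in>{1..n}. (x a)\<^sup>2)
          < \<bar>\<Sum>a\<in>{1..n}. \<Sum>b\<in>{1..n}. x a * link_matrix n p K E a b * x b\<bar>" by blast
    define N where "N = (\<Sum>a\<in>{1..n}. (x a)\<^sup>2)"
    define q where "q = (\<Sum>a\<in>{1..n}. \<Sum>b\<in>{1..n}. x a * link_matrix n p K E a b * x b)"
    have N0: "0 \<le> N" by (simp add: N_def sum_nonneg)
    have kk: "2 * k = 2 ^ Suc s" by (simp add: k_def)
    have "q ^ (2 * k) \<le> N ^ (2 * k) * T E"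
      unfolding kk N_def q_def T_def
      by (rule quadratic_form_power_le_trace[OF finite_atLeastAtMost link_matrix_sym])
    moreover have "(R * N) ^ (2 * k) < \<bar>q\<bar> ^ (2 * k)"
      using x R0 N0 k by (intro power_strict_mono) (simp_all add: N_def q_def)
    ultimately have "N ^ (2 * k) * R ^ (2 * k) < N ^ (2 * k) * T E"
      by (simp add: power_even_abs power_mult_distrib mult.commute)
    moreover have "0 \<le> N ^ (2 * k)" using N0 by simp
    ultimately have "R ^ (2 * k) < T E" by (rule mult_left_less_imp_less)
    then show "1 \<le> T E / R ^ (2 * k)" using R0 by simp
  qed
  also have "\<dots> = measure_pmf.expectation (Gnp n p) T / R ^ (2 * k)" by simp
  also have "\<dots> \<le> (real (card (heavy_walks {1..2 * k} (2 * k))) / (p * (1 - p))) / R ^ (2 * k)"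
    unfolding T_def using R0 k d by (intro divide_right_mono expectation_link_trace_le p K) simp_all
  also have "\<dots> \<le> ((trace_const * (2 * d)) ^ k / (p * (1 - p))) / R ^ (2 * k)"
  proof -
    have "real (card (heavy_walks {1..2 * k} (2 * k))) \<le> (trace_const * real k) ^ k"
      by (rule card_heavy_walks_le[OF k(1)])
    also have "\<dots> \<le> (trace_const * (2 * d)) ^ k"
      using trace_const_pos k by (intro power_mono mult_left_mono) auto
    finally show ?thesis using p R0 by (intro divide_right_mono) auto
  qed
  also have "\<dots> = ((trace_const * (2 * d)) / (2 * exp 1 * trace_const * d)) ^ k / (p * (1 - p))"
    unfolding R2 power_divide by simp
  also have "(trace_const * (2 * d)) / (2 * exp 1 * trace_const * d) = exp (- 1)"
    using trace_const_pos d(2) by (simp add: exp_minus field_simps)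
  also have "exp (- 1) ^ k = exp (- real k)" by (simp flip: exp_of_nat_mult)
  also have "exp (- real k) / (p * (1 - p)) \<le> exp (- d) / (p * (1 - p))"
    using k p by (intro divide_right_mono) auto
  \<comment> \<open>The factor \<open>1 / (p * (1 - p))\<close> left by the walk bound is at most
    \<open>n\<close>, since \<open>1 \<le> d \<le> n * (p * (1 - p))\<close>.\<close>
  also have "\<dots> \<le> exp (- d) * real n"
  proof -
    have "p * (1 - p) ^ (card K + 1) \<le> p * (1 - p) ^ 1"
      using p by (intro mult_left_mono power_decreasing) auto
    then have "real n * (p * (1 - p) ^ (card K + 1)) \<le> real n * (p * (1 - p) ^ 1)"
      by (rule mult_left_mono) simp
    then have "d \<le> real n * (p * (1 - p))" by (simp only: d(1) power_one_right)
    then have "1 \<le> real n * (p * (1 - p))" using d(2) by linarith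
    then have "1 / (p * (1 - p)) \<le> real n" using p by (simp add: pos_divide_le_eq)
    then have "exp (- d) * (1 / (p * (1 - p))) \<le> exp (- d) * real n" by (intro mult_left_mono) auto
    then show ?thesis by simp
  qed
  finally show ?thesis by (simp add: R_def mult.commute)
qed

section \<open>Lower tail of the number of common non-neighbours\<close>

lemma expectation_prod_nonnbrs:
  assumes p: "0 \<le> p" "p \<le> 1" and K: "K \<subseteq> {1..n}" and X: "X \<subseteq> {1..n}" "K \<inter> X = {}"
  shows "measure_pmf.expectation (Gnp n p) (\<lambda>E. \<Prod>v\<in>X. of_bool (v \<in> nonnbrs n E K)) = (1 - p) ^ (card K * card X)"
proof -
  have finK: "finite K" using K by (rule finite_subset) simp
  have "measure_pmf.expectation (Gnp n p) (\<lambda>E. \<Prod>v\<in>X. of_bool (v \<in> nonnbrs n E K))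
      = (\<Prod>e\<in>cross_pairs K X. p * of_bool (\<not> True) + (1 - p) * of_bool (\<not> False))"
    unfolding prod_nonnbrs[OF finK X]
    by (rule expectation_Gnp_prod[OF p cross_pairs_subset[OF K X], where h = "\<lambda>e b. of_bool (\<not> b)"])
  then show ?thesis by (simp add: card_cross_pairs[OF X(2)])
qed

text \<open>Chernoff's method with parameter 1. The variable \<open>exp (- count)\<close> is a
  product of factors \<open>1 - t * Z\<close>, \<open>t = 1 - exp (- 1) \<ge> 1/2\<close>; expanding
  it over subsets reduces its mean to products of indicators. Since at least \<open>n / 2\<close>
  vertices lie outside \<open>K\<close>, the mean is at most \<open>exp (- n q / 4)\<close>, where
  \<open>q\<close> is here the power \<open>(1 - p) ^ card K\<close>; the threshold gives back half
  of the exponent.\<close>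

lemma prob_few_nonnbrs:
  assumes p: "0 < p" "p < 1" and K: "K \<subseteq> {1..n}" "2 * card K \<le> n"
  shows "measure_pmf.prob (Gnp n p) {E. real (card (nonnbrs n E K)) < real n * (1 - p) ^ card K / 8}
    \<le> exp (- (real n * (1 - p) ^ card K / 8))"
proof -
  define q where "q = (1 - p) ^ card K"
  define t where "t = 1 - exp (- 1 :: real)"
  define W where "W = {1..n} - K"
  define Z where "Z E v = (of_bool (v \<in> nonnbrs n E K) :: real)" for E v
  have finW: "finite W" by (simp add: W_def)
  have finK: "finite K" using K(1) by (rule finite_subset) simp
  have q: "0 \<le> q" "q \<le> 1" using p by (simp_all add: q_def power_le_one)
  have t: "1/2 \<le> t" "t \<le> 1"
  proof -
    have "2 \<le> exp (1::real)" using exp_ge_add_one_self[of "1::real"] by simp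
    then have "1 / exp (1::real) \<le> 1/2" by (intro divide_left_mono) simp_all
    then have "exp (- 1 :: real) \<le> 1/2" by (simp only: exp_minus inverse_eq_divide)
    then show "1/2 \<le> t" by (simp add: t_def)
  qed (simp add: t_def)
  have exp_eq: "exp (- real (card (nonnbrs n E K))) = (\<Prod>v\<in>W. 1 + (- t) * Z E v)" for E
  proof -
    have "(\<Prod>v\<in>W. 1 + (- t) * Z E v) = (\<Prod>v\<in>W. if v \<in> nonnbrs n E K then exp (- 1) else 1)"
      by (rule prod.cong) (auto simp: Z_def t_def)
    also have "\<dots> = (\<Prod>v\<in>W \<inter> nonnbrs n E K. exp (- 1))"
      by (rule prod.inter_restrict[OF finW, symmetric])
    also have "W \<inter> nonnbrs n E K = nonnbrs n E K" by (auto simp: W_def nonnbrs_def)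
    finally show ?thesis by (simp flip: exp_of_nat_mult)
  qed
  have "measure_pmf.prob (Gnp n p) {E. real (card (nonnbrs n E K)) < real n * q / 8}
      \<le> measure_pmf.expectation (Gnp n p) (\<lambda>E. exp (real n * q / 8) * exp (- real (card (nonnbrs n E K))))"
    by (rule prob_Gnp_le) (auto simp flip: exp_add)
  also have "\<dots> = exp (real n * q / 8) * measure_pmf.expectation (Gnp n p) (\<lambda>E. \<Prod>v\<in>W. 1 + (- t) * Z E v)"
    unfolding exp_eq by simp
  also have "measure_pmf.expectation (Gnp n p) (\<lambda>E. \<Prod>v\<in>W. 1 + (- t) * Z E v)
      = measure_pmf.expectation (Gnp n p) (\<lambda>E. \<Sum>X\<in>Pow W. (\<Prod>v\<in>W - X. (- t) * Z E v))"
    by (subst prod_add[OF finW]) simp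
  also have "\<dots> = (\<Sum>X\<in>Pow W. measure_pmf.expectation (Gnp n p) (\<lambda>E. \<Prod>v\<in>W - X. (- t) * Z E v))"
    by (simp add: integrable_Gnp)
  also have "\<dots> = (\<Sum>X\<in>Pow W. (\<Prod>v\<in>X. 1) * (\<Prod>v\<in>W - X. (- t) * q))"
  proof (rule sum.cong[OF refl])
    fix X assume "X \<in> Pow W"
    have "measure_pmf.expectation (Gnp n p) (\<lambda>E. \<Prod>v\<in>W - X. (- t) * Z E v)
        = (- t) ^ card (W - X) * measure_pmf.expectation (Gnp n p) (\<lambda>E. \<Prod>v\<in>W - X. Z E v)"
      by (simp only: prod.distrib prod_constant integral_mult_right_zero)
    also have "measure_pmf.expectation (Gnp n p) (\<lambda>E. \<Prod>v\<in>W - X. Z E v) = q ^ card (W - X)"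
      unfolding Z_def q_def power_mult[symmetric] using p K(1)
      by (intro expectation_prod_nonnbrs) (auto simp: W_def)
    finally show "measure_pmf.expectation (Gnp n p) (\<lambda>E. \<Prod>v\<in>W - X. (- t) * Z E v)
        = (\<Prod>v\<in>X. 1) * (\<Prod>v\<in>W - X. (- t) * q)"
      by (simp only: prod.distrib prod_constant power_one mult_1)
  qed
  also have "\<dots> = (\<Prod>v\<in>W. 1 + (- t) * q)" by (rule prod_add[OF finW, symmetric])
  also have "\<dots> = (1 - t * q) ^ card W" by simp
  also have "\<dots> \<le> exp (- (t * q)) ^ card W"
  proof (rule power_mono)
    show "1 - t * q \<le> exp (- (t * q))" using exp_ge_add_one_self[of "- (t * q)"] by simp
    have "t * q \<le> 1 * 1" using t q by (intro mult_mono) auto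
    then show "0 \<le> 1 - t * q" by simp
  qed
  also have "\<dots> = exp (- (real (card W) * (t * q)))" by (simp flip: exp_of_nat_mult)
  also have "\<dots> \<le> exp (- (real n / 2 * (1/2 * q)))"
  proof -
    have "card W = n - card K" unfolding W_def using K(1) finK by (simp add: card_Diff_subset)
    then have "real n / 2 \<le> real (card W)" using K(2) by simp
    then have "real n / 2 * (1/2 * q) \<le> real (card W) * (t * q)"
      using t q by (intro mult_mono mult_right_mono) auto
    then show ?thesis by simp
  qed
  finally have "measure_pmf.prob (Gnp n p) {E. real (card (nonnbrs n E K)) < real n * q / 8}
     \<le> exp (real n * q / 8) * exp (- (real n / 2 * (1/2 * q)))" by simp
  also have "\<dots> = exp (- (real n * q / 8))" by (simp flip: exp_add)
  finally show ?thesis by (simp add: q_def)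
qed

section \<open>The complex of independent sets\<close>

text \<open>Cholesky: subtract the rank-one matrix of the pivot \<open>t\<close>. For \<open>Y t t = 0\<close> the row of \<open>t\<close> vanishes
  and, division by zero being zero, nothing is subtracted.\<close>

lemma psd_on_pivot:
  assumes "finite I" "t \<notin> I" and psd: "psd_on (insert t I) Y"
  shows "psd_on I (\<lambda>i j. Y i j - Y t i * Y t j / Y t t)" "0 \<le> Y t t" "i \<in> I \<Longrightarrow> Y t t = 0 \<Longrightarrow> Y t i = 0"
proof -
  have sym: "Y i j = Y j i" if "i \<in> insert t I" "j \<in> insert t I" for i j
    using psd that unfolding psd_on_def by blast
  have form: "(\<Sum>i\<in>insert t I. \<Sum>j\<in>insert t I. v i * Y i j * v j)
      = v t * Y t t * v t + 2 * v t * (\<Sum>i\<in>I. Y t i * v i) + (\<Sum>i\<in>I. \<Sum>j\<in>I. v i * Y i j * v j)" for v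
  proof -
    have "(\<Sum>i\<in>I. v i * Y i t * v t) = v t * (\<Sum>i\<in>I. Y t i * v i)"
      unfolding sum_distrib_left by (intro sum.cong refl) (simp add: sym)
    moreover have "(\<Sum>j\<in>I. v t * Y t j * v j) = v t * (\<Sum>i\<in>I. Y t i * v i)"
      unfolding sum_distrib_left by (intro sum.cong refl) simp
    ultimately show ?thesis
      using assms(1,2) by (simp add: sum.distrib)
  qed
  have nonneg: "0 \<le> v t * Y t t * v t + 2 * v t * (\<Sum>i\<in>I. Y t i * v i) + (\<Sum>i\<in>I. \<Sum>j\<in>I. v i * Y i j * v j)" for v
    using psd unfolding psd_on_def form[symmetric] by blast
  show d: "0 \<le> Y t t"
  proof -
    have "(\<Sum>i\<in>I. Y t i * (if i = t then 1 else 0)) = 0"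
      by (rule sum.neutral) (use assms(2) in auto)
    moreover have "(\<Sum>i\<in>I. \<Sum>j\<in>I. (if i = t then 1 else 0) * Y i j * (if j = t then 1 else 0)) = 0"
      by (intro sum.neutral ballI) (use assms(2) in auto)
    ultimately show ?thesis using nonneg[of "\<lambda>i. if i = t then 1 else 0"] by simp
  qed
  show "Y t i = 0" if i: "i \<in> I" and d0: "Y t t = 0"
  proof (rule ccontr)
    assume nz: "Y t i \<noteq> 0"
    define s where "s = - (Y i i + 1) / (2 * Y t i)"
    define v where "v j = (if j = t then s else if j = i then 1 else 0)" for j
    have it: "i \<noteq> t" using i assms(2) by auto
    have "(\<Sum>j\<in>I. Y t j * v j) = (\<Sum>j\<in>I. if j = i then Y t i else 0)"
      using assms(2) by (intro sum.cong refl) (auto simp: v_def)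
    then have 1: "(\<Sum>j\<in>I. Y t j * v j) = Y t i" using i assms(1) by simp
    have "(\<Sum>a\<in>I. \<Sum>b\<in>I. v a * Y a b * v b) = (\<Sum>a\<in>I. if a = i then (\<Sum>b\<in>I. if b = i then Y i i else 0) else 0)"
    proof (intro sum.cong refl)
      fix a assume a: "a \<in> I"
      show "(\<Sum>b\<in>I. v a * Y a b * v b) = (if a = i then (\<Sum>b\<in>I. if b = i then Y i i else 0) else 0)"
      proof (cases "a = i")
        case True
        have "(\<Sum>b\<in>I. v a * Y a b * v b) = (\<Sum>b\<in>I. if b = i then Y i i else 0)"
          using assms(2) it True by (intro sum.cong refl) (auto simp: v_def)
        then show ?thesis using True by simp
      next
        case False
        then have "v a = 0" using a assms(2) by (auto simp: v_def)
        then show ?thesis using False by simp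
      qed
    qed
    then have 2: "(\<Sum>a\<in>I. \<Sum>b\<in>I. v a * Y a b * v b) = Y i i" using i assms(1) by simp
    have "0 \<le> 2 * s * Y t i + Y i i" using nonneg[of v] unfolding 1 2 by (simp add: v_def d0)
    also have "2 * s * Y t i + Y i i = - 1" using nz by (simp add: s_def field_simps)
    finally show False by simp
  qed
  show "psd_on I (\<lambda>i j. Y i j - Y t i * Y t j / Y t t)"
    unfolding psd_on_def
  proof (intro conjI ballI allI)
    fix i j assume "i \<in> I" "j \<in> I"
    then show "Y i j - Y t i * Y t j / Y t t = Y j i - Y t j * Y t i / Y t t" using sym[of i j] by simp
  next
    fix v :: "'a \<Rightarrow> real"
    define b where "b = (\<Sum>i\<in>I. Y t i * v i)"
    define w where "w i = (if i = t then - b / Y t t else v i)" for i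
    have wv: "w i = v i" if "i \<in> I" for i using that assms(2) by (auto simp: w_def)
    have "0 \<le> w t * Y t t * w t + 2 * w t * b + (\<Sum>i\<in>I. \<Sum>j\<in>I. v i * Y i j * v j)"
      using nonneg[of w] by (simp add: wv b_def cong: sum.cong)
    also have "w t * Y t t * w t + 2 * w t * b = - (b * b / Y t t)"
      by (cases "Y t t = 0") (simp_all add: w_def)
    also have "b * b / Y t t = (\<Sum>i\<in>I. \<Sum>j\<in>I. v i * (Y t i * Y t j / Y t t) * v j)"
      unfolding b_def sum_product sum_divide_distrib by (intro sum.cong refl) simp
    finally show "0 \<le> (\<Sum>i\<in>I. \<Sum>j\<in>I. v i * (Y i j - Y t i * Y t j / Y t t) * v j)"
      by (simp add: algebra_simps sum_subtractf)
  qed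
qed

text \<open>Undoing the pivots one at a time: the pivot row divided by \<open>sqrt (Y t t)\<close>
  is one vector, and the vectors of the reduced matrix are extended by 0 at
  \<open>t\<close>.\<close>

lemma psd_on_gram:
  assumes "finite I" "psd_on I Y"
  shows "\<exists>u. \<forall>i\<in>I. \<forall>j\<in>I. Y i j = (\<Sum>a\<in>I. u a i * u a j)"
  using assms
proof (induction I arbitrary: Y rule: finite_induct)
  case (insert t I)
  note piv = psd_on_pivot[OF insert.hyps insert.prems]
  obtain u where u: "\<And>i j. i \<in> I \<Longrightarrow> j \<in> I \<Longrightarrow> Y i j - Y t i * Y t j / Y t t = (\<Sum>a\<in>I. u a i * u a j)"
    using insert.IH[OF piv(1)] by blast
  have sym: "Y i j = Y j i" if "i \<in> insert t I" "j \<in> insert t I" for i j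
    using insert.prems that unfolding psd_on_def by blast
  define w where "w a i = (if a = t then Y t i / sqrt (Y t t) else if i = t then 0 else u a i)" for a i
  have tI: "a \<noteq> t" if "a \<in> I" for a using that insert.hyps(2) by auto
  have row: "w t i * w t j = Y t i * Y t j / Y t t" for i j
    using piv(2) by (simp add: w_def)
  have "Y i j = (\<Sum>a\<in>insert t I. w a i * w a j)" if ij: "i \<in> insert t I" "j \<in> insert t I" for i j
  proof -
    have S: "(\<Sum>a\<in>insert t I. w a i * w a j) = Y t i * Y t j / Y t t + (\<Sum>a\<in>I. w a i * w a j)"
      using insert.hyps by (simp add: row)
    show ?thesis
    proof (cases "i = t \<or> j = t")
      case True
      have "(\<Sum>a\<in>I. w a i * w a j) = 0" by (rule sum.neutral) (use True tI in \<open>auto simp: w_def\<close>)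
      moreover have "Y t k = Y t t * Y t k / Y t t" if "k \<in> insert t I" for k
        using piv(3)[of k] that by (cases "Y t t = 0") auto
      ultimately show ?thesis unfolding S using True ij sym[of i t] by (auto simp: mult.commute)
    next
      case False
      then have "i \<in> I" "j \<in> I" using ij by auto
      moreover have "(\<Sum>a\<in>I. w a i * w a j) = (\<Sum>a\<in>I. u a i * u a j)"
        by (rule sum.cong) (use False tI in \<open>auto simp: w_def\<close>)
      ultimately show ?thesis unfolding S using u[of i j] by simp
    qed
  qed
  then show ?case by blast
qed simp

text \<open>Weak duality. Writing \<open>Y\<close> as a sum of rank-one matrices turns the trace
  into a sum of values of the form \<open>Q\<close>, to which the bound applies term by
  term.\<close>

lemma trace_mult_psd_le:
  assumes "finite I" "psd_on I Y"
    and Q: "\<And>v. (\<Sum>i\<in>I. \<Sum>j\<in>I. v i * Q i j * v j) \<le> c * (\<Sum>i\<in>I. (v i)\<^sup>2)"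
  shows "trace_mult_on I Q Y \<le> c * trace_on I Y"
proof -
  obtain u where u: "\<And>i j. i \<in> I \<Longrightarrow> j \<in> I \<Longrightarrow> Y i j = (\<Sum>a\<in>I. u a i * u a j)"
    using psd_on_gram[OF assms(1,2)] by blast
  have "trace_mult_on I Q Y = (\<Sum>i\<in>I. \<Sum>j\<in>I. \<Sum>a\<in>I. u a i * Q i j * u a j)"
    unfolding trace_mult_on_def by (intro sum.cong refl) (simp add: u sum_distrib_left mult_ac)
  also have "\<dots> = (\<Sum>i\<in>I. \<Sum>a\<in>I. \<Sum>j\<in>I. u a i * Q i j * u a j)"
    by (intro sum.cong refl sum.swap)
  also have "\<dots> = (\<Sum>a\<in>I. \<Sum>i\<in>I. \<Sum>j\<in>I. u a i * Q i j * u a j)" by (rule sum.swap)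
  also have "\<dots> \<le> (\<Sum>a\<in>I. c * (\<Sum>i\<in>I. (u a i)\<^sup>2))" by (rule sum_mono[OF Q])
  also have "\<dots> = c * (\<Sum>i\<in>I. \<Sum>a\<in>I. (u a i)\<^sup>2)"
    by (subst sum.swap) (simp add: sum_distrib_left)
  also have "(\<Sum>i\<in>I. \<Sum>a\<in>I. (u a i)\<^sup>2) = trace_on I Y"
    unfolding trace_on_def by (intro sum.cong refl) (simp add: u power2_eq_square)
  finally show ?thesis .
qed

section \<open>Localization of face sums to links\<close>

locale independence_complex =
  fixes n :: nat and E :: "nat set set" and l :: nat
  assumes edges: "E \<subseteq> vertex_pairs n" and l_pos: "1 \<le> l"
begin

definition faces :: "nat set set" where "faces = Ind n E (l - 1)"

text \<open>All sets of this size, independent or not, so that the index set does not depend on the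
  graph. A ridge that is not independent has an empty link and adds nothing to the sums.\<close>

definition ridges :: "nat set set" where "ridges = {K. K \<subseteq> {1..n} \<and> card K = l - 1}"

definition link :: "nat set \<Rightarrow> nat set" where "link K = {v \<in> {1..n} - K. insert v K \<in> faces}"

definition sgn_inc :: "nat set \<Rightarrow> nat \<Rightarrow> real" where
  "sgn_inc K v = of_int (incidence (insert v K) K)"

lemma faces_iff: "F \<in> faces \<longleftrightarrow> F \<subseteq> {1..n} \<and> card F = l \<and> (\<forall>e\<in>E. \<not> e \<subseteq> F)"
  using l_pos by (auto simp: faces_def Ind_def independent_def)

lemma faceD:
  assumes "F \<in> faces"
  shows "F \<subseteq> {1..n}" "card F = l" "\<forall>e\<in>E. \<not> e \<subseteq> F"
  using assms by (simp_all add: faces_iff)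

lemma faces_finite: "F \<in> faces \<Longrightarrow> finite F"
  unfolding faces_iff using finite_subset by blast

lemma finite_faces: "finite faces"
proof (rule finite_subset)
  show "faces \<subseteq> Pow {1..n}" using faces_iff by blast
qed simp

lemma finite_ridges: "finite ridges"
proof (rule finite_subset)
  show "ridges \<subseteq> Pow {1..n}" unfolding ridges_def by blast
qed simp

lemma finite_link: "finite (link K)"
  by (simp add: link_def)

lemma linkD:
  assumes "v \<in> link K"
  shows "v \<in> {1..n}" "v \<notin> K" "insert v K \<in> faces"
  using assms by (simp_all add: link_def)

lemma link_subset_nonnbrs: "link K \<subseteq> nonnbrs n E K"
proof
  fix v assume v: "v \<in> link K"
  have "{u, v} \<notin> E" if "u \<in> K" for u
  proof
    assume "{u, v} \<in> E"
    moreover have "{u, v} \<subseteq> insert v K" using that by simp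
    ultimately show False using linkD(3)[OF v] unfolding faces_iff by blast
  qed
  then show "v \<in> nonnbrs n E K" using linkD[OF v] by (simp add: nonnbrs_def)
qed

lemma sgn_inc_square: "sgn_inc K v * sgn_inc K v = 1"
proof -
  have "sgn_inc K v = (- 1) ^ card {y \<in> insert v K. y < the_elem (insert v K - K)}"
    by (simp add: sgn_inc_def incidence_def)
  then show ?thesis by (simp flip: power_mult_distrib)
qed

lemma sgn_inc_mult_power2: "(sgn_inc K v * a)\<^sup>2 = a\<^sup>2"
proof -
  have "(sgn_inc K v)\<^sup>2 = 1" using sgn_inc_square[of K v] by (simp only: power2_eq_square)
  then show ?thesis by (simp only: power_mult_distrib mult_1)
qed

lemma eps_sym: "eps F F' = eps F' F"
  by (auto simp: eps_def Int_commute mult.commute)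

lemma eps_eq_0: "F \<in> faces \<Longrightarrow> F' \<in> faces \<Longrightarrow> F = F' \<or> card (F \<inter> F') \<noteq> l - 1 \<Longrightarrow> eps F F' = 0"
  by (auto simp: eps_def faces_iff)

text \<open>Around a fixed ridge the orientation sign is a product of two vertex signs. The
  substitution \<open>y v = sgn_inc K v * x (insert v K)\<close> therefore removes
  \<open>eps\<close> from the local form without changing the squares.\<close>

lemma eps_link:
  assumes "v \<in> link K" "v' \<in> link K" "v \<noteq> v'"
  shows "eps (insert v K) (insert v' K) = sgn_inc K v * sgn_inc K v'"
proof -
  have int: "insert v K \<inter> insert v' K = K" using assms(3) linkD(2)[OF assms(1)] linkD(2)[OF assms(2)] by blast
  have ne: "insert v K \<noteq> insert v' K" using assms(3) linkD(2)[OF assms(1)] by blast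
  have "finite K" using faces_finite[OF linkD(3)[OF assms(1)]] by simp
  then have "card (insert v K) = Suc (card K)" "card (insert v' K) = Suc (card K)"
    using linkD(2)[OF assms(1)] linkD(2)[OF assms(2)] by simp_all
  then show ?thesis using ne unfolding eps_def int by (simp add: sgn_inc_def)
qed

text \<open>Both halves are independent, so an edge inside the union has to contain \<open>v\<close>
  and \<open>v'\<close>, and it has only two elements.\<close>

lemma union_independent_iff:
  assumes "v \<in> link K" "v' \<in> link K" "v \<noteq> v'"
  shows "independent n E (insert v K \<union> insert v' K) \<longleftrightarrow> {v, v'} \<notin> E"
proof -
  define U where "U = insert v K \<union> insert v' K"
  note f1 = faceD[OF linkD(3)[OF assms(1)]] and f2 = faceD[OF linkD(3)[OF assms(2)]]
  have U: "U \<subseteq> {1..n}" using f1(1) f2(1) unfolding U_def by (rule Un_least)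
  have sub: "{v, v'} \<subseteq> U" by (simp add: U_def)
  have edge: "e = {v, v'}" if e: "e \<in> E" "e \<subseteq> U" for e
  proof -
    have "v \<in> e"
    proof (rule ccontr)
      assume "v \<notin> e"
      with e(2) have "e \<subseteq> insert v' K" unfolding U_def by blast
      then show False using bspec[OF f2(3) e(1)] by contradiction
    qed
    moreover have "v' \<in> e"
    proof (rule ccontr)
      assume "v' \<notin> e"
      with e(2) have "e \<subseteq> insert v K" unfolding U_def by blast
      then show False using bspec[OF f1(3) e(1)] by contradiction
    qed
    ultimately have 1: "{v, v'} \<subseteq> e" by simp
    have c: "card e = 2" using subsetD[OF edges e(1)] by (simp add: vertex_pairs_def)
    have "finite e" by (rule card_ge_0_finite) (simp add: c)
    moreover have "card {v, v'} = card e" using assms(3) c by simp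
    ultimately show ?thesis using card_subset_eq[OF _ 1] by metis
  qed
  have "independent n E U \<longleftrightarrow> (\<forall>e\<in>E. \<not> e \<subseteq> U)" using U by (simp add: independent_def)
  also have "\<dots> \<longleftrightarrow> {v, v'} \<notin> E" using edge sub by metis
  finally show ?thesis by (simp only: U_def)
qed

text \<open>Double counting of pairs of a face and one of its vertices: removing the vertex leaves a
  ridge having it in its link.\<close>

lemma sum_faces:
  fixes \<phi> :: "nat set \<Rightarrow> real"
  shows "real l * (\<Sum>F\<in>faces. \<phi> F) = (\<Sum>K\<in>ridges. \<Sum>v\<in>link K. \<phi> (insert v K))"
proof -
  have "real l * (\<Sum>F\<in>faces. \<phi> F) = (\<Sum>F\<in>faces. \<Sum>v\<in>F. \<phi> F)"
    unfolding sum_distrib_left by (intro sum.cong refl) (simp add: faces_iff)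
  also have "\<dots> = (\<Sum>(F, v)\<in>Sigma faces (\<lambda>F. F). \<phi> F)"
    using finite_faces faces_finite by (intro sum.Sigma) auto
  also have "\<dots> = (\<Sum>(K, v)\<in>Sigma ridges link. \<phi> (insert v K))"
  proof (rule sum.reindex_bij_witness[where i = "\<lambda>(K, v). (insert v K, v)" and j = "\<lambda>(F, v). (F - {v}, v)"])
    fix a assume "a \<in> Sigma faces (\<lambda>F. F)"
    then obtain F v where a: "a = (F, v)" "F \<in> faces" "v \<in> F" by blast
    have ins: "insert v (F - {v}) = F" using a(3) by blast
    show "(case case a of (F, v) \<Rightarrow> (F - {v}, v) of (K, v) \<Rightarrow> (insert v K, v)) = a"
      by (simp add: a(1) insert_absorb[OF a(3)])
    have "F - {v} \<in> ridges" using a(2,3) faces_finite[OF a(2)] by (auto simp: ridges_def faces_iff)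
    moreover have "v \<in> link (F - {v})" using a(2,3) by (auto simp: link_def insert_absorb faces_iff)
    ultimately show "(case a of (F, v) \<Rightarrow> (F - {v}, v)) \<in> Sigma ridges link" by (simp add: a(1))
    show "(case case a of (F, v) \<Rightarrow> (F - {v}, v) of (K, v) \<Rightarrow> \<phi> (insert v K)) = (case a of (F, v) \<Rightarrow> \<phi> F)"
      by (simp add: a(1) insert_absorb[OF a(3)])
  next
    fix b assume "b \<in> Sigma ridges link"
    then obtain K v where b: "b = (K, v)" "K \<in> ridges" "v \<in> link K" by blast
    show "(case case b of (K, v) \<Rightarrow> (insert v K, v) of (F, v) \<Rightarrow> (F - {v}, v)) = b"
      using linkD(2)[OF b(3)] by (simp add: b(1))
    show "(case b of (K, v) \<Rightarrow> (insert v K, v)) \<in> Sigma faces (\<lambda>F. F)"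
      using linkD(3)[OF b(3)] by (simp add: b(1))
  qed
  also have "\<dots> = (\<Sum>K\<in>ridges. \<Sum>v\<in>link K. \<phi> (insert v K))"
    using finite_ridges finite_link by (intro sum.Sigma[symmetric]) auto
  finally show ?thesis .
qed

definition adjacent_faces :: "nat set \<Rightarrow> nat set set" where
  "adjacent_faces F = {F' \<in> faces. F \<noteq> F' \<and> card (F \<inter> F') = l - 1}"

lemma adjacent_faces_split:
  assumes "F \<in> faces" "F' \<in> adjacent_faces F"
  obtains v v' where "v \<noteq> v'" "v \<in> link (F \<inter> F')" "v' \<in> link (F \<inter> F')"
    "F = insert v (F \<inter> F')" "F' = insert v' (F \<inter> F')" "F \<inter> F' \<in> ridges" "F - F' = {v}" "F' - F = {v'}"
proof -
  have F': "F' \<in> faces" "card (F \<inter> F') = l - 1" using assms(2) by (simp_all add: adjacent_faces_def)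
  have fin: "finite F" "finite F'" using assms(1) F'(1) by (simp_all add: faces_finite)
  have "card (F - F') = 1" "card (F' - F) = 1"
    using fin F' assms(1) l_pos by (simp_all add: card_Diff_subset_Int faces_iff Int_commute)
  then obtain v v' where v: "F - F' = {v}" "F' - F = {v'}" by (metis card_1_singletonE)
  have eq: "insert v (F \<inter> F') = F" "insert v' (F \<inter> F') = F'" using v by blast+
  have "F \<inter> F' \<in> ridges" using F' assms(1) by (auto simp: ridges_def faces_iff)
  moreover have "v \<in> {1..n} - (F \<inter> F')" "v' \<in> {1..n} - (F \<inter> F')"
    using v assms(1) F'(1) unfolding faces_iff by blast+
  then have "v \<in> link (F \<inter> F')" "v' \<in> link (F \<inter> F')"
    using assms(1) F'(1) by (simp_all only: link_def mem_Collect_eq eq simp_thms)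
  moreover have "v \<noteq> v'" using v by blast
  ultimately show thesis using eq v by (intro that[of v v']) simp_all
qed

lemma link_adjacent:
  assumes "K \<in> ridges" "v \<in> link K" "v' \<in> link K" "v \<noteq> v'"
  shows "insert v' K \<in> adjacent_faces (insert v K)" "insert v K \<inter> insert v' K = K"
    "insert v K - insert v' K = {v}" "insert v' K - insert v K = {v'}"
proof -
  show int: "insert v K \<inter> insert v' K = K" using assms(4) linkD(2)[OF assms(2)] linkD(2)[OF assms(3)] by blast
  show "insert v K - insert v' K = {v}" "insert v' K - insert v K = {v'}"
    using assms(4) linkD(2)[OF assms(2)] linkD(2)[OF assms(3)] by blast+
  have "insert v K \<noteq> insert v' K" using assms(4) linkD(2)[OF assms(2)] by blast
  then show "insert v' K \<in> adjacent_faces (insert v K)"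
    using linkD(3)[OF assms(3)] assms(1) by (simp add: adjacent_faces_def int ridges_def)
qed

text \<open>Adjacent faces share exactly one ridge, their intersection, so every off-diagonal entry
  belongs to exactly one link. A single face, in contrast, occurs in \<open>l\<close> links, whence
  the factor \<open>l\<close> in \<open>sum_faces\<close>.\<close>

lemma sum_adjacent_faces:
  fixes \<phi> :: "nat set \<Rightarrow> nat set \<Rightarrow> real"
  shows "(\<Sum>F\<in>faces. \<Sum>F'\<in>adjacent_faces F. \<phi> F F')
    = (\<Sum>K\<in>ridges. \<Sum>v\<in>link K. \<Sum>v'\<in>link K - {v}. \<phi> (insert v K) (insert v' K))"
proof -
  let ?A = "Sigma faces adjacent_faces"
  let ?B = "Sigma ridges (\<lambda>K. Sigma (link K) (\<lambda>v. link K - {v}))"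
  let ?j = "\<lambda>(F, F'). (F \<inter> F', the_elem (F - F'), the_elem (F' - F))"
  let ?i = "\<lambda>(K, v, v'). (insert v K, insert v' K)"
  have "(\<Sum>F\<in>faces. \<Sum>F'\<in>adjacent_faces F. \<phi> F F') = (\<Sum>(F, F')\<in>?A. \<phi> F F')"
    using finite_faces by (intro sum.Sigma) (auto simp: adjacent_faces_def)
  also have "\<dots> = (\<Sum>(K, v, v')\<in>?B. \<phi> (insert v K) (insert v' K))"
  proof (rule sum.reindex_bij_witness[where i = ?i and j = ?j])
    fix a assume "a \<in> ?A"
    then obtain F F' where a: "a = (F, F')" "F \<in> faces" "F' \<in> adjacent_faces F" by blast
    obtain v v' where v: "v \<noteq> v'" "v \<in> link (F \<inter> F')" "v' \<in> link (F \<inter> F')"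
      "F = insert v (F \<inter> F')" "F' = insert v' (F \<inter> F')" "F \<inter> F' \<in> ridges" "F - F' = {v}" "F' - F = {v'}"
      using adjacent_faces_split[OF a(2,3)] .
    have j: "?j a = (F \<inter> F', v, v')" by (simp add: a(1) v(7,8))
    show "?i (?j a) = a" unfolding j using v(4,5) by (simp add: a(1))
    show "?j a \<in> ?B" unfolding j using v by simp
    show "(case ?j a of (K, v, v') \<Rightarrow> \<phi> (insert v K) (insert v' K)) = (case a of (F, F') \<Rightarrow> \<phi> F F')"
      unfolding j using v(4,5) by (simp add: a(1))
  next
    fix b assume "b \<in> ?B"
    then obtain K v v' where b: "b = (K, v, v')" "K \<in> ridges" "v \<in> link K" "v' \<in> link K" "v \<noteq> v'" by blast
    note adj = link_adjacent[OF b(2-5)]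
    show "?j (?i b) = b" by (simp add: b(1) adj(2-4) del: insert_Diff_if Int_insert_left Int_insert_right)
    show "?i b \<in> ?A" using adj(1) linkD(3)[OF b(3)] by (simp add: b(1))
  qed
  also have "\<dots> = (\<Sum>K\<in>ridges. \<Sum>(v, v')\<in>Sigma (link K) (\<lambda>v. link K - {v}). \<phi> (insert v K) (insert v' K))"
    using finite_ridges finite_link by (subst sum.Sigma) (auto intro!: finite_SigmaI)
  also have "\<dots> = (\<Sum>K\<in>ridges. \<Sum>v\<in>link K. \<Sum>v'\<in>link K - {v}. \<phi> (insert v K) (insert v' K))"
    using finite_link by (intro sum.cong refl sum.Sigma[symmetric]) auto
  finally show ?thesis .
qed

end

section \<open>Bounds for the semidefinite program\<close>

context independence_complex
begin

lemma independent_insert: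
  assumes "independent n E J" "v \<in> nonnbrs n E J"
  shows "independent n E (insert v J)"
proof -
  have J: "J \<subseteq> {1..n}" "\<forall>e\<in>E. \<not> e \<subseteq> J" using assms(1) by (simp_all add: independent_def)
  have v: "v \<in> {1..n}" "v \<notin> J" "\<forall>u\<in>J. {u, v} \<notin> E" using assms(2) by (simp_all add: nonnbrs_def)
  have "\<not> e \<subseteq> insert v J" if e: "e \<in> E" for e
  proof
    assume sub: "e \<subseteq> insert v J"
    have "card e = 2" using subsetD[OF edges e] by (simp add: vertex_pairs_def)
    then have "\<exists>a b. e = {a, b} \<and> a \<noteq> b" by (simp only: card_2_iff)
    then obtain a b where ab: "e = {a, b}" "a \<noteq> b" by (elim exE conjE)
    have "\<not> e \<subseteq> J" using J(2) e by (rule bspec)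
    then consider "a = v" | "b = v" using sub ab by auto
    then show False
    proof cases
      case 1
      then have "b \<in> J" using sub ab by auto
      then have "{b, v} \<notin> E" using v(3) by simp
      then show False using e ab 1 by (simp add: insert_commute)
    next
      case 2
      then have "a \<in> J" using sub ab by auto
      then have "{a, v} \<notin> E" using v(3) by simp
      then show False using e ab 2 by simp
    qed
  qed
  then show ?thesis using J(1) v(1) by (simp add: independent_def)
qed

lemma independent_subset: "independent n E J \<Longrightarrow> J' \<subseteq> J \<Longrightarrow> independent n E J'"
  unfolding independent_def by (meson order_trans)

text \<open>Greedy construction. The extension hypothesis concerns sets of size exactly
  \<open>l\<close>, so the independent set \<open>J\<close> is first padded to an arbitrary
  \<open>l\<close>-set; a common non-neighbour of the larger set is one of \<open>J\<close> as
  well.\<close>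

lemma faces_nonempty:
  assumes "l \<le> n" and ext: "\<And>F. F \<subseteq> {1..n} \<Longrightarrow> card F = l \<Longrightarrow> nonnbrs n E F \<noteq> {}"
  shows "faces \<noteq> {}"
proof -
  have "\<exists>J. independent n E J \<and> card J = j" if "j \<le> l" for j
    using that
  proof (induction j)
    case 0
    have "\<not> e \<subseteq> {}" if "e \<in> E" for e
      using subsetD[OF edges that] by (auto simp: vertex_pairs_def)
    then have "independent n E {}" by (simp add: independent_def)
    then show ?case by (intro exI[of _ "{}"]) simp
  next
    case (Suc j)
    then obtain J where J: "independent n E J" "card J = j" by auto
    have Jn: "J \<subseteq> {1..n}" using J(1) by (simp add: independent_def)
    have finJ: "finite J" using Jn by (rule finite_subset) simp
    obtain F where F: "J \<subseteq> F" "F \<subseteq> {1..n}" "card F = l"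
      using exists_subset_between[of J l "{1..n}"] Jn J(2) Suc.prems assms(1) by auto
    obtain v where v: "v \<in> nonnbrs n E F" using ext[OF F(2,3)] by blast
    have "v \<in> nonnbrs n E J" using v F(1) by (auto simp: nonnbrs_def)
    then have "independent n E (insert v J)" "v \<notin> J"
      using independent_insert[OF J(1)] by (simp_all add: nonnbrs_def)
    then show ?case using finJ J(2) by (intro exI[of _ "insert v J"]) simp
  qed
  then obtain J where "independent n E J" "card J = l" by blast
  then have "J \<in> faces" by (simp add: faces_iff independent_def)
  then show ?thesis by blast
qed

text \<open>Exchange a fixed vertex \<open>u\<close> of \<open>F\<close> for a common non-neighbour.
  Fixing \<open>u\<close> gives up a factor \<open>l\<close>, which only affects the
  constants.\<close>

lemma card_nonnbrs_le:
  assumes F: "F \<in> faces"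
  shows "card (nonnbrs n E F) \<le> card {F' \<in> adjacent_faces F. independent n E (F \<union> F')}"
proof -
  have finF: "finite F" by (rule faces_finite[OF F])
  have cF: "card F = l" by (rule faceD(2)[OF F])
  then have "F \<noteq> {}" using l_pos by auto
  then obtain u where u: "u \<in> F" by blast
  define K where "K = F - {u}"
  have indF: "independent n E F" using F by (simp add: faces_iff independent_def)
  have KF: "K \<subseteq> F" by (simp add: K_def Diff_subset)
  have cK: "card K = l - 1" using u finF cF by (simp add: K_def)
  have finK: "finite K" using finF by (simp add: K_def)
  show ?thesis
  proof (rule card_inj_on_le)
    show "inj_on (\<lambda>v. insert v K) (nonnbrs n E F)"
    proof (rule inj_onI)
      fix v w assume "v \<in> nonnbrs n E F" "w \<in> nonnbrs n E F" and eq: "insert v K = insert w K"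
      then have "v \<notin> K" "w \<notin> K" using KF by (auto simp: nonnbrs_def)
      then show "v = w" using eq by (metis insertE insertI1)
    qed
    show "(\<lambda>v. insert v K) ` nonnbrs n E F \<subseteq> {F' \<in> adjacent_faces F. independent n E (F \<union> F')}"
    proof (rule image_subsetI)
      fix v assume v: "v \<in> nonnbrs n E F"
      then have vF: "v \<notin> F" by (simp add: nonnbrs_def)
      have vK: "v \<notin> K" using vF KF by blast
      have un: "F \<union> insert v K = insert v F" using KF by blast
      have int: "F \<inter> insert v K = K" using KF vF by blast
      have ind: "independent n E (insert v F)" by (rule independent_insert[OF indF v])
      then have "independent n E (insert v K)" by (rule independent_subset) (use KF in blast)
      moreover have "card (insert v K) = l" using finK vK cK l_pos by simp
      ultimately have "insert v K \<in> faces" by (simp add: faces_iff independent_def)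
      moreover have "F \<noteq> insert v K" using vF by blast
      ultimately have "insert v K \<in> adjacent_faces F"
        using cK by (simp only: adjacent_faces_def mem_Collect_eq int simp_thms)
      then show "insert v K \<in> {F' \<in> adjacent_faces F. independent n E (F \<union> F')}"
        using ind by (simp only: mem_Collect_eq un simp_thms)
    qed
    have "adjacent_faces F \<subseteq> faces" by (simp add: adjacent_faces_def)
    then have "finite (adjacent_faces F)" using finite_faces by (rule finite_subset)
    then show "finite {F' \<in> adjacent_faces F. independent n E (F \<union> F')}" by simp
  qed
qed

lemma sum_face_split:
  assumes F: "F \<in> faces" and 0: "\<And>F'. F' \<in> faces \<Longrightarrow> F' \<noteq> F \<Longrightarrow> F' \<notin> adjacent_faces F \<Longrightarrow> g F' = 0"
  shows "(\<Sum>F'\<in>faces. g F') = g F + (\<Sum>F'\<in>adjacent_faces F. g F' :: real)"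
proof -
  have sub: "insert F (adjacent_faces F) \<subseteq> faces" using F by (auto simp: adjacent_faces_def)
  have "adjacent_faces F \<subseteq> faces" by (simp add: adjacent_faces_def)
  then have fin: "finite (adjacent_faces F)" using finite_faces by (rule finite_subset)
  have "(\<Sum>F'\<in>faces. g F') = (\<Sum>F'\<in>insert F (adjacent_faces F). g F')"
    by (rule sum.mono_neutral_right[OF finite_faces sub]) (use 0 in blast)
  also have "\<dots> = g F + (\<Sum>F'\<in>adjacent_faces F. g F')"
    using fin by (subst sum.insert) (simp_all add: adjacent_faces_def)
  finally show ?thesis .
qed

lemma eps_nonadjacent: "F \<in> faces \<Longrightarrow> F' \<in> faces \<Longrightarrow> F' \<notin> adjacent_faces F \<Longrightarrow> eps F F' = 0"
  by (auto simp: adjacent_faces_def intro: eps_eq_0)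

text \<open>Garland's identity, stated for a free weight \<open>g\<close> so that it serves both
  sides: \<open>g\<close> is the indicator of independence for the primal matrix, and takes the
  values \<open>1\<close> and \<open>1 - 1 / p\<close> for the dual one. A diagonal entry
  \<open>l * c\<close> is shared equally by the \<open>l\<close> links containing the face.\<close>

lemma quadratic_form_faces:
  fixes x :: "nat set \<Rightarrow> real"
  shows "(\<Sum>F\<in>faces. \<Sum>F'\<in>faces. x F * (if F = F' then real l * c else eps F F' * g (independent n E (F \<union> F'))) * x F')
    = (\<Sum>K\<in>ridges. c * (\<Sum>v\<in>link K. (sgn_inc K v * x (insert v K))\<^sup>2)
        + (\<Sum>v\<in>link K. \<Sum>v'\<in>link K - {v}.
            (sgn_inc K v * x (insert v K)) * g ({v, v'} \<notin> E) * (sgn_inc K v' * x (insert v' K))))"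
proof -
  define \<phi> where "\<phi> F F' = x F * (eps F F' * g (independent n E (F \<union> F'))) * x F'" for F F'
  have "(\<Sum>F\<in>faces. \<Sum>F'\<in>faces. x F * (if F = F' then real l * c else eps F F' * g (independent n E (F \<union> F'))) * x F')
    = (\<Sum>F\<in>faces. real l * c * (x F)\<^sup>2 + (\<Sum>F'\<in>adjacent_faces F. \<phi> F F'))"
  proof (rule sum.cong[OF refl])
    fix F assume F: "F \<in> faces"
    let ?g = "\<lambda>F'. x F * (if F = F' then real l * c else eps F F' * g (independent n E (F \<union> F'))) * x F'"
    have "(\<Sum>F'\<in>faces. ?g F') = ?g F + (\<Sum>F'\<in>adjacent_faces F. ?g F')"
      by (rule sum_face_split[OF F]) (simp add: eps_nonadjacent F)
    also have "?g F = real l * c * (x F)\<^sup>2" by (simp add: power2_eq_square)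
    also have "(\<Sum>F'\<in>adjacent_faces F. ?g F') = (\<Sum>F'\<in>adjacent_faces F. \<phi> F F')"
      by (rule sum.cong) (simp_all add: \<phi>_def adjacent_faces_def)
    finally show "(\<Sum>F'\<in>faces. ?g F') = real l * c * (x F)\<^sup>2 + (\<Sum>F'\<in>adjacent_faces F. \<phi> F F')" .
  qed
  also have "\<dots> = real l * (\<Sum>F\<in>faces. c * (x F)\<^sup>2) + (\<Sum>F\<in>faces. \<Sum>F'\<in>adjacent_faces F. \<phi> F F')"
    by (simp add: sum.distrib sum_distrib_left mult.assoc)
  also have "\<dots> = (\<Sum>K\<in>ridges. (\<Sum>v\<in>link K. c * (x (insert v K))\<^sup>2)
      + (\<Sum>v\<in>link K. \<Sum>v'\<in>link K - {v}. \<phi> (insert v K) (insert v' K)))"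
    unfolding sum_faces sum_adjacent_faces sum.distrib by simp
  also have "\<dots> = (\<Sum>K\<in>ridges. c * (\<Sum>v\<in>link K. (sgn_inc K v * x (insert v K))\<^sup>2)
        + (\<Sum>v\<in>link K. \<Sum>v'\<in>link K - {v}.
            (sgn_inc K v * x (insert v K)) * g ({v, v'} \<notin> E) * (sgn_inc K v' * x (insert v' K))))"
  proof (rule sum.cong[OF refl])
    fix K
    have "(\<Sum>v\<in>link K. c * (x (insert v K))\<^sup>2) = c * (\<Sum>v\<in>link K. (sgn_inc K v * x (insert v K))\<^sup>2)"
      by (simp only: sgn_inc_mult_power2 sum_distrib_left)
    moreover have "(\<Sum>v\<in>link K. \<Sum>v'\<in>link K - {v}. \<phi> (insert v K) (insert v' K))
        = (\<Sum>v\<in>link K. \<Sum>v'\<in>link K - {v}.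
            (sgn_inc K v * x (insert v K)) * g ({v, v'} \<notin> E) * (sgn_inc K v' * x (insert v' K)))"
    proof (intro sum.cong refl)
      fix v v' assume "v \<in> link K" "v' \<in> link K - {v}"
      then have vv: "v \<in> link K" "v' \<in> link K" "v \<noteq> v'" by auto
      show "\<phi> (insert v K) (insert v' K)
          = (sgn_inc K v * x (insert v K)) * g ({v, v'} \<notin> E) * (sgn_inc K v' * x (insert v' K))"
        unfolding \<phi>_def eps_link[OF vv] union_independent_iff[OF vv] by simp
    qed
    ultimately show "(\<Sum>v\<in>link K. c * (x (insert v K))\<^sup>2)
          + (\<Sum>v\<in>link K. \<Sum>v'\<in>link K - {v}. \<phi> (insert v K) (insert v' K))
        = c * (\<Sum>v\<in>link K. (sgn_inc K v * x (insert v K))\<^sup>2)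
          + (\<Sum>v\<in>link K. \<Sum>v'\<in>link K - {v}.
            (sgn_inc K v * x (insert v K)) * g ({v, v'} \<notin> E) * (sgn_inc K v' * x (insert v' K)))"
      by simp
  qed
  finally show ?thesis .
qed

lemma sum_ridges_squares:
  "(\<Sum>K\<in>ridges. \<Sum>v\<in>link K. (sgn_inc K v * x (insert v K))\<^sup>2) = real l * (\<Sum>F\<in>faces. (x F)\<^sup>2)"
  unfolding sgn_inc_mult_power2 sum_faces ..

lemma eps_square_adjacent:
  assumes "F \<in> faces" "F' \<in> adjacent_faces F"
  shows "eps F F' * eps F F' = 1"
proof -
  obtain v v' where v: "v \<noteq> v'" "v \<in> link (F \<inter> F')" "v' \<in> link (F \<inter> F')"
    "F = insert v (F \<inter> F')" "F' = insert v' (F \<inter> F')"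
    using adjacent_faces_split[OF assms] by metis
  have "eps F F' = sgn_inc (F \<inter> F') v * sgn_inc (F \<inter> F') v'"
    using eps_link[OF v(2,3,1)] v(4,5) by simp
  then have "(eps F F')\<^sup>2 = (sgn_inc (F \<inter> F') v * (sgn_inc (F \<inter> F') v' * 1))\<^sup>2" by simp
  also have "\<dots> = 1" unfolding sgn_inc_mult_power2 by simp
  finally show ?thesis by (simp only: power2_eq_square)
qed

lemma card_union_faces:
  assumes "F \<in> faces" "F' \<in> faces"
  shows "card (F \<union> F') + card (F \<inter> F') = 2 * l"
  using card_Un_Int[OF faces_finite[OF assms(1)] faces_finite[OF assms(2)]] faceD(2)[OF assms(1)] faceD(2)[OF assms(2)]
  by simp

lemma adjacent_iff_card_union:
  assumes "F \<in> faces" "F' \<in> faces"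
  shows "F' \<in> adjacent_faces F \<longleftrightarrow> card (F \<union> F') = l + 1"
proof -
  have "F = F' \<Longrightarrow> card (F \<union> F') = l" using faceD(2)[OF assms(1)] by simp
  then show ?thesis
    using card_union_faces[OF assms] assms(2) l_pos by (auto simp: adjacent_faces_def)
qed

end

section \<open>Deterministic bounds from a uniform norm bound on the links\<close>

locale quasirandom_complex = independence_complex +
  fixes p R :: real
  assumes p: "0 < p" "p < 1" and R: "0 \<le> R"
    and norm: "\<And>K x. K \<in> ridges \<Longrightarrow>
      \<bar>\<Sum>a\<in>{1..n}. \<Sum>b\<in>{1..n}. x a * link_matrix n p K E a b * x b\<bar> \<le> R * (\<Sum>a\<in>{1..n}. (x a)\<^sup>2)"
    and nonempty: "faces \<noteq> {}"
begin

text \<open>The link lies among the common non-neighbours of \<open>K\<close>, so a vector on it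
  extends by zero and the form is that of a principal submatrix.\<close>

lemma link_form_le:
  assumes K: "K \<in> ridges"
  shows "\<bar>\<Sum>v\<in>link K. \<Sum>v'\<in>link K - {v}. y v * (of_bool ({v, v'} \<in> E) - p) * y v'\<bar> \<le> R * (\<Sum>v\<in>link K. (y v)\<^sup>2)"
proof -
  define x where "x a = (if a \<in> link K then y a else 0)" for a
  have sub: "link K \<subseteq> {1..n}" by (auto dest: linkD)
  have 1: "(\<Sum>b\<in>{1..n}. x a * link_matrix n p K E a b * x b)
      = (\<Sum>b\<in>link K - {a}. y a * (of_bool ({a, b} \<in> E) - p) * y b)" if a: "a \<in> link K" for a
  proof (rule sum.mono_neutral_cong_right)
    show "link K - {a} \<subseteq> {1..n}" using sub by blast
    show "\<forall>b\<in>{1..n} - (link K - {a}). x a * link_matrix n p K E a b * x b = 0"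
      by (auto simp: x_def link_matrix_def)
    fix b assume b: "b \<in> link K - {a}"
    then have "a \<in> nonnbrs n E K" "b \<in> nonnbrs n E K" using a link_subset_nonnbrs by blast+
    then show "x a * link_matrix n p K E a b * x b = y a * (of_bool ({a, b} \<in> E) - p) * y b"
      using a b by (simp add: x_def link_matrix_def)
  qed simp
  have "(\<Sum>a\<in>{1..n}. \<Sum>b\<in>{1..n}. x a * link_matrix n p K E a b * x b)
      = (\<Sum>v\<in>link K. \<Sum>v'\<in>link K - {v}. y v * (of_bool ({v, v'} \<in> E) - p) * y v')"
    by (rule sum.mono_neutral_cong_right) (use sub 1 in \<open>simp_all add: x_def\<close>)
  moreover have "(\<Sum>a\<in>{1..n}. (x a)\<^sup>2) = (\<Sum>v\<in>link K. (y v)\<^sup>2)"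
    by (rule sum.mono_neutral_cong_right) (use sub in \<open>simp_all add: x_def\<close>)
  ultimately show ?thesis using norm[OF K, of x] by simp
qed

text \<open>Feasible \<open>Y\<close> vanish where the union of adjacent faces is not independent,
  so the objective matrix may be changed there at will. The change turns each local form into the
  identity minus \<open>1 / p\<close> times the centered adjacency form.\<close>

lemma objective_le:
  assumes Y: "theta_feasible n E l Y"
  shows "trace_mult_on faces (down_laplacian l) Y \<le> real l * (1 + R / p)"
proof -
  \<comment> \<open>The value \<open>1 - 1 / p\<close> on edges makes \<open>g\<close> a multiple of
    the centered indicator: on edges and non-edges alike it equals \<open>- (1 / p)\<close> times
    (indicator of the edge minus \<open>p\<close>).\<close>
  define g where "g b = (if b then 1 else 1 - 1 / p)" for b
  define Q where "Q F F' = (if F = F' then real l * 1 else eps F F' * g (independent n E (F \<union> F')))" for F F'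
  have psd: "psd_on faces Y" and tr: "trace_on faces Y = 1"
    and zero: "\<And>F F'. F \<in> faces \<Longrightarrow> F' \<in> faces \<Longrightarrow> card (F \<union> F') = l + 1 \<Longrightarrow> \<not> independent n E (F \<union> F') \<Longrightarrow> Y F F' = 0"
    using Y unfolding theta_feasible_def faces_def[symmetric] by blast+
  have "trace_mult_on faces (down_laplacian l) Y = trace_mult_on faces Q Y"
    unfolding trace_mult_on_def
  proof (intro sum.cong refl)
    fix F F' assume F: "F \<in> faces" "F' \<in> faces"
    show "down_laplacian l F F' * Y F' F = Q F F' * Y F' F"
    proof (cases "F = F' \<or> independent n E (F \<union> F')")
      case True
      then show ?thesis by (auto simp: down_laplacian_def Q_def g_def)
    next
      case False
      show ?thesis
      proof (cases "F' \<in> adjacent_faces F")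
        case True
        then have "Y F' F = 0" using zero[OF F(2,1)] False adjacent_iff_card_union[OF F] by (simp add: Un_commute)
        then show ?thesis by simp
      next
        case nonadj: False
        then show ?thesis using eps_nonadjacent[OF F nonadj] False by (simp add: down_laplacian_def Q_def)
      qed
    qed
  qed
  also have "\<dots> \<le> real l * (1 + R / p) * trace_on faces Y"
  proof (rule trace_mult_psd_le[OF finite_faces psd])
    fix x :: "nat set \<Rightarrow> real"
    let ?y = "\<lambda>K v. sgn_inc K v * x (insert v K)"
    have "(\<Sum>F\<in>faces. \<Sum>F'\<in>faces. x F * Q F F' * x F')
      = (\<Sum>K\<in>ridges. 1 * (\<Sum>v\<in>link K. (?y K v)\<^sup>2) + (\<Sum>v\<in>link K. \<Sum>v'\<in>link K - {v}. ?y K v * g ({v, v'} \<notin> E) * ?y K v'))"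
      unfolding Q_def by (rule quadratic_form_faces)
    also have "\<dots> \<le> (\<Sum>K\<in>ridges. (1 + R / p) * (\<Sum>v\<in>link K. (?y K v)\<^sup>2))"
    proof (rule sum_mono)
      fix K assume K: "K \<in> ridges"
      define S where "S = (\<Sum>v\<in>link K. \<Sum>v'\<in>link K - {v}. ?y K v * (of_bool ({v, v'} \<in> E) - p) * ?y K v')"
      define Z where "Z = (\<Sum>v\<in>link K. (?y K v)\<^sup>2)"
      have "(\<Sum>v\<in>link K. \<Sum>v'\<in>link K - {v}. ?y K v * g ({v, v'} \<notin> E) * ?y K v') = - (1 / p) * S"
        unfolding S_def sum_distrib_left using p by (intro sum.cong refl) (simp add: g_def field_simps)
      moreover have "- S \<le> R * Z" using link_form_le[OF K, of "?y K"] unfolding S_def Z_def by linarith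
      then have "- (1 / p) * S \<le> R * Z / p" using p by (simp add: field_simps)
      ultimately show "1 * (\<Sum>v\<in>link K. (?y K v)\<^sup>2) + (\<Sum>v\<in>link K. \<Sum>v'\<in>link K - {v}. ?y K v * g ({v, v'} \<notin> E) * ?y K v')
          \<le> (1 + R / p) * (\<Sum>v\<in>link K. (?y K v)\<^sup>2)"
        unfolding Z_def[symmetric] by (simp add: algebra_simps)
    qed
    also have "\<dots> = (1 + R / p) * (real l * (\<Sum>F\<in>faces. (x F)\<^sup>2))"
      by (simp only: sum_distrib_left[symmetric] sum_ridges_squares)
    finally show "(\<Sum>F\<in>faces. \<Sum>F'\<in>faces. x F * Q F F' * x F') \<le> real l * (1 + R / p) * (\<Sum>F\<in>faces. (x F)\<^sup>2)"
      by (simp add: mult_ac)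
  qed
  finally show ?thesis using tr by simp
qed

text \<open>Locally the off-diagonal part is \<open>1 - p\<close> times the all-ones form minus the
  centered form. Without its diagonal the all-ones form is at least minus the squared norm, and the
  centered form is at most \<open>R\<close> times it. So \<open>(1 - p) + R\<close> per link
  suffices for positivity, and each face lies in \<open>l\<close> links.\<close>

definition witness_diag :: real where "witness_diag = real l * ((1 - p) + R)"

definition witness :: "nat set \<Rightarrow> nat set \<Rightarrow> real" where
  "witness F F' = (if F = F' then witness_diag else eps F F' * of_bool (independent n E (F \<union> F')))
     / (witness_diag * real (card faces))"

lemma witness_diag_pos: "0 < witness_diag"
  using p R l_pos by (simp add: witness_diag_def)

lemma card_faces_pos: "0 < card faces"
  using nonempty finite_faces by (simp add: card_gt_0_iff)

lemma witness_psd: "psd_on faces witness"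
  unfolding psd_on_def
proof (intro conjI ballI allI)
  fix F F'
  show "witness F F' = witness F' F" by (simp add: witness_def eps_sym[of F F'] Un_commute)
next
  fix x :: "nat set \<Rightarrow> real"
  define g where "g b = (of_bool b :: real)" for b
  let ?y = "\<lambda>K v. sgn_inc K v * x (insert v K)"
  let ?M = "\<lambda>F F'. if F = F' then real l * ((1 - p) + R) else eps F F' * g (independent n E (F \<union> F'))"
  have "0 \<le> (\<Sum>K\<in>ridges. ((1 - p) + R) * (\<Sum>v\<in>link K. (?y K v)\<^sup>2)
      + (\<Sum>v\<in>link K. \<Sum>v'\<in>link K - {v}. ?y K v * g ({v, v'} \<notin> E) * ?y K v'))"
  proof (rule sum_nonneg)
    fix K assume K: "K \<in> ridges"
    define S where "S = (\<Sum>v\<in>link K. \<Sum>v'\<in>link K - {v}. ?y K v * (of_bool ({v, v'} \<in> E) - p) * ?y K v')"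
    define Z where "Z = (\<Sum>v\<in>link K. (?y K v)\<^sup>2)"
    define D where "D = (\<Sum>v\<in>link K. \<Sum>v'\<in>link K - {v}. ?y K v * ?y K v')"
    have "D = (\<Sum>v\<in>link K. (\<Sum>v'\<in>link K. ?y K v * ?y K v') - (?y K v)\<^sup>2)"
      unfolding D_def
      by (intro sum.cong refl) (simp add: sum_diff1 finite_link power2_eq_square)
    also have "\<dots> = (\<Sum>v\<in>link K. ?y K v)\<^sup>2 - Z"
      by (simp add: sum_subtractf Z_def power2_eq_square sum_product)
    finally have "- Z \<le> D" by simp
    then have "(1 - p) * (- Z) \<le> (1 - p) * D" using p by (intro mult_left_mono) auto
    moreover have "S \<le> R * Z" using link_form_le[OF K, of "?y K"] unfolding S_def Z_def by linarith
    \<comment> \<open>The indicator of a non-edge is \<open>(1 - p)\<close> minus the centered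
      indicator of the edge.\<close>
    moreover have "(\<Sum>v\<in>link K. \<Sum>v'\<in>link K - {v}. ?y K v * g ({v, v'} \<notin> E) * ?y K v') = (1 - p) * D - S"
      unfolding S_def D_def sum_distrib_left sum_subtractf[symmetric]
      by (intro sum.cong refl) (simp add: g_def algebra_simps)
    ultimately show "0 \<le> ((1 - p) + R) * (\<Sum>v\<in>link K. (?y K v)\<^sup>2)
        + (\<Sum>v\<in>link K. \<Sum>v'\<in>link K - {v}. ?y K v * g ({v, v'} \<notin> E) * ?y K v')"
      unfolding Z_def[symmetric] by (simp add: algebra_simps)
  qed
  also have "\<dots> = (\<Sum>F\<in>faces. \<Sum>F'\<in>faces. x F * ?M F F' * x F')"
    by (rule quadratic_form_faces[symmetric])
  finally have "0 \<le> (\<Sum>F\<in>faces. \<Sum>F'\<in>faces. x F * ?M F F' * x F')" .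
  then have "0 \<le> (\<Sum>F\<in>faces. \<Sum>F'\<in>faces. x F * ?M F F' * x F') / (witness_diag * real (card faces))"
    using witness_diag_pos by (intro divide_nonneg_nonneg) auto
  also have "\<dots> = (\<Sum>F\<in>faces. \<Sum>F'\<in>faces. x F * witness F F' * x F')"
    unfolding sum_divide_distrib by (intro sum.cong refl) (simp add: witness_def witness_diag_def g_def)
  finally show "0 \<le> (\<Sum>F\<in>faces. \<Sum>F'\<in>faces. x F * witness F F' * x F')" .
qed

text \<open>The sign constraint holds because \<open>eps * eps = 1\<close> on adjacent faces:
  \<open>eps F F' * witness F F'\<close> is then a function of the union alone.\<close>

lemma witness_feasible: "theta_feasible n E l witness"
proof -
  have "trace_on faces witness = 1"
    using witness_diag_pos card_faces_pos by (simp add: trace_on_def witness_def)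
  moreover have dep: "witness F F' = 0"
    if F: "F \<in> faces" "F' \<in> faces" and "card (F \<union> F') = l + 1" "\<not> independent n E (F \<union> F')" for F F'
  proof -
    have "F \<noteq> F'" using that faceD(2)[OF F(1)] by auto
    then show ?thesis using that(4) by (simp add: witness_def)
  qed
  moreover have far: "witness F F' = 0" if F: "F \<in> faces" "F' \<in> faces" and "l + 2 \<le> card (F \<union> F')" for F F'
  proof -
    have "F \<noteq> F'" using that faceD(2)[OF F(1)] by auto
    moreover have "eps F F' = 0" using adjacent_iff_card_union[OF F] that(3) by (intro eps_nonadjacent F) simp
    ultimately show ?thesis by (simp add: witness_def)
  qed
  moreover have const: "eps F F' * witness F F' = of_bool (independent n E (F \<union> F')) / (witness_diag * real (card faces))"
    if F: "F \<in> faces" "F' \<in> faces" and c: "card (F \<union> F') = l + 1" for F F'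
  proof -
    have "F \<noteq> F'" using that faceD(2)[OF F(1)] by auto
    moreover have "F' \<in> adjacent_faces F" using adjacent_iff_card_union[OF F] c by simp
    then have "eps F F' * eps F F' = 1" by (rule eps_square_adjacent[OF F(1)])
    ultimately show ?thesis by (simp add: witness_def mult.assoc[symmetric])
  qed
  ultimately show ?thesis
    unfolding theta_feasible_def faces_def[symmetric]
  proof (intro conjI ballI impI)
    fix F F' H H' assume F: "F \<in> faces" "F' \<in> faces" and H: "H \<in> faces" "H' \<in> faces"
      and u: "F \<union> F' = H \<union> H' \<and> card (F \<union> F') = l + 1"
    note u1 = u[THEN conjunct1] and u2 = u[THEN conjunct2]
    show "eps F F' * witness F F' = eps H H' * witness H H'"
      unfolding const[OF F u2] const[OF H u2[unfolded u1]] u1 ..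
  qed (use witness_psd in auto)
qed

text \<open>Signs cancel, so each ordered adjacent pair with independent union contributes
  \<open>1 / T\<close>, and every face has at least \<open>m\<close> such partners. The nonnegative
  diagonal is dropped, and the number of faces cancels against the normalization in
  \<open>T\<close>.\<close>

lemma objective_witness_ge:
  assumes m: "\<And>F. F \<in> faces \<Longrightarrow> m \<le> real (card (nonnbrs n E F))"
  shows "m / witness_diag \<le> trace_mult_on faces (down_laplacian l) witness"
proof -
  define T where "T = witness_diag * real (card faces)"
  have T0: "0 < T" using witness_diag_pos card_faces_pos by (simp add: T_def)
  have "m / T \<le> (\<Sum>F'\<in>faces. down_laplacian l F F' * witness F' F)" if F: "F \<in> faces" for F
  proof -
    have "adjacent_faces F \<subseteq> faces" by (simp add: adjacent_faces_def)
    then have fin: "finite (adjacent_faces F)" using finite_faces by (rule finite_subset)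
    have split: "(\<Sum>F'\<in>faces. down_laplacian l F F' * witness F' F)
        = down_laplacian l F F * witness F F + (\<Sum>F'\<in>adjacent_faces F. down_laplacian l F F' * witness F' F)"
      by (rule sum_face_split[OF F]) (simp add: down_laplacian_def eps_nonadjacent F)
    have diag: "0 \<le> down_laplacian l F F * witness F F"
      using witness_diag_pos by (simp add: down_laplacian_def witness_def)
    have "(\<Sum>F'\<in>adjacent_faces F. down_laplacian l F F' * witness F' F)
        = (\<Sum>F'\<in>adjacent_faces F. of_bool (independent n E (F \<union> F')) / T)"
    proof (rule sum.cong[OF refl])
      fix F' assume F': "F' \<in> adjacent_faces F"
      then have ne: "F \<noteq> F'" by (simp add: adjacent_faces_def)
      then have "down_laplacian l F F' = eps F F'" by (simp add: down_laplacian_def)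
      moreover have "witness F' F = eps F F' * of_bool (independent n E (F \<union> F')) / T"
        using ne by (auto simp: witness_def T_def eps_sym[of F' F] Un_commute[of F' F])
      ultimately have "down_laplacian l F F' * witness F' F
          = eps F F' * eps F F' * of_bool (independent n E (F \<union> F')) / T" by simp
      then show "down_laplacian l F F' * witness F' F = of_bool (independent n E (F \<union> F')) / T"
        unfolding eps_square_adjacent[OF F F'] by simp
    qed
    also have "\<dots> = (\<Sum>F'\<in>adjacent_faces F. of_bool (independent n E (F \<union> F'))) / T"
      by (rule sum_divide_distrib[symmetric])
    also have "(\<Sum>F'\<in>adjacent_faces F. of_bool (independent n E (F \<union> F')))
        = real (card (adjacent_faces F \<inter> {F'. independent n E (F \<union> F')}))"
      using fin by simp
    also have "adjacent_faces F \<inter> {F'. independent n E (F \<union> F')}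
        = {F' \<in> adjacent_faces F. independent n E (F \<union> F')}" by blast
    finally have off: "(\<Sum>F'\<in>adjacent_faces F. down_laplacian l F F' * witness F' F)
        = real (card {F' \<in> adjacent_faces F. independent n E (F \<union> F')}) / T" .
    have "real (card (nonnbrs n E F)) \<le> real (card {F' \<in> adjacent_faces F. independent n E (F \<union> F')})"
      by (rule of_nat_mono[OF card_nonnbrs_le[OF F]])
    then have "m / T \<le> real (card {F' \<in> adjacent_faces F. independent n E (F \<union> F')}) / T"
      using m[OF F] T0 by (intro divide_right_mono) linarith+
    then show ?thesis unfolding split off using diag by linarith
  qed
  then have "(\<Sum>F\<in>faces. m / T) \<le> trace_mult_on faces (down_laplacian l) witness"
    unfolding trace_mult_on_def by (rule sum_mono)
  then show ?thesis using card_faces_pos by (simp add: T_def)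
qed

lemma vartheta_bounds:
  assumes m: "\<And>F. F \<in> faces \<Longrightarrow> m \<le> real (card (nonnbrs n E F))"
  shows "m / (real l * ((1 - p) + R)) \<le> vartheta l n E" "vartheta l n E \<le> real l * (1 + R / p)"
proof -
  let ?f = "trace_mult_on faces (down_laplacian l)"
  have v: "vartheta l n E = (SUP Y \<in> {Y. theta_feasible n E l Y}. ?f Y)"
    by (simp add: vartheta_def faces_def)
  have bdd: "bdd_above (?f ` {Y. theta_feasible n E l Y})"
    by (rule bdd_aboveI2[of _ _ "real l * (1 + R / p)"]) (use objective_le in simp)
  have "m / witness_diag \<le> ?f witness" by (rule objective_witness_ge[OF m])
  also have "\<dots> \<le> vartheta l n E"
    unfolding v by (rule cSUP_upper[OF _ bdd]) (simp add: witness_feasible)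
  finally show "m / (real l * ((1 - p) + R)) \<le> vartheta l n E" by (simp add: witness_diag_def)
  show "vartheta l n E \<le> real l * (1 + R / p)"
    unfolding v using witness_feasible by (intro cSUP_least) (auto intro: objective_le)
qed

end

section \<open>The random graph\<close>

text \<open>With \<open>sqrt d = p * s\<close> and \<open>n * q ^ l = p * s ^ 2\<close> both bounds
  become multiples of \<open>s\<close>. The \<open>1\<close> in \<open>1 + C * s\<close> is absorbed
  by \<open>s \<ge> 1\<close>, and the \<open>q\<close> in \<open>q + C * sqrt d\<close> by
  \<open>q \<le> sqrt d\<close>.\<close>

lemma vartheta_bounds_of_quasirandom:
  assumes E: "E \<subseteq> vertex_pairs n" and l: "1 \<le> l" "l \<le> n" and p: "0 < p" "p < 1"
    and large: "1 \<le> real n * (1 - p) ^ l" "1 \<le> real n * (p * (1 - p) ^ (l - 1))"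
    and C: "0 < C"
    and norm: "\<And>K x. K \<subseteq> {1..n} \<Longrightarrow> card K = l - 1 \<Longrightarrow>
      \<bar>\<Sum>a\<in>{1..n}. \<Sum>b\<in>{1..n}. x a * link_matrix n p K E a b * x b\<bar>
        \<le> C * sqrt (real n * (p * (1 - p) ^ l)) * (\<Sum>a\<in>{1..n}. (x a)\<^sup>2)"
    and ext: "\<And>F. F \<subseteq> {1..n} \<Longrightarrow> card F = l \<Longrightarrow> real n * (1 - p) ^ l / 8 \<le> real (card (nonnbrs n E F))"
  shows "Ind n E (l - 1) \<noteq> {}"
    "1 / (8 * real l * (1 + C)) * sqrt (real n * (1 - p) ^ l / p) \<le> vartheta l n E"
    "vartheta l n E \<le> real l * (1 + C) * sqrt (real n * (1 - p) ^ l / p)"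
proof -
  define q where "q = 1 - p"
  define d where "d = real n * (p * q ^ l)"
  define s where "s = sqrt (real n * q ^ l / p)"
  define R where "R = C * sqrt d"
  have q: "0 < q" "q < 1" using p by (simp_all add: q_def)
  have nq: "1 \<le> real n * q ^ l" "1 \<le> real n * (p * q ^ (l - 1))" using large by (simp_all add: q_def)
  have ql: "q * q ^ (l - 1) = q ^ l" using l(1) by (simp flip: power_Suc)
  have d0: "0 < d" using nq(1) p by (simp add: d_def mult.left_commute[of "real n"])
  interpret ic: independence_complex n E l by unfold_locales (use E l in auto)
  have ne: "ic.faces \<noteq> {}"
  proof (rule ic.faces_nonempty[OF l(2)])
    fix F assume "F \<subseteq> {1..n}" "card F = l"
    then have "real n * q ^ l / 8 \<le> real (card (nonnbrs n E F))" using ext by (simp add: q_def)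
    then have "card (nonnbrs n E F) \<noteq> 0" using nq(1) by (intro notI) simp
    then show "nonnbrs n E F \<noteq> {}" by (intro notI) simp
  qed
  then show "Ind n E (l - 1) \<noteq> {}" by (simp only: ic.faces_def not_False_eq_True)
  interpret qc: quasirandom_complex n E l p R
  proof unfold_locales
    show "0 \<le> R" using C d0 by (simp add: R_def)
    show "\<bar>\<Sum>a\<in>{1..n}. \<Sum>b\<in>{1..n}. x a * link_matrix n p K E a b * x b\<bar> \<le> R * (\<Sum>a\<in>{1..n}. (x a)\<^sup>2)"
      if "K \<in> ic.ridges" for K x
      using norm[of K x] that by (simp add: ic.ridges_def R_def d_def q_def)
  qed (use p ne in auto)
  have sd: "sqrt d = p * s"
  proof -
    have "d = p\<^sup>2 * (real n * q ^ l / p)" using p by (simp add: d_def power2_eq_square)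
    then have "sqrt d = sqrt (p\<^sup>2) * s" unfolding s_def by (simp only: real_sqrt_mult)
    then show ?thesis using p by simp
  qed
  have s2: "s * s * p = real n * q ^ l"
    using p q by (simp add: s_def)
  have s1: "1 \<le> s"
  proof -
    have "p \<le> real n * q ^ l" using nq(1) p by linarith
    then have "1 \<le> real n * q ^ l / p" using p by simp
    then show ?thesis by (simp add: s_def)
  qed
  \<comment> \<open>The second size hypothesis enters here: multiplying
    \<open>1 \<le> n * p * q ^ (l - 1)\<close> by \<open>q ^ 2\<close> and using
    \<open>q * q ^ (l - 1) = q ^ l\<close> with \<open>q \<le> 1\<close> leaves
    \<open>q ^ 2 \<le> d\<close>.\<close>
  have q_le: "q \<le> sqrt d"
  proof (rule real_le_rsqrt)
    have "q * q \<le> q * (real n * (p * q ^ (l - 1)))" using nq(2) q by (intro mult_left_mono) linarith+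
    also have "\<dots> = real n * (p * (q * q ^ (l - 1)))" by (simp add: mult_ac)
    finally show "q\<^sup>2 \<le> d" unfolding ql d_def by (simp add: power2_eq_square)
  qed
  \<comment> \<open>The parameter \<open>m\<close> of \<open>vartheta_bounds\<close> concerns the
    lower bound; 0 meets its condition trivially.\<close>
  have "vartheta l n E \<le> real l * (1 + R / p)"
    by (rule qc.vartheta_bounds(2)[of 0]) simp
  also have "\<dots> = real l * (1 + C * s)" using p by (simp add: R_def sd)
  also have "\<dots> \<le> real l * ((1 + C) * s)"
    using s1 by (intro mult_left_mono) (simp_all add: algebra_simps)
  finally show "vartheta l n E \<le> real l * (1 + C) * sqrt (real n * (1 - p) ^ l / p)"
    by (simp add: s_def q_def mult.assoc)
  have "1 / (8 * real l * (1 + C)) * s = (real n * q ^ l / 8) / (real l * ((1 + C) * (p * s)))"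
  proof -
    have "s \<noteq> 0" "p \<noteq> 0" using s1 p by auto
    then have "s * s * p / 8 / (real l * ((1 + C) * (p * s))) = s / (8 * (real l * (1 + C)))"
      by simp
    then show ?thesis unfolding s2[symmetric] by simp
  qed
  also have "\<dots> \<le> (real n * q ^ l / 8) / (real l * (q + R))"
  proof (rule divide_left_mono)
    have "q + R \<le> (1 + C) * (p * s)" using q_le unfolding R_def sd by (simp add: algebra_simps)
    then show "real l * (q + R) \<le> real l * ((1 + C) * (p * s))" by (intro mult_left_mono) auto
    show "0 \<le> real n * q ^ l / 8" using nq(1) by simp
    have x: "0 < q + R" using q qc.R by linarith
    have y: "0 < (1 + C) * (p * s)" using C p s1 by (intro mult_pos_pos) linarith+
    have z: "0 < real l" using l(1) by simp
    show "0 < real l * ((1 + C) * (p * s)) * (real l * (q + R))"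
      by (rule mult_pos_pos[OF mult_pos_pos[OF z y] mult_pos_pos[OF z x]])
  qed
  also have "\<dots> \<le> vartheta l n E"
    unfolding q_def
  proof (rule qc.vartheta_bounds(1))
    fix F assume F: "F \<in> ic.faces"
    show "real n * (1 - p) ^ l / 8 \<le> real (card (nonnbrs n E F))"
      by (rule ext[OF ic.faceD(1)[OF F] ic.faceD(2)[OF F]])
  qed
  finally show "1 / (8 * real l * (1 + C)) * sqrt (real n * (1 - p) ^ l / p) \<le> vartheta l n E"
    by (simp add: s_def q_def)
qed

lemma card_subsets_le:
  assumes "k \<le> n"
  shows "finite {K. K \<subseteq> {1..n} \<and> card K = k}" "real (card {K. K \<subseteq> {1..n} \<and> card K = k}) \<le> real n ^ k"
proof -
  show "finite {K. K \<subseteq> {1..n} \<and> card K = k}" by simp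
  have "card {K. K \<subseteq> {1..n} \<and> card K = k} = n choose k" by (simp add: n_subsets)
  also have "\<dots> \<le> n ^ k" using assms by (rule binomial_le_pow)
  finally show "real (card {K. K \<subseteq> {1..n} \<and> card K = k}) \<le> real n ^ k"
    by (metis of_nat_le_iff of_nat_power)
qed

text \<open>Union bound over at most \<open>n ^ (l - 1)\<close> ridges, each failing with
  probability at most \<open>n * \<delta>\<close>, and at most \<open>n ^ l\<close> sets of size
  \<open>l\<close>, each failing with probability at most \<open>\<delta>\<close>. The 8 in
  \<open>c0\<close> cancels the 8 in the tail exponent, so
  \<open>\<delta> = n powr - (l + 2 + c)\<close>; the total \<open>2 * n ^ l * \<delta>\<close> is
  then below \<open>n powr (- c)\<close>.\<close>

lemma vartheta_Gnp_bounds: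
  fixes l n :: nat and c c0 p :: real
  assumes l: "1 \<le> l" and c: "0 < c" and n: "2 \<le> n" and p: "0 \<le> p" "p \<le> 1"
    and c0: "c0 = 8 * (real l + 2 + c)"
    and h1: "(1 - p) ^ l \<ge> c0 * ln (real n) / real n"
    and h2: "p * (1 - p) ^ (l - 1) \<ge> c0 * ln (real n) / real n"
  shows "1 - real n powr (- c) \<le> measure_pmf.prob (Gnp n p)
     {E. Ind n E (l - 1) \<noteq> {} \<and>
       1 / (8 * real l * (1 + norm_const)) * sqrt (real n * (1 - p) ^ l / p) \<le> vartheta l n E \<and>
       vartheta l n E \<le> real l * (1 + norm_const) * sqrt (real n * (1 - p) ^ l / p)}"
    (is "_ \<le> measure_pmf.prob _ ?T")
proof -
  define q where "q = 1 - p"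
  define d where "d = real n * (p * q ^ l)"
  have n0: "0 < real n" using n by simp
  have "ln 2 \<le> ln (real n)" using n by (intro ln_mono) auto
  then have ln: "2/3 \<le> ln (real n)" using ln2_ge_two_thirds by linarith
  have c0_ge: "8 * real l \<le> c0" "16 \<le> c0" using c l by (simp_all add: c0)
  have "c0 * (2/3) \<le> c0 * ln (real n)" using ln c0_ge by (intro mult_left_mono) linarith+
  then have L: "2 * real l \<le> c0 * ln (real n)" "8 \<le> c0 * ln (real n)" using c0_ge by linarith+
  have a1: "c0 * ln (real n) \<le> real n * q ^ l"
    using h1 n0 by (simp add: q_def divide_le_eq mult.commute)
  have a2: "c0 * ln (real n) \<le> real n * (p * q ^ (l - 1))"
    using h2 n0 by (simp add: q_def divide_le_eq mult.commute)
  have p0: "0 < p"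
  proof (rule ccontr)
    assume "\<not> 0 < p"
    then have "p = 0" using p by simp
    then show False using a2 L by simp
  qed
  have p1: "p < 1"
  proof (rule ccontr)
    assume "\<not> p < 1"
    then have "q = 0" using p by (simp add: q_def)
    then show False using a1 L l by (simp add: power_0_left)
  qed
  have q: "0 < q" "q < 1" using p0 p1 by (simp_all add: q_def)
  have "q ^ l \<le> 1" using q by (intro power_le_one) auto
  then have "real n * q ^ l \<le> real n" using n0 by (simp add: mult_le_cancel_left1)
  \<comment> \<open>From \<open>n \<ge> n * q ^ l \<ge> c0 * ln n\<close>. It leaves at least half
    of the vertices outside any \<open>l\<close>-set, as the tail bound requires.\<close>
  then have ln2: "2 * l \<le> n" using a1 L(1) by linarith
  have ql: "q * q ^ (l - 1) = q ^ l" using l by (simp flip: power_Suc)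
  \<comment> \<open>\<open>d\<close> equals both \<open>p * (n * q ^ l)\<close> and
    \<open>q * (n * p * q ^ (l - 1))\<close>, and one of \<open>p\<close>, \<open>q\<close> is at
    least \<open>1/2\<close>.\<close>
  have d_ge: "c0 * ln (real n) / 2 \<le> d"
  proof (cases "1/2 \<le> p")
    case True
    have "1/2 * (c0 * ln (real n)) \<le> p * (real n * q ^ l)" by (rule mult_mono) (use True a1 L(2) in simp_all)
    then show ?thesis by (simp add: d_def mult.left_commute)
  next
    case False
    then have "1/2 * (c0 * ln (real n)) \<le> q * (real n * (p * q ^ (l - 1)))"
      by (intro mult_mono[of "1/2" q "c0 * ln (real n)"]) (use a2 L(2) q_def in simp_all)
    also have "\<dots> = real n * (p * (q * q ^ (l - 1)))" by (simp add: mult_ac)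
    finally show ?thesis unfolding ql d_def by simp
  qed
  define KK where "KK = {K. K \<subseteq> {1..n} \<and> card K = l - 1}"
  define FF where "FF = {F. F \<subseteq> {1..n} \<and> card F = l}"
  define B1 where "B1 K = {E. \<exists>x. norm_const * sqrt d * (\<Sum>a\<in>{1..n}. (x a)\<^sup>2)
      < \<bar>\<Sum>a\<in>{1..n}. \<Sum>b\<in>{1..n}. x a * link_matrix n p K E a b * x b\<bar>}" for K
  define B2 where "B2 F = {E. real (card (nonnbrs n E F)) < real n * q ^ l / 8}" for F
  define B where "B = (\<Union>K\<in>KK. B1 K) \<union> (\<Union>F\<in>FF. B2 F)"
  have KK: "finite KK" "real (card KK) \<le> real n ^ (l - 1)"
    unfolding KK_def using ln2 by (intro card_subsets_le; linarith)+
  have FF: "finite FF" "real (card FF) \<le> real n ^ l"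
    unfolding FF_def using ln2 by (intro card_subsets_le; linarith)+
  define \<delta> where "\<delta> = exp (- (c0 * ln (real n) / 8))"
  have P1: "measure_pmf.prob (Gnp n p) (B1 K) \<le> real n * \<delta>" if "K \<in> KK" for K
  proof -
    have K: "K \<subseteq> {1..n}" "card K + 1 = l" using that l by (auto simp: KK_def)
    have "measure_pmf.prob (Gnp n p) (B1 K) \<le> real n * exp (- d)"
      unfolding B1_def by (rule prob_link_norm[OF p0 p1 K(1)]) (use K(2) d_ge L in \<open>simp_all add: d_def q_def\<close>)
    also have "\<dots> \<le> real n * \<delta>" unfolding \<delta>_def using d_ge L by (intro mult_left_mono) simp_all
    finally show ?thesis .
  qed
  have P2: "measure_pmf.prob (Gnp n p) (B2 F) \<le> \<delta>" if "F \<in> FF" for F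
  proof -
    have F: "F \<subseteq> {1..n}" "card F = l" using that by (auto simp: FF_def)
    have "measure_pmf.prob (Gnp n p) (B2 F) \<le> exp (- (real n * q ^ l / 8))"
      using prob_few_nonnbrs[OF p0 p1 F(1)] F(2) ln2 unfolding B2_def q_def by simp
    also have "\<dots> \<le> \<delta>" unfolding \<delta>_def using a1 by simp
    finally show ?thesis .
  qed
  have "measure_pmf.prob (Gnp n p) B
      \<le> measure_pmf.prob (Gnp n p) (\<Union>K\<in>KK. B1 K) + measure_pmf.prob (Gnp n p) (\<Union>F\<in>FF. B2 F)"
    unfolding B_def by (rule measure_Un_le) simp_all
  also have "\<dots> \<le> (\<Sum>K\<in>KK. measure_pmf.prob (Gnp n p) (B1 K)) + (\<Sum>F\<in>FF. measure_pmf.prob (Gnp n p) (B2 F))"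
    using KK(1) FF(1) by (intro add_mono measure_pmf.finite_measure_subadditive_finite) simp_all
  also have "\<dots> \<le> (\<Sum>K\<in>KK. real n * \<delta>) + (\<Sum>F\<in>FF. \<delta>)"
    by (intro add_mono sum_mono P1 P2)
  also have "\<dots> = real (card KK) * (real n * \<delta>) + real (card FF) * \<delta>" by simp
  also have "\<dots> \<le> real n ^ (l - 1) * (real n * \<delta>) + real n ^ l * \<delta>"
    using KK FF by (intro add_mono mult_right_mono) (simp_all add: \<delta>_def)
  also have "\<dots> = 2 * real n ^ l * \<delta>"
  proof -
    have "real n ^ (l - 1) * real n = real n ^ l" using l by (simp flip: power_Suc2)
    then show ?thesis by (simp add: mult.assoc[symmetric])
  qed
  \<comment> \<open>The factor 2 from the two kinds of failure is paid for by
    \<open>2 \<le> n\<close>, using up one unit of the exponent of \<open>\<delta>\<close>.\<close>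
  also have "\<dots> \<le> real n * real n ^ l * \<delta>"
    using n by (intro mult_right_mono) (simp_all add: \<delta>_def)
  also have "\<dots> = real n powr 1 * real n powr (real l) * real n powr (- (real l + 2 + c))"
  proof -
    have "- (c0 * ln (real n) / 8) = - (real l + 2 + c) * ln (real n)" by (simp add: c0 field_simps)
    then have "\<delta> = real n powr (- (real l + 2 + c))" using n0 by (simp add: \<delta>_def powr_def)
    then show ?thesis using n0 by (simp add: powr_realpow)
  qed
  also have "\<dots> = real n powr (- c - 1)"
  proof -
    have "1 + real l + - (real l + 2 + c) = - c - 1" by simp
    then show ?thesis by (simp only: powr_add[symmetric])
  qed
  also have "\<dots> \<le> real n powr (- c)" using n by (intro powr_mono) auto
  finally have PB: "measure_pmf.prob (Gnp n p) B \<le> real n powr (- c)" .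
  \<comment> \<open>Intersecting with the support supplies
    \<open>E \<subseteq> vertex_pairs n\<close>, which the deterministic part assumes and which the
    complement of \<open>B\<close> alone does not give.\<close>
  have sub: "(- B) \<inter> set_pmf (Gnp n p) \<subseteq> ?T"
  proof
    fix E assume E: "E \<in> (- B) \<inter> set_pmf (Gnp n p)"
    have Ev: "E \<subseteq> vertex_pairs n" using E set_pmf_Gnp[of n p] by blast
    have notB1: "E \<notin> B1 K" if "K \<in> KK" for K using E that unfolding B_def by blast
    have notB2: "E \<notin> B2 F" if "F \<in> FF" for F using E that unfolding B_def by blast
    have norm: "\<bar>\<Sum>a\<in>{1..n}. \<Sum>b\<in>{1..n}. x a * link_matrix n p K E a b * x b\<bar>
        \<le> norm_const * sqrt (real n * (p * (1 - p) ^ l)) * (\<Sum>a\<in>{1..n}. (x a)\<^sup>2)"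
      if "K \<subseteq> {1..n}" "card K = l - 1" for K x
    proof -
      have "E \<notin> B1 K" using that by (intro notB1) (simp add: KK_def)
      then show ?thesis unfolding B1_def d_def q_def mem_Collect_eq not_ex not_less by blast
    qed
    have ext: "real n * (1 - p) ^ l / 8 \<le> real (card (nonnbrs n E F))"
      if "F \<subseteq> {1..n}" "card F = l" for F
    proof -
      have "E \<notin> B2 F" using that by (intro notB2) (simp add: FF_def)
      then show ?thesis unfolding B2_def q_def mem_Collect_eq not_less .
    qed
    have ln': "l \<le> n" using ln2 by linarith
    have big: "1 \<le> real n * (1 - p) ^ l" "1 \<le> real n * (p * (1 - p) ^ (l - 1))"
      using a1 a2 L(2) unfolding q_def by linarith+
    note bounds = vartheta_bounds_of_quasirandom[OF Ev l ln' p0 p1 big norm_const_pos norm ext]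
    show "E \<in> ?T" using bounds by blast
  qed
  have "1 - real n powr (- c) \<le> 1 - measure_pmf.prob (Gnp n p) B" using PB by simp
  also have "\<dots> = measure_pmf.prob (Gnp n p) (- B)"
    using measure_pmf.prob_compl[of B "Gnp n p"] by (simp add: Compl_eq_Diff_UNIV)
  also have "\<dots> = measure_pmf.prob (Gnp n p) ((- B) \<inter> set_pmf (Gnp n p))"
    by (rule measure_Int_set_pmf[symmetric])
  also have "\<dots> \<le> measure_pmf.prob (Gnp n p) ?T"
    using sub by (rule measure_pmf.finite_measure_mono) simp
  finally show ?thesis .
qed

theorem theorem9p5:
  shows "\<forall>l::nat. l \<ge> 1 \<longrightarrow> (\<forall>c::real. c > 0 \<longrightarrow>
    (\<exists>c0 c1 c2 :: real. c0 > 0 \<and> c1 > 0 \<and> c2 > 0 \<and>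
      (\<forall>(n::nat) (p::real). n \<ge> 1 \<longrightarrow> 0 \<le> p \<longrightarrow> p \<le> 1 \<longrightarrow>
         (1 - p) ^ l \<ge> c0 * ln (real n) / real n \<longrightarrow>
         p * (1 - p) ^ (l - 1) \<ge> c0 * ln (real n) / real n \<longrightarrow>
         measure_pmf.prob (Gnp n p)
           {E. Ind n E (l - 1) \<noteq> {} \<and>
               c1 * sqrt (real n * (1 - p) ^ l / p) \<le> vartheta l n E \<and>
               vartheta l n E \<le> c2 * sqrt (real n * (1 - p) ^ l / p)}
         \<ge> 1 - real n powr (- c))))"
proof (intro allI impI)
  fix l :: nat and c :: real
  assume l: "1 \<le> l" and c: "0 < c"
  define c0 where "c0 = 8 * (real l + 2 + c)"
  define c1 where "c1 = 1 / (8 * real l * (1 + norm_const))"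
  define c2 where "c2 = real l * (1 + norm_const)"
  have pos: "0 < c0" "0 < c1" "0 < c2"
    using l c norm_const_pos by (simp_all add: c0_def c1_def c2_def add_pos_pos)
  have main: "1 - real n powr (- c) \<le> measure_pmf.prob (Gnp n p)
           {E. Ind n E (l - 1) \<noteq> {} \<and>
               c1 * sqrt (real n * (1 - p) ^ l / p) \<le> vartheta l n E \<and>
               vartheta l n E \<le> c2 * sqrt (real n * (1 - p) ^ l / p)}"
    if "1 \<le> n" "0 \<le> p" "p \<le> 1" "(1 - p) ^ l \<ge> c0 * ln (real n) / real n"
      "p * (1 - p) ^ (l - 1) \<ge> c0 * ln (real n) / real n" for n :: nat and p
  proof (cases "n = 1")
    \<comment> \<open>Since \<open>ln 1 = 0\<close> the hypotheses carry no information for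
      \<open>n = 1\<close>, but the claimed probability \<open>1 - 1 powr (- c)\<close> is
      0.\<close>
    case True
    then show ?thesis by simp
  next
    case False
    then have "2 \<le> n" using that(1) by simp
    then show ?thesis
      unfolding c1_def c2_def by (rule vartheta_Gnp_bounds[OF l c _ that(2,3) c0_def that(4,5)])
  qed
  show "\<exists>c0 c1 c2 :: real. c0 > 0 \<and> c1 > 0 \<and> c2 > 0 \<and>
      (\<forall>(n::nat) (p::real). n \<ge> 1 \<longrightarrow> 0 \<le> p \<longrightarrow> p \<le> 1 \<longrightarrow>
         (1 - p) ^ l \<ge> c0 * ln (real n) / real n \<longrightarrow>
         p * (1 - p) ^ (l - 1) \<ge> c0 * ln (real n) / real n \<longrightarrow>
         measure_pmf.prob (Gnp n p)
           {E. Ind n E (l - 1) \<noteq> {} \<and>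
               c1 * sqrt (real n * (1 - p) ^ l / p) \<le> vartheta l n E \<and>
               vartheta l n E \<le> c2 * sqrt (real n * (1 - p) ^ l / p)}
         \<ge> 1 - real n powr (- c))"
    by (intro exI[of _ c0] exI[of _ c1] exI[of _ c2] conjI pos allI impI main)
qed

end
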